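(* Let $s\ge1$, $k\in\{1,\dots,n\}$, $\epsilon,\delta\in(0,1)$, and suppose that $m\ge\frac{3\nu^{(1)}}{c_{A,k,s}\delta^2}\log\frac{4k}{\epsilon}$ if the sampling follows regime 1, or that $m_t\ge\frac{3\nu^{(2)}(t)}{c_{A,k,s}\delta^2}\log\frac{4k}{\epsilon}$ for all $t=0,\dots,s-1$ if the sampling follows regime 2. Put $M=\sum_{t=0}^{s-1}m_t$ (with $m_t=m$ in regime 1). For data $z\in\mathbb R^{M}$ consider the least squares problem $$w_{\mathrm{aug}}^*\in\arg\min_{\widetilde w\in\mathrm{span}(\widetilde U_k)}\|\mathcal W\mathcal P(\mathcal S\pi_{A,s}(\widetilde w)-z)\|_2 .\qquad(\ast)$$ With probability at least $1-\epsilon$ (over the random sampling), the following holds for all $w_{\mathrm{aug}}\in\mathrm{span}(\widetilde U_k)$ and all $e\in\mathbb R^{M}$: 1. If $w_{\mathrm{aug}}^*$ is the solution of $(\ast)$ with $z=\mathcal S\pi_{A,s}(w_{\mathrm{aug}})+e$, then $$\|w_{\mathrm{aug}}^*-w_{\mathrm{aug}}\|_2\le\frac{2}{\sqrt{(1-\delta)c_{A,k,s}}}\,\|\mathcal W\mathcal Pe\|_2 .$$ 2. There exists some particular vector $\widetilde e\in\mathbb R^{M}$ such that the solution $w_{\mathrm{aug}}^*$ of $(\ast)$ with $z=\mathcal S\pi_{A,s}(w_{\mathrm{aug}})+\widetilde e$ satisfies $$\|w_{\mathrm{aug}}^*-w_{\mathrm{aug}}\|_2\ge\frac{1}{\sqrt{(1+\delta)C_{A,k,s}}}\,\|\mathcal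 W\mathcal P\widetilde e\|_2 .$$
   Context: Graph setting. $\mathcal G$ is a simple undirected weighted graph on $n$ nodes with symmetric weighted adjacency matrix $W\in\mathbb R^{n\times n}$ (positive weights on edges, $0$ otherwise), degree matrix $D=\mathrm{diag}(\sum_jW(i,j))_{i}$ with positive diagonal entries, and normalized Laplacian $L=I-D^{-1/2}WD^{-1/2}$. Fix an eigendecomposition $L=U\Theta U^\top$ with $U\in\mathbb R^{n\times n}$ orthogonal and $\Theta=\mathrm{diag}(\theta_1,\dots,\theta_n)$, $0=\theta_1\le\dots\le\theta_n$. The known operator $A\in\mathbb R^{n\times n}$ has the form $A=U\Lambda U^\top$ with $\Lambda=\mathrm{diag}(\lambda_1,\dots,\lambda_n)$ real diagonal. Let $U_k=U(:,1{:}k)$ be the matrix of the first $k$ columns of $U$, $\Lambda_k=\mathrm{diag}(\lambda_1,\dots,\lambda_k)$, $\Lambda_k^0=I$, $\bar\Lambda_k^0=\mathbf 0$ and $\bar\Lambda_k^t=\sum_{j=0}^{t-1}\Lambda_k^j$ for $t\ge1$. Let $\widetilde U_k=\begin{bmatrix}U_k&\mathbf 0\\ \mathbf 0&U_k\end{bmatrix}\in\mathbb R^{2n\times 2k}$; $\mathrm{span}$ denotes column space. Operator $\pi_{A,s}$. The integer $s\ge1$ is the number of sampling times $0,\dots,s-1$. $\pi_{A,s}:\mathbb R^{2n}\to\mathbb R^{sn}$ is the linear map whose $t$-th block ($t=0,\dots,s-1$) of length $n$ is $U_k\begin{bmatrix}\Lambda_k^t&\bar\Lambda_k^t\end{bmatrix}\widetilde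 U_k^\top v$. (If $w_{\mathrm{aug}}=\begin{bmatrix}x_0\\ w\end{bmatrix}$ with $x_0,w\in\mathrm{span}(U_k)$ and $x_{t+1}=Ax_t+w$, then $\pi_{A,s}(w_{\mathrm{aug}})$ stacks $x_0,\dots,x_{s-1}$.) Constants. Let $Y=\sum_{t=0}^{s-1}\begin{bmatrix}\Lambda_k^{t}\\ \bar\Lambda_k^{t}\end{bmatrix}\begin{bmatrix}\Lambda_k^{t}&\bar\Lambda_k^{t}\end{bmatrix}\in\mathbb R^{2k\times2k}$. Then $c_{A,k,s}:=\lambda_{\min}(Y)$ and $C_{A,k,s}:=\lambda_{\max}(Y)$; these are the constants in the bounds $c_{A,k,s}\|v\|^2\le\|\pi_{A,s}(v)\|^2\le C_{A,k,s}\|v\|^2$ for $v\in\mathrm{span}(\widetilde U_k)$, where $\|\cdot\|$ is the Euclidean norm. Sampling. For each $t$, $\mathbf p_t$ is a probability distribution on $[n]=\{1,\dots,n\}$ with $\mathbf p_t(i)>0$ for all $i$. At time $t$, the sampled nodes are $\Omega_t=\{\omega_{1,t},\dots,\omega_{m_t,t}\}$ (with repetitions allowed). Regime 1: all $\mathbf p_t$ equal $\mathbf p_0$, $m_t=m$, and one set of $m$ indices is drawn i.i.d. (with replacement) from $\mathbf p_0$ and used at every time, i.e. $\omega_{j,t}=\omega_j$ for all $t$. Regime 2: at each time $t$, $m_t$ indices are drawn independently with replacement from $\mathbf p_t$, independently across times. $S_t\in\mathbb R^{m_t\times n}$ is the matrix with $S_t(i,j)=1$ if $j=\omega_{i,t}$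 and $0$ otherwise. $M_t=\frac1{\sqrt{m_t}}I\in\mathbb R^{m_t\times m_t}$, $P_{\Omega_t}=\mathrm{diag}(\mathbf p_t(\omega_{1,t}),\dots,\mathbf p_t(\omega_{m_t,t}))$. $\mathcal W$, $\mathcal P$, $\mathcal S$ are block diagonal with diagonal blocks $M_t$, $P_{\Omega_t}^{-1/2}$, $S_t$ ($t=0,\dots,s-1$) respectively. Graph spectral weighted coherence. With $\delta_\ell$ the $\ell$-th standard basis vector of $\mathbb R^n$ and $\|\cdot\|_2$ the spectral norm for matrices and the Euclidean norm for vectors, $$\nu^{(1)}=\max_{1\le\ell\le n}\frac1{\mathbf p_0(\ell)}\left\|\sum_{t=0}^{s-1}\begin{bmatrix}\Lambda_k^t\\ \bar\Lambda_k^t\end{bmatrix}U_k^\top\delta_\ell\delta_\ell^\top U_k\begin{bmatrix}\Lambda_k^t&\bar\Lambda_k^t\end{bmatrix}\right\|_2,\qquad \nu^{(2)}(t)=\max_{1\le\ell\le n}\frac1{\mathbf p_t(\ell)}\left\|\delta_\ell^\top U_k\begin{bmatrix}\Lambda_k^t&\bar\Lambda_k^t\end{bmatrix}\right\|_2^2 .$$ *)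

theory Defs
  imports
    "HOL-Probability.Probability"
    "Jordan_Normal_Form.Matrix"
    "Jordan_Normal_Form.VS_Connect"
    "Jordan_Normal_Form.Spectral_Radius"
begin

(* Nodes, matrix indices and sampling indices are counted from 0 throughout. *)

definition enorm :: "real Matrix.vec \<Rightarrow> real" where
  "enorm v = sqrt (v \<bullet> v)"

definition spectral_norm :: "real Matrix.mat \<Rightarrow> real" where
  "spectral_norm B =
     (SUP v \<in> {v \<in> carrier_vec (dim_col B). enorm v \<le> 1}. enorm (B *\<^sub>v v))"

definition mat_sum ::
    "nat \<Rightarrow> nat \<Rightarrow> ('i \<Rightarrow> real Matrix.mat) \<Rightarrow> 'i set \<Rightarrow> real Matrix.mat" where
  "mat_sum nr nc F I = Matrix.mat nr nc (\<lambda>ij. \<Sum>t\<in>I. F t $$ ij)"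

(* The block row [B C]; the block column is append_rows. *)
definition append_cols :: "real Matrix.mat \<Rightarrow> real Matrix.mat \<Rightarrow> real Matrix.mat" where
  "append_cols B C =
     four_block_mat B C (0\<^sub>m 0 (dim_col B)) (0\<^sub>m 0 (dim_col C))"

definition degree_of :: "nat \<Rightarrow> real Matrix.mat \<Rightarrow> nat \<Rightarrow> real" where
  "degree_of n W i = (\<Sum>j<n. W $$ (i, j))"

definition weighted_graph :: "nat \<Rightarrow> real Matrix.mat \<Rightarrow> bool" where
  "weighted_graph n W \<longleftrightarrow>
     W \<in> carrier_mat n n \<and>
     (\<forall>i<n. \<forall>j<n. W $$ (i, j) = W $$ (j, i) \<and> 0 \<le> W $$ (i, j)) \<and>
     (\<forall>i<n. W $$ (i, i) = 0) \<and>
     (\<forall>i<n. 0 < degree_of n W i)"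

definition normalized_laplacian :: "nat \<Rightarrow> real Matrix.mat \<Rightarrow> real Matrix.mat" where
  "normalized_laplacian n W =
     (let Dinv = mat_diag n (\<lambda>i. 1 / sqrt (degree_of n W i)) in 1\<^sub>m n - Dinv * W * Dinv)"

(* U is required to be orthonormal: the library's orthogonal_mat would allow
   columns of any nonzero length. *)
definition ordered_eigendecomposition ::
    "nat \<Rightarrow> real Matrix.mat \<Rightarrow> real Matrix.mat \<Rightarrow> (nat \<Rightarrow> real) \<Rightarrow> bool" where
  "ordered_eigendecomposition n L U \<theta> \<longleftrightarrow>
     U \<in> carrier_mat n n \<and>
     transpose_mat U * U = 1\<^sub>m n \<and> U * transpose_mat U = 1\<^sub>m n \<and>
     L = U * mat_diag n \<theta> * transpose_mat U \<and>
     \<theta> 0 = 0 \<and> (\<forall>i j. i \<le> j \<longrightarrow> j < n \<longrightarrow> \<theta> i \<le> \<theta> j)"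

definition first_cols :: "nat \<Rightarrow> real Matrix.mat \<Rightarrow> real Matrix.mat" where
  "first_cols k U = Matrix.mat (dim_row U) k (\<lambda>(i, j). U $$ (i, j))"

definition U_tilde :: "nat \<Rightarrow> nat \<Rightarrow> real Matrix.mat \<Rightarrow> real Matrix.mat" where
  "U_tilde n k U = four_block_mat (first_cols k U) (0\<^sub>m n k) (0\<^sub>m n k) (first_cols k U)"

definition span_U_tilde :: "nat \<Rightarrow> nat \<Rightarrow> real Matrix.mat \<Rightarrow> real Matrix.vec set" where
  "span_U_tilde n k U = vec_space.col_space (2 * n) (U_tilde n k U)"

definition Lam_pow :: "nat \<Rightarrow> (nat \<Rightarrow> real) \<Rightarrow> nat \<Rightarrow> real Matrix.mat" where
  "Lam_pow k lam t = mat_diag k lam ^\<^sub>m t"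

definition Lam_bar :: "nat \<Rightarrow> (nat \<Rightarrow> real) \<Rightarrow> nat \<Rightarrow> real Matrix.mat" where
  "Lam_bar k lam t = mat_sum k k (Lam_pow k lam) {..<t}"

definition Lam_row :: "nat \<Rightarrow> (nat \<Rightarrow> real) \<Rightarrow> nat \<Rightarrow> real Matrix.mat" where
  "Lam_row k lam t = append_cols (Lam_pow k lam t) (Lam_bar k lam t)"

definition Lam_col :: "nat \<Rightarrow> (nat \<Rightarrow> real) \<Rightarrow> nat \<Rightarrow> real Matrix.mat" where
  "Lam_col k lam t = Lam_pow k lam t @\<^sub>r Lam_bar k lam t"

(* Entry i of the stacked vector is entry (i mod n) of the block at time (i div n). *)
definition pi_op ::
    "nat \<Rightarrow> nat \<Rightarrow> nat \<Rightarrow> real Matrix.mat \<Rightarrow> (nat \<Rightarrow> real) \<Rightarrow> real Matrix.vec \<Rightarrow> real Matrix.vec"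
  where
  "pi_op n k s U lam v = Matrix.vec (s * n) (\<lambda>i.
     ((first_cols k U * Lam_row k lam (i div n) * transpose_mat (U_tilde n k U)) *\<^sub>v v)
       $ (i mod n))"

definition Y_mat :: "nat \<Rightarrow> nat \<Rightarrow> (nat \<Rightarrow> real) \<Rightarrow> real Matrix.mat" where
  "Y_mat k s lam = mat_sum (2 * k) (2 * k) (\<lambda>t. Lam_col k lam t * Lam_row k lam t) {..<s}"

definition c_low :: "nat \<Rightarrow> nat \<Rightarrow> (nat \<Rightarrow> real) \<Rightarrow> real" where
  "c_low k s lam = Min (spectrum (Y_mat k s lam))"

definition C_up :: "nat \<Rightarrow> nat \<Rightarrow> (nat \<Rightarrow> real) \<Rightarrow> real" where
  "C_up k s lam = Max (spectrum (Y_mat k s lam))"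

definition nu1 ::
    "nat \<Rightarrow> nat \<Rightarrow> nat \<Rightarrow> real Matrix.mat \<Rightarrow> (nat \<Rightarrow> real) \<Rightarrow> nat pmf \<Rightarrow> real" where
  "nu1 n k s U lam q = (MAX l \<in> {..<n}. 1 / pmf q l *
     spectral_norm (mat_sum (2 * k) (2 * k)
       (\<lambda>t. Lam_col k lam t * transpose_mat (first_cols k U) *
            (mat_of_cols n [unit_vec n l] * mat_of_rows n [unit_vec n l]) *
            first_cols k U * Lam_row k lam t)
       {..<s}))"

(* The row vector delta_l^T B is written as B^T delta_l. *)
definition nu2 ::
    "nat \<Rightarrow> nat \<Rightarrow> real Matrix.mat \<Rightarrow> (nat \<Rightarrow> real) \<Rightarrow> nat pmf \<Rightarrow> nat \<Rightarrow> real" where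
  "nu2 n k U lam q t = (MAX l \<in> {..<n}. 1 / pmf q l *
     (enorm (transpose_mat (first_cols k U * Lam_row k lam t) *\<^sub>v unit_vec n l))\<^sup>2)"

datatype regime = Regime1 | Regime2

(* The law of the sampled indices (\<omega> t j is the j-th node sampled at time t);
   indices outside t < s, j < m t are irrelevant. *)
fun sampling ::
    "regime \<Rightarrow> nat \<Rightarrow> (nat \<Rightarrow> nat) \<Rightarrow> (nat \<Rightarrow> nat pmf) \<Rightarrow> (nat \<Rightarrow> nat \<Rightarrow> nat) pmf" where
  "sampling Regime1 s m p = map_pmf (\<lambda>\<omega> t. \<omega>) (Pi_pmf {..<m 0} 0 (\<lambda>j. p 0))"
| "sampling Regime2 s m p =
     Pi_pmf {..<s} (\<lambda>j. 0) (\<lambda>t. Pi_pmf {..<m t} 0 (\<lambda>j. p t))"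

definition W_cal :: "nat \<Rightarrow> (nat \<Rightarrow> nat) \<Rightarrow> real Matrix.mat" where
  "W_cal s m = diag_block_mat
     (map (\<lambda>t. (1 / sqrt (real (m t))) \<cdot>\<^sub>m 1\<^sub>m (m t)) [0..<s])"

definition P_cal ::
    "nat \<Rightarrow> (nat \<Rightarrow> nat) \<Rightarrow> (nat \<Rightarrow> nat pmf) \<Rightarrow> (nat \<Rightarrow> nat \<Rightarrow> nat) \<Rightarrow> real Matrix.mat" where
  "P_cal s m p \<omega> = diag_block_mat
     (map (\<lambda>t. mat_diag (m t) (\<lambda>j. 1 / sqrt (pmf (p t) (\<omega> t j)))) [0..<s])"

definition S_cal ::
    "nat \<Rightarrow> nat \<Rightarrow> (nat \<Rightarrow> nat) \<Rightarrow> (nat \<Rightarrow> nat \<Rightarrow> nat) \<Rightarrow> real Matrix.mat" where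
  "S_cal n s m \<omega> = diag_block_mat
     (map (\<lambda>t. Matrix.mat (m t) n (\<lambda>(i, j). if j = \<omega> t i then 1 else 0)) [0..<s])"

definition ls_solution ::
    "nat \<Rightarrow> nat \<Rightarrow> nat \<Rightarrow> real Matrix.mat \<Rightarrow> (nat \<Rightarrow> real) \<Rightarrow> (nat \<Rightarrow> nat) \<Rightarrow> (nat \<Rightarrow> nat pmf) \<Rightarrow>
     (nat \<Rightarrow> nat \<Rightarrow> nat) \<Rightarrow> real Matrix.vec \<Rightarrow> real Matrix.vec \<Rightarrow> bool" where
  "ls_solution n k s U lam m p \<omega> z =
     is_arg_min
       (\<lambda>w. enorm ((W_cal s m * P_cal s m p \<omega>) *\<^sub>v (S_cal n s m \<omega> *\<^sub>v pi_op n k s U lam w - z)))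
       (\<lambda>w. w \<in> span_U_tilde n k U)"

end

theory Submission
  imports Defs
begin

text \<open>
  Write an element of the signal space as \<open>Ut v\<close> with \<open>v\<close> of length \<open>2k\<close>. The squared norm of its
  weighted samples is the quadratic form at \<open>v\<close> of a random matrix \<open>X\<close>, a sum of independent
  positive semidefinite matrices whose mean is \<open>Y\<close>. Suppose that
  \<open>(1 - \<delta>) c \<le> X \<le> (1 + \<delta>) C\<close> in the Loewner order. Then the sampled operator is bounded below
  and above on the signal space, and both claims follow without further probability. For the first,
  a minimizer has a residual no larger than that of the true signal, so the triangle inequality
  bounds the weighted samples of the error by twice the weighted noise, and the lower bound on \<open>X\<close>
  turns this into a bound on the error itself. For the second, the samples of any nonzero
  \<open>u\<close> in the signal space serve as noise: the solution moves by exactly \<open>u\<close>, and the upper bound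
  on \<open>X\<close> applies (\<open>reconstruction_of_energy_bounds\<close>).

  The two Loewner bounds hold with probability at least \<open>1 - \<epsilon>\<close> by a matrix Chernoff inequality
  (\<open>matrix_chernoff\<close>), in which each of the two tails costs the dimension \<open>2k\<close> times
  \<open>exp (- c \<delta>\<^sup>2 / (3 R))\<close>, where \<open>R\<close> bounds the single summands. In Regime 2 the summands drawn at
  different times have different, singular means, and only the sum \<open>Y\<close> of these means is positive
  definite. Bounding the exponential moments one summand at a time by their largest eigenvalue
  (the argument from the Golden-Thompson inequality) would therefore lose the constant \<open>c\<close>. What is needed
  is that a summand may be replaced inside the exponential: for \<open>0 \<le> Z \<le> 1\<close> and symmetric \<open>H\<close>,
  \<open>E tr exp (H + \<theta> Z) \<le> tr exp (H + (exp \<theta> - 1) E Z)\<close>. This is \<open>trace_exp_jensen\<close>, a consequence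
  of Lieb's concavity theorem.

  The proof of that inequality goes through the joint convexity of the relative entropy of two positive
  definite matrices. In terms of eigendecompositions, the relative entropy is an integral over
  \<open>u\<close> in \<open>[0, 1]\<close> of \<open>u\<close> times a quantity of chi-square type, and for fixed \<open>u\<close> this quantity is a
  maximum, over auxiliary matrices, of functions that are linear in the pair of matrices. Maxima of
  linear functions are convex, and integration preserves this.
\<close>

unbundle no inner_syntax and no vec_syntax

section \<open>The spectral theorem for symmetric real matrices\<close>

text \<open>
  The functional calculus is only ever applied to explicit eigendecompositions, so no uniqueness
  of eigenvectors or of functions of a matrix has to be established: the decomposition is an
  argument of every notion below.
\<close>

definition eigendecomposition ::
    "nat \<Rightarrow> real Matrix.mat \<Rightarrow> (nat \<Rightarrow> real) \<Rightarrow> real Matrix.mat \<Rightarrow> bool" where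
  "eigendecomposition d Q a A \<longleftrightarrow>
     Q \<in> carrier_mat d d \<and> Q\<^sup>T * Q = 1\<^sub>m d \<and> Q * Q\<^sup>T = 1\<^sub>m d \<and> A = Q * mat_diag d a * Q\<^sup>T"

lemma index_mult_mat_sum:
  "B \<in> carrier_mat nr n \<Longrightarrow> C \<in> carrier_mat n nc \<Longrightarrow> i < nr \<Longrightarrow> j < nc \<Longrightarrow>
     (B * C) $$ (i, j) = (\<Sum>l<n. B $$ (i, l) * C $$ (l, j))"
  by (auto simp: scalar_prod_def lessThan_atLeast0 intro!: sum.cong)

lemma index_mult_vec_sum:
  "B \<in> carrier_mat nr n \<Longrightarrow> v \<in> carrier_vec n \<Longrightarrow> i < nr \<Longrightarrow>
     (B *\<^sub>v v) $ i = (\<Sum>l<n. B $$ (i, l) * v $ l)"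
  by (auto simp: scalar_prod_def lessThan_atLeast0 intro!: sum.cong)

lemma scalar_prod_sum:
  "w \<in> carrier_vec n \<Longrightarrow> v \<bullet> w = (\<Sum>l<n. v $ l * w $ l)"
  by (auto simp: scalar_prod_def lessThan_atLeast0 intro!: sum.cong)

lemma scalar_prod_self_eq_0_iff:
  fixes v :: "real Matrix.vec"
  assumes "v \<in> carrier_vec d"
  shows "v \<bullet> v = 0 \<longleftrightarrow> v = 0\<^sub>v d"
proof -
  have "v \<bullet> v = (\<Sum>l<d. (v $ l)\<^sup>2)"
    using assms by (simp add: scalar_prod_sum power2_eq_square)
  then have "v \<bullet> v = 0 \<longleftrightarrow> (\<forall>l<d. v $ l = 0)"
    by (auto simp: sum_nonneg_eq_0_iff)
  then show ?thesis using assms by (auto intro!: eq_vecI)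
qed

lemma scalar_prod_self_nonneg: "0 \<le> (v :: real Matrix.vec) \<bullet> v"
  by (auto simp: scalar_prod_def intro!: sum_nonneg)

lemma scalar_prod_self_pos:
  fixes v :: "real Matrix.vec"
  assumes "v \<in> carrier_vec d" "v \<noteq> 0\<^sub>v d"
  shows "0 < v \<bullet> v"
  using scalar_prod_self_eq_0_iff[OF assms(1)] assms(2) scalar_prod_self_nonneg[of v] by linarith

text \<open>
  The complexified matrix has an eigenvalue; symmetry forces its imaginary part to vanish, so the
  real and the imaginary part of an eigenvector both solve the real eigenvalue equation, and one of
  them is nonzero.
\<close>

lemma symmetric_real_eigenvector:
  fixes A :: "real Matrix.mat"
  assumes A: "A \<in> carrier_mat d d" and sym: "A\<^sup>T = A" and d: "0 < d"
  shows "\<exists>v l. v \<in> carrier_vec d \<and> v \<noteq> 0\<^sub>v d \<and> A *\<^sub>v v = l \<cdot>\<^sub>v v"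
proof -
  let ?A = "map_mat complex_of_real A"
  have cA: "?A \<in> carrier_mat d d" using A by simp
  obtain l where "eigenvalue ?A l"
    using spectrum_non_empty[OF cA d] by (auto simp: spectrum_def)
  then obtain z where z: "z \<in> carrier_vec d" "z \<noteq> 0\<^sub>v d" and Az: "?A *\<^sub>v z = l \<cdot>\<^sub>v z"
    using A by (auto simp: eigenvalue_def eigenvector_def)
  define x where "x = map_vec Re z"
  define y where "y = map_vec Im z"
  have x: "x \<in> carrier_vec d" and y: "y \<in> carrier_vec d" using z by (auto simp: x_def y_def)
  have Az_i: "(\<Sum>j<d. complex_of_real (A $$ (i, j)) * z $ j) = l * z $ i" if i: "i < d" for i
  proof -
    have "(?A *\<^sub>v z) $ i = (\<Sum>j<d. ?A $$ (i, j) * z $ j)"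
      by (rule index_mult_vec_sum[OF cA z(1) i])
    also have "\<dots> = (\<Sum>j<d. complex_of_real (A $$ (i, j)) * z $ j)"
      using A i by (intro sum.cong) auto
    finally show ?thesis using Az z i by auto
  qed
  have Ax: "A *\<^sub>v x = Re l \<cdot>\<^sub>v x - Im l \<cdot>\<^sub>v y"
  proof (rule eq_vecI)
    fix i assume "i < dim_vec (Re l \<cdot>\<^sub>v x - Im l \<cdot>\<^sub>v y)"
    then have i: "i < d" using y by auto
    have "(A *\<^sub>v x) $ i = (\<Sum>j<d. A $$ (i, j) * Re (z $ j))"
      unfolding index_mult_vec_sum[OF A x i] using z by (intro sum.cong) (auto simp: x_def)
    also have "\<dots> = Re (\<Sum>j<d. complex_of_real (A $$ (i, j)) * z $ j)" by simp
    finally show "(A *\<^sub>v x) $ i = (Re l \<cdot>\<^sub>v x - Im l \<cdot>\<^sub>v y) $ i"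
      using i z by (simp add: Az_i x_def y_def)
  qed (use A x y in auto)
  have Ay: "A *\<^sub>v y = Re l \<cdot>\<^sub>v y + Im l \<cdot>\<^sub>v x"
  proof (rule eq_vecI)
    fix i assume "i < dim_vec (Re l \<cdot>\<^sub>v y + Im l \<cdot>\<^sub>v x)"
    then have i: "i < d" using x by auto
    have "(A *\<^sub>v y) $ i = (\<Sum>j<d. A $$ (i, j) * Im (z $ j))"
      unfolding index_mult_vec_sum[OF A y i] using z by (intro sum.cong) (auto simp: y_def)
    also have "\<dots> = Im (\<Sum>j<d. complex_of_real (A $$ (i, j)) * z $ j)" by simp
    finally show "(A *\<^sub>v y) $ i = (Re l \<cdot>\<^sub>v y + Im l \<cdot>\<^sub>v x) $ i"
      using i z by (simp add: Az_i x_def y_def)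
  qed (use A x y in auto)
  have "(A *\<^sub>v x) \<bullet> y = x \<bullet> (A *\<^sub>v y)"
    using transpose_vec_mult_scalar[OF A y x] sym A x y
      by (metis comm_scalar_prod mult_mat_vec_carrier)
  then have "Re l * (x \<bullet> y) - Im l * (y \<bullet> y) = Re l * (x \<bullet> y) + Im l * (x \<bullet> x)"
    using x y unfolding Ax Ay
    by (simp add: minus_scalar_prod_distrib[of _ d] scalar_prod_add_distrib[of _ d] comm_scalar_prod[of y d x])
  then have *: "Im l * (x \<bullet> x + y \<bullet> y) = 0" by (simp add: algebra_simps)
  have nz: "x \<noteq> 0\<^sub>v d \<or> y \<noteq> 0\<^sub>v d"
  proof (rule ccontr)
    assume "\<not> ?thesis"
    then have 0: "map_vec Re z = 0\<^sub>v d" "map_vec Im z = 0\<^sub>v d" by (auto simp: x_def y_def)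
    have "z $ i = 0" if "i < d" for i
      using arg_cong[OF 0(1), of "\<lambda>v. v $ i"] arg_cong[OF 0(2), of "\<lambda>v. v $ i"] that z
      by (simp add: complex_eq_iff)
    then have "z = 0\<^sub>v d" using z by (intro eq_vecI) auto
    then show False using z by simp
  qed
  then have "x \<bullet> x + y \<bullet> y \<noteq> 0"
    using scalar_prod_self_pos[OF x] scalar_prod_self_pos[OF y]
      scalar_prod_self_nonneg[of x] scalar_prod_self_nonneg[of y] by fastforce
  then have "Im l = 0" using * by simp
  then have "A *\<^sub>v x = Re l \<cdot>\<^sub>v x" "A *\<^sub>v y = Re l \<cdot>\<^sub>v y"
    unfolding Ax Ay using x y by auto
  then show ?thesis using nz x y by blast
qed

text \<open>
  The reflection that exchanges \<open>v\<close> and the first unit vector extends \<open>v\<close> to an orthonormal basis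
  without an orthogonalization procedure.
\<close>

lemma householder_reflection:
  fixes v :: "real Matrix.vec"
  assumes v: "v \<in> carrier_vec d" "v \<bullet> v = 1" and d: "0 < d"
  obtains Q where "Q \<in> carrier_mat d d" "Q\<^sup>T = Q" "Q * Q = 1\<^sub>m d" "Q *\<^sub>v unit_vec d 0 = v"
proof (cases "v = unit_vec d 0")
  case True
  show ?thesis by (rule that[of "1\<^sub>m d"]) (use True in auto)
next
  case False
  define u where "u = v - unit_vec d 0"
  have u: "u \<in> carrier_vec d" using v by (auto simp: u_def)
  define c where "c = u \<bullet> u"
  have "u \<noteq> 0\<^sub>v d"
  proof
    assume u0: "u = 0\<^sub>v d"
    have "v $ i = unit_vec d 0 $ i" if "i < d" for i
      using that arg_cong[OF u0, of "\<lambda>w. w $ i"] v by (simp add: u_def)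
    then show False using False v by (auto intro!: eq_vecI)
  qed
  then have c: "c > 0" unfolding c_def by (rule scalar_prod_self_pos[OF u])
  have c_sum: "c = (\<Sum>l<d. u $ l * u $ l)" unfolding c_def by (rule scalar_prod_sum[OF u])
  (* |v| = 1 makes |u|^2 = 2 - 2 v_0, which fixes the first coordinate of u. *)
  have "c = v \<bullet> v - v \<bullet> unit_vec d 0 - (unit_vec d 0 \<bullet> v - unit_vec d 0 \<bullet> unit_vec d 0)"
    unfolding c_def u_def using v
    by (simp add: minus_scalar_prod_distrib[of _ d] scalar_prod_minus_distrib[of _ d])
  then have u0: "u $ 0 = - c / 2" using v d by (simp add: u_def)
  have v0: "v $ 0 = 1 - c / 2" using u0 v d by (simp add: u_def)
  define Q where "Q = Matrix.mat d d (\<lambda>(i, j). (if i = j then 1 else 0) - 2 / c * u $ i * u $ j)"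
  have Q: "Q \<in> carrier_mat d d" by (simp add: Q_def)
  have "Q\<^sup>T = Q" by (rule eq_matI) (auto simp: Q_def)
  moreover have "Q * Q = 1\<^sub>m d"
  proof (rule eq_matI)
    fix i j assume "i < dim_row (1\<^sub>m d :: real Matrix.mat)" "j < dim_col (1\<^sub>m d :: real Matrix.mat)"
    then have ij: "i < d" "j < d" by auto
    have "(Q * Q) $$ (i, j) = (\<Sum>l<d. Q $$ (i, l) * Q $$ (l, j))"
      by (rule index_mult_mat_sum[OF Q Q ij])
    also have "\<dots> = (\<Sum>l<d. (if i = l then (if l = j then 1 else 0) else 0)
        - (if i = l then 2 / c * u $ l * u $ j else 0) - (if l = j then 2 / c * u $ i * u $ l else 0)
        + 4 / c\<^sup>2 * u $ i * u $ j * (u $ l * u $ l))"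
      using ij by (intro sum.cong) (auto simp: Q_def algebra_simps power2_eq_square)
    also have "\<dots> = (if i = j then 1 else 0) - 4 / c * u $ i * u $ j + 4 / c\<^sup>2 * u $ i * u $ j * c"
      using ij unfolding c_sum by (simp add: sum.distrib sum_subtractf sum.delta sum.delta' sum_distrib_left)
    also have "\<dots> = (1\<^sub>m d) $$ (i, j)"
      using ij c by (simp add: power2_eq_square)
    finally show "(Q * Q) $$ (i, j) = (1\<^sub>m d) $$ (i, j)" .
  qed (use Q in auto)
  moreover have "Q *\<^sub>v unit_vec d 0 = v"
  proof (rule eq_vecI)
    fix i assume "i < dim_vec v"
    then have i: "i < d" using v by auto
    have "(Q *\<^sub>v unit_vec d 0) $ i = Q $$ (i, 0)"
      using i d Q by (simp)
    also have "\<dots> = v $ i"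
      using i d v c by (auto simp: Q_def u0 v0) (auto simp: u_def)
    finally show "(Q *\<^sub>v unit_vec d 0) $ i = v $ i" .
  qed (use v Q in auto)
  ultimately show ?thesis using that Q by blast
qed

text \<open>
  Induction on the dimension: conjugation by a Householder reflection moves a unit eigenvector to the first
  coordinate, and symmetry then splits off a symmetric matrix of dimension one less.
\<close>

theorem symmetric_eigendecomposition:
  fixes A :: "real Matrix.mat"
  assumes "A \<in> carrier_mat d d" "A\<^sup>T = A"
  shows "\<exists>Q a. eigendecomposition d Q a A"
  using assms
proof (induction d arbitrary: A)
  case 0
  show ?case
    by (rule exI[of _ "1\<^sub>m 0"], rule exI[of _ "\<lambda>_. 0"])
       (use 0 in \<open>auto simp: eigendecomposition_def intro!: eq_matI\<close>)
next
  case (Suc e)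
  note A = Suc.prems(1) and sym = Suc.prems(2)
  let ?d = "Suc e"
  let ?e0 = "unit_vec ?d 0 :: real Matrix.vec"
  obtain w l where w: "w \<in> carrier_vec ?d" "w \<noteq> 0\<^sub>v ?d" and Aw: "A *\<^sub>v w = l \<cdot>\<^sub>v w"
    using symmetric_real_eigenvector[OF A sym] by auto
  define v where "v = (1 / sqrt (w \<bullet> w)) \<cdot>\<^sub>v w"
  have ww: "w \<bullet> w > 0" by (rule scalar_prod_self_pos[OF w])
  have v: "v \<in> carrier_vec ?d" "v \<bullet> v = 1"
    using w ww by (auto simp: v_def)
  have Av: "A *\<^sub>v v = l \<cdot>\<^sub>v v"
    using A w Aw by (simp add: v_def mult_mat_vec smult_smult_assoc mult.commute)
  obtain H where H: "H \<in> carrier_mat ?d ?d" "H\<^sup>T = H" "H * H = 1\<^sub>m ?d" "H *\<^sub>v ?e0 = v"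
    using householder_reflection[OF v] by auto
  define B where "B = H * A * H"
  have B: "B \<in> carrier_mat ?d ?d" using H A by (simp add: B_def)
  have Bsym: "B\<^sup>T = B"
    using H A sym unfolding B_def by (simp add: transpose_mult[of _ ?d ?d _ ?d])
  have Hv: "H *\<^sub>v v = ?e0"
    using H by (metis assoc_mult_mat_vec one_mult_mat_vec unit_vec_carrier)
  have Be: "B *\<^sub>v ?e0 = l \<cdot>\<^sub>v ?e0"
    using H A v Av Hv by (simp add: B_def assoc_mult_mat_vec[of _ ?d ?d _ ?d] mult_mat_vec[of _ ?d ?d])
  have B0: "B $$ (i, 0) = (if i = 0 then l else 0)" if "i < ?d" for i
    using arg_cong[OF Be, of "\<lambda>v. v $ i"] that B by (auto simp: index_unit_vec)
  have B0': "B $$ (0, i) = (if i = 0 then l else 0)" if "i < ?d" for i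
    using B0[OF that] Bsym B that by (metis carrier_matD index_transpose_mat(1) zero_less_Suc)
  define B' where "B' = Matrix.mat e e (\<lambda>(i, j). B $$ (Suc i, Suc j))"
  have B': "B' \<in> carrier_mat e e" by (simp add: B'_def)
  have B'sym: "B'\<^sup>T = B'"
  proof (rule eq_matI)
    fix i j assume "i < dim_row B'" "j < dim_col B'"
    then have ij: "i < e" "j < e" by (auto simp: B'_def)
    have "B $$ (Suc j, Suc i) = B\<^sup>T $$ (Suc i, Suc j)" using ij B by simp
    then show "B'\<^sup>T $$ (i, j) = B' $$ (i, j)" using ij Bsym by (simp add: B'_def)
  qed (auto simp: B'_def)
  obtain Q' b where Q': "eigendecomposition e Q' b B'"
    using Suc.IH[OF B' B'sym] by auto
  define P where "P = four_block_mat (1\<^sub>m 1) (0\<^sub>m 1 e) (0\<^sub>m e 1) Q'"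
  define a where "a i = (case i of 0 \<Rightarrow> l | Suc j \<Rightarrow> b j)" for i
  have Q'c: "Q' \<in> carrier_mat e e" and Q'o: "Q'\<^sup>T * Q' = 1\<^sub>m e" "Q' * Q'\<^sup>T = 1\<^sub>m e"
    and Q'B: "B' = Q' * mat_diag e b * Q'\<^sup>T"
    using Q' by (auto simp: eigendecomposition_def)
  have P: "P \<in> carrier_mat ?d ?d" using Q'c unfolding P_def
    using four_block_carrier_mat[of "1\<^sub>m 1" 1 1 Q' e e] by simp
  have PT: "P\<^sup>T = four_block_mat (1\<^sub>m 1) (0\<^sub>m 1 e) (0\<^sub>m e 1) (Q'\<^sup>T)"
    unfolding P_def by (subst transpose_four_block_mat[of _ 1 1 _ e _ e]) (use Q'c in auto)
  have one: "four_block_mat (1\<^sub>m 1) (0\<^sub>m 1 e) (0\<^sub>m e 1) (1\<^sub>m e) = (1\<^sub>m ?d :: real Matrix.mat)"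
    by (rule eq_matI) auto
  have PTP: "P\<^sup>T * P = 1\<^sub>m ?d" unfolding PT unfolding P_def
    by (subst mult_four_block_mat[of _ 1 1 _ e _ e _ _ 1 _ e]) (use Q'c Q'o one in auto)
  have PPT: "P * P\<^sup>T = 1\<^sub>m ?d" unfolding PT unfolding P_def
    by (subst mult_four_block_mat[of _ 1 1 _ e _ e _ _ 1 _ e]) (use Q'c Q'o one in auto)
  obtain L E where LE: "L = mat_diag 1 (\<lambda>_. l)" "E = mat_diag e b"
    and L: "L \<in> carrier_mat 1 1" and E: "E \<in> carrier_mat e e" by simp
  have D: "mat_diag ?d a = four_block_mat L (0\<^sub>m 1 e) (0\<^sub>m e 1) E"
    by (rule eq_matI) (auto simp: LE mat_diag_def a_def split: nat.splits)
  have PD: "P * mat_diag ?d a = four_block_mat L (0\<^sub>m 1 e) (0\<^sub>m e 1) (Q' * E)"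
    unfolding D P_def
    by (subst mult_four_block_mat[of _ 1 1 _ e _ e _ _ 1 _ e]) (use Q'c L E in auto)
  have "P * mat_diag ?d a * P\<^sup>T = four_block_mat L (0\<^sub>m 1 e) (0\<^sub>m e 1) B'"
    unfolding PD PT Q'B LE(2)[symmetric]
    by (subst mult_four_block_mat[of _ 1 1 _ e _ e _ _ 1 _ e]) (use Q'c L E in auto)
  also have "\<dots> = B"
  proof (rule eq_matI)
    fix i j assume ij: "i < dim_row B" "j < dim_col B"
    show "four_block_mat L (0\<^sub>m 1 e) (0\<^sub>m e 1) B' $$ (i, j) = B $$ (i, j)"
      using ij B B0[of i] B0'[of j] by (auto simp: B'_def mat_diag_def LE)
  qed (use B B' L in auto)
  finally have PB: "B = P * mat_diag ?d a * P\<^sup>T" ..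
  have HBH: "A = H * B * H"
  proof -
    have "H * B * H = (H * H) * A * (H * H)"
      using H(1) A by (simp add: B_def assoc_mult_mat[of _ ?d ?d _ ?d _ ?d])
    then show ?thesis using H A by simp
  qed
  have HX: "H * (H * X) = X" if "X \<in> carrier_mat ?d ?d" for X
    using that H assoc_mult_mat[of H ?d ?d H ?d X ?d] by simp
  have PX: "P * (P\<^sup>T * X) = X" "P\<^sup>T * (P * X) = X" if "X \<in> carrier_mat ?d ?d" for X
    using that P PPT PTP assoc_mult_mat[of P ?d ?d "P\<^sup>T" ?d X ?d] assoc_mult_mat[of "P\<^sup>T" ?d ?d P ?d X ?d]
    by simp_all
  have "eigendecomposition ?d (H * P) a A"
    unfolding eigendecomposition_def using H P PTP
    by (auto simp: transpose_mult[of _ ?d ?d _ ?d] HX PX HBH PB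
        assoc_mult_mat[of _ ?d ?d _ ?d _ ?d] mult_carrier_mat[of _ ?d ?d _ ?d])
  then show ?case by blast
qed

section \<open>Joint convexity of the relative entropy\<close>

text \<open>
  The trace of \<open>A\<^sup>T B\<close>, written with entries because linearity in either argument is then
  immediate.
\<close>

definition frob :: "nat \<Rightarrow> real Matrix.mat \<Rightarrow> real Matrix.mat \<Rightarrow> real" where
  "frob d A B = (\<Sum>i<d. \<Sum>j<d. A $$ (i, j) * B $$ (i, j))"

lemma frob_add_right:
  "B \<in> carrier_mat d d \<Longrightarrow> C \<in> carrier_mat d d \<Longrightarrow> frob d A (B + C) = frob d A B + frob d A C"
  by (simp add: frob_def algebra_simps sum.distrib)

lemma frob_smult_right: "B \<in> carrier_mat d d \<Longrightarrow> frob d A (c \<cdot>\<^sub>m B) = c * frob d A B"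
  by (simp add: frob_def sum_distrib_left algebra_simps)

lemma frob_commute: "frob d A B = frob d B A"
  by (simp add: frob_def mult.commute)

lemma frob_mat_sum_left:
  assumes "\<And>l. l \<in> I \<Longrightarrow> F l \<in> carrier_mat d d"
  shows "frob d (mat_sum d d (\<lambda>l. w l \<cdot>\<^sub>m F l) I) K = (\<Sum>l\<in>I. w l * frob d (F l) K)"
proof -
  have "frob d (mat_sum d d (\<lambda>l. w l \<cdot>\<^sub>m F l) I) K =
      (\<Sum>i<d. \<Sum>j<d. \<Sum>l\<in>I. w l * (F l $$ (i, j) * K $$ (i, j)))"
    unfolding frob_def mat_sum_def
  proof (intro sum.cong refl)
    fix i j assume ij: "i \<in> {..<d}" "j \<in> {..<d}"
    have "(\<Sum>l\<in>I. (w l \<cdot>\<^sub>m F l) $$ (i, j)) = (\<Sum>l\<in>I. w l * F l $$ (i, j))"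
    proof (rule sum.cong)
      fix l assume "l \<in> I"
      then show "(w l \<cdot>\<^sub>m F l) $$ (i, j) = w l * F l $$ (i, j)" using assms[of l] ij by simp
    qed simp
    then show "Matrix.mat d d (\<lambda>ij. \<Sum>t\<in>I. (w t \<cdot>\<^sub>m F t) $$ ij) $$ (i, j) * K $$ (i, j) =
        (\<Sum>l\<in>I. w l * (F l $$ (i, j) * K $$ (i, j)))"
      using ij by (simp add: sum_distrib_right mult.assoc)
  qed
  also have "\<dots> = (\<Sum>i<d. \<Sum>l\<in>I. \<Sum>j<d. w l * (F l $$ (i, j) * K $$ (i, j)))"
    by (rule sum.cong[OF refl], rule sum.swap)
  also have "\<dots> = (\<Sum>l\<in>I. \<Sum>i<d. \<Sum>j<d. w l * (F l $$ (i, j) * K $$ (i, j)))"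
    by (rule sum.swap)
  finally show ?thesis by (simp add: frob_def sum_distrib_left)
qed

lemma eigendecomposition_carrier:
  assumes "eigendecomposition d Q a A"
  shows "Q \<in> carrier_mat d d" "A \<in> carrier_mat d d" "Q\<^sup>T * Q = 1\<^sub>m d" "Q * Q\<^sup>T = 1\<^sub>m d"
    "A = Q * mat_diag d a * Q\<^sup>T"
proof -
  show "Q \<in> carrier_mat d d" "Q\<^sup>T * Q = 1\<^sub>m d" "Q * Q\<^sup>T = 1\<^sub>m d" "A = Q * mat_diag d a * Q\<^sup>T"
    using assms by (auto simp: eigendecomposition_def)
  then show "A \<in> carrier_mat d d" using mat_diag_dim[of d a]
    by (metis mult_carrier_mat transpose_carrier_mat)
qed

lemma orthogonal_cancel:
  fixes Q X :: "real Matrix.mat"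
  assumes "Q \<in> carrier_mat d d" "Q\<^sup>T * Q = 1\<^sub>m d" "X \<in> carrier_mat d m"
  shows "Q\<^sup>T * (Q * X) = X"
  using assms assoc_mult_mat[of "Q\<^sup>T" d d Q d X m] left_mult_one_mat[of X d m] by simp

lemma orthogonal_cancel':
  fixes Q X :: "real Matrix.mat"
  assumes "Q \<in> carrier_mat d d" "Q * Q\<^sup>T = 1\<^sub>m d" "X \<in> carrier_mat d m"
  shows "Q * (Q\<^sup>T * X) = X"
  using assms assoc_mult_mat[of Q d d "Q\<^sup>T" d X m] left_mult_one_mat[of X d m] by simp

lemma eigendecomposition_transpose:
  assumes "eigendecomposition d Q a A"
  shows "A\<^sup>T = A"
proof -
  note Q = eigendecomposition_carrier[OF assms]
  have D: "(mat_diag d a)\<^sup>T = mat_diag d a" by (rule eq_matI) (auto simp: mat_diag_def)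
  show ?thesis unfolding Q(5) using Q(1)
    by (simp add: transpose_mult[of _ d d _ d] D assoc_mult_mat[of _ d d _ d _ d] mult_carrier_mat[of _ d d _ d])
qed

lemma conj_diag_entry:
  fixes Q :: "real Matrix.mat"
  assumes "Q \<in> carrier_mat d d" "p < d" "q < d"
  shows "(Q * mat_diag d a * Q\<^sup>T) $$ (p, q) = (\<Sum>i<d. a i * (Q $$ (p, i) * Q $$ (q, i)))"
proof -
  have c: "Q * mat_diag d a \<in> carrier_mat d d" "Q\<^sup>T \<in> carrier_mat d d"
    using assms(1) mult_carrier_mat[OF assms(1) mat_diag_dim[of d a]] by auto
  show ?thesis unfolding index_mult_mat_sum[OF c assms(2,3)]
    using assms by (intro sum.cong) (auto simp: mat_diag_mult_right[OF assms(1)] mult.assoc mult.left_commute mult.commute)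
qed

lemma congruence_diag_entry:
  fixes Q K :: "real Matrix.mat"
  assumes "Q \<in> carrier_mat d d" "K \<in> carrier_mat d d" "i < d"
  shows "(Q\<^sup>T * K * Q) $$ (i, i) = (\<Sum>p<d. \<Sum>q<d. Q $$ (p, i) * K $$ (p, q) * Q $$ (q, i))"
proof -
  have c: "Q\<^sup>T * K \<in> carrier_mat d d" "Q\<^sup>T \<in> carrier_mat d d" using assms by auto
  have "(Q\<^sup>T * K * Q) $$ (i, i) = (\<Sum>q<d. \<Sum>p<d. Q $$ (p, i) * K $$ (p, q) * Q $$ (q, i))"
    unfolding index_mult_mat_sum[OF c(1) assms(1,3,3)] using assms
    by (intro sum.cong refl) (simp add: index_mult_mat_sum[OF c(2) assms(2)] sum_distrib_right del: index_mult_mat)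
  then show ?thesis by (subst sum.swap)
qed

lemma frob_eigendecomposition:
  assumes "eigendecomposition d Q a A" and K: "K \<in> carrier_mat d d"
  shows "frob d A K = (\<Sum>i<d. a i * (Q\<^sup>T * K * Q) $$ (i, i))"
proof -
  note Q = eigendecomposition_carrier[OF assms(1)]
  have "frob d A K = (\<Sum>p<d. \<Sum>q<d. \<Sum>i<d. a i * (Q $$ (p, i) * K $$ (p, q) * Q $$ (q, i)))"
    unfolding frob_def Q(5)
    by (intro sum.cong refl) (simp add: conj_diag_entry[OF Q(1)] sum_distrib_left sum_distrib_right mult.assoc mult.left_commute mult.commute)
  also have "\<dots> = (\<Sum>p<d. \<Sum>i<d. \<Sum>q<d. a i * (Q $$ (p, i) * K $$ (p, q) * Q $$ (q, i)))"
    by (rule sum.cong[OF refl], rule sum.swap)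
  also have "\<dots> = (\<Sum>i<d. \<Sum>p<d. \<Sum>q<d. a i * (Q $$ (p, i) * K $$ (p, q) * Q $$ (q, i)))"
    by (rule sum.swap)
  also have "\<dots> = (\<Sum>i<d. a i * (Q\<^sup>T * K * Q) $$ (i, i))"
    using K Q(1) by (intro sum.cong refl)
      (simp add: congruence_diag_entry sum_distrib_left del: index_mult_mat assoc_mult_mat)
  finally show ?thesis .
qed

text \<open>
  The squared overlaps of two eigenbases form a doubly stochastic matrix. Through them, traces of
  products of functions of two matrices become double sums of scalars, which is how all matrix
  inequalities below reduce to scalar ones.
\<close>

lemma frob_two_eigendecompositions:
  assumes A: "eigendecomposition d Q a A" and B: "eigendecomposition d V b B"
  shows "frob d A B = (\<Sum>i<d. \<Sum>j<d. ((Q\<^sup>T * V) $$ (i, j))\<^sup>2 * (a i * b j))"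
proof -
  note Q = eigendecomposition_carrier[OF A] and V = eigendecomposition_carrier[OF B]
  define C where "C = Q\<^sup>T * V"
  have C: "C \<in> carrier_mat d d" using Q V by (simp add: C_def)
  have CT: "C\<^sup>T = V\<^sup>T * Q" using Q(1) V(1) by (simp add: C_def transpose_mult[of _ d d _ d])
  have "Q\<^sup>T * B * Q = C * mat_diag d b * C\<^sup>T"
    unfolding CT unfolding C_def V(5) using Q(1) V(1)
    by (simp add: assoc_mult_mat[of _ d d _ d _ d] mult_carrier_mat[of _ d d _ d])
  then show ?thesis
    using frob_eigendecomposition[OF A V(2)] conj_diag_entry[OF C]
    by (simp add: C_def[symmetric] sum_distrib_left power2_eq_square mult.assoc mult.left_commute mult.commute)
qed

lemma eigendecomposition_id: 
  assumes "eigendecomposition d Q a A"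
  shows "eigendecomposition d Q (\<lambda>_. 1) (1\<^sub>m d)"
  using assms by (auto simp: eigendecomposition_def)

lemma eigendecomposition_affine:
  assumes "eigendecomposition d Q a A"
  shows "eigendecomposition d Q (\<lambda>i. b + c * a i) (b \<cdot>\<^sub>m 1\<^sub>m d + c \<cdot>\<^sub>m A)"
proof -
  note Q = eigendecomposition_carrier[OF assms]
  have "b \<cdot>\<^sub>m 1\<^sub>m d + c \<cdot>\<^sub>m A = Q * mat_diag d (\<lambda>i. b + c * a i) * Q\<^sup>T"
  proof (rule eq_matI)
    fix p q assume "p < dim_row (Q * mat_diag d (\<lambda>i. b + c * a i) * Q\<^sup>T)"
      "q < dim_col (Q * mat_diag d (\<lambda>i. b + c * a i) * Q\<^sup>T)"
    then have pq: "p < d" "q < d" using Q(1) by auto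
    have one: "(\<Sum>i<d. Q $$ (p, i) * Q $$ (q, i)) = (1\<^sub>m d) $$ (p, q)"
      using Q(1) pq unfolding Q(4)[symmetric]
      by (subst index_mult_mat_sum[of _ d d _ d]) (auto intro!: sum.cong)
    have A: "A $$ (p, q) = (\<Sum>i<d. a i * (Q $$ (p, i) * Q $$ (q, i)))"
      unfolding Q(5) by (rule conj_diag_entry[OF Q(1) pq])
    show "(b \<cdot>\<^sub>m 1\<^sub>m d + c \<cdot>\<^sub>m A) $$ (p, q) = (Q * mat_diag d (\<lambda>i. b + c * a i) * Q\<^sup>T) $$ (p, q)"
      using pq Q(2) conj_diag_entry[OF Q(1) pq] one[symmetric] A
      by (simp add: sum.distrib sum_distrib_left distrib_right mult.assoc del: index_one_mat(1))
  qed (use Q in auto)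
  then show ?thesis using Q by (simp add: eigendecomposition_def)
qed

lemma eigendecomposition_mult_vec:
  assumes A: "eigendecomposition d Q a A" and v: "v \<in> carrier_vec d"
  shows "v \<bullet> (A *\<^sub>v v) = (\<Sum>i<d. a i * ((Q\<^sup>T *\<^sub>v v) $ i)\<^sup>2)"
    and "v \<bullet> v = (\<Sum>i<d. ((Q\<^sup>T *\<^sub>v v) $ i)\<^sup>2)"
proof -
  note Q = eigendecomposition_carrier[OF A]
  have gen: "v \<bullet> (B *\<^sub>v v) = (\<Sum>i<d. b i * ((Q\<^sup>T *\<^sub>v v) $ i)\<^sup>2)"
    if B: "eigendecomposition d Q b B" for b B
  proof -
    define y where "y = Q\<^sup>T *\<^sub>v v"
    have y: "y \<in> carrier_vec d" using Q v by (simp add: y_def)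
    have D: "mat_diag d b \<in> carrier_mat d d" by simp
    have "B *\<^sub>v v = Q *\<^sub>v (mat_diag d b *\<^sub>v y)"
      unfolding eigendecomposition_carrier(5)[OF B] y_def using Q(1) D v
      by (simp add: assoc_mult_mat_vec[of _ d d _ d])
    then have "v \<bullet> (B *\<^sub>v v) = v \<bullet> (Q *\<^sub>v (mat_diag d b *\<^sub>v y))" by simp
    also have "\<dots> = y \<bullet> (mat_diag d b *\<^sub>v y)" unfolding y_def
      using transpose_vec_mult_scalar[of Q d d "mat_diag d b *\<^sub>v (Q\<^sup>T *\<^sub>v v)" v] Q(1) v y
      by (simp add: y_def[symmetric] mult_mat_vec_carrier[of _ d d])
    also have "\<dots> = (\<Sum>i<d. y $ i * (mat_diag d b *\<^sub>v y) $ i)"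
      by (rule scalar_prod_sum) (rule mult_mat_vec_carrier[OF mat_diag_dim y])
    also have "\<dots> = (\<Sum>i<d. b i * (y $ i)\<^sup>2)"
    proof (rule sum.cong)
      fix i assume "i \<in> {..<d}"
      then have i: "i < d" by simp
      have "(mat_diag d b *\<^sub>v y) $ i = (\<Sum>l<d. if l = i then b i * y $ i else 0)"
        unfolding index_mult_vec_sum[OF D y i] by (rule sum.cong) (use i in \<open>auto simp: mat_diag_def\<close>)
      then show "y $ i * (mat_diag d b *\<^sub>v y) $ i = b i * (y $ i)\<^sup>2"
        using i by (simp add: power2_eq_square)
    qed simp
    finally show ?thesis by (simp add: y_def)
  qed
  show "v \<bullet> (A *\<^sub>v v) = (\<Sum>i<d. a i * ((Q\<^sup>T *\<^sub>v v) $ i)\<^sup>2)" by (rule gen[OF A])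
  show "v \<bullet> v = (\<Sum>i<d. ((Q\<^sup>T *\<^sub>v v) $ i)\<^sup>2)"
    using gen[OF eigendecomposition_id[OF A]] v by simp
qed

lemma eigendecomposition_eigenvector:
  assumes A: "eigendecomposition d Q a A" and i: "i < d"
  shows "col Q i \<in> carrier_vec d" "A *\<^sub>v col Q i = a i \<cdot>\<^sub>v col Q i" "col Q i \<bullet> col Q i = 1"
proof -
  note Q = eigendecomposition_carrier[OF A]
  show q: "col Q i \<in> carrier_vec d" using Q(1) i by (simp add: col_def)
  have "A * Q = Q * mat_diag d a"
    unfolding Q(5) using Q(1,3) by (simp add: right_mult_one_mat[OF mat_diag_dim] assoc_mult_mat[of _ d d _ d _ d] mult_carrier_mat[of _ d d _ d])
  then have "A *\<^sub>v col Q i = col (Q * mat_diag d a) i"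
    using Q(1,2) i by (metis col_mult2)
  also have "\<dots> = a i \<cdot>\<^sub>v col Q i"
    unfolding mat_diag_mult_right[OF Q(1)] using Q(1) i by (intro eq_vecI) auto
  finally show "A *\<^sub>v col Q i = a i \<cdot>\<^sub>v col Q i" .
  have "(Q\<^sup>T * Q) $$ (i, i) = col Q i \<bullet> col Q i" using Q(1) i by simp
  then show "col Q i \<bullet> col Q i = 1" using Q(3) i by simp
qed

lemma eigenvalue_quadratic_form:
  assumes A: "eigendecomposition d Q a A" and i: "i < d"
  shows "col Q i \<bullet> (A *\<^sub>v col Q i) = a i"
  using eigendecomposition_eigenvector[OF assms] by simp

lemma overlap_sums:
  assumes A: "eigendecomposition d Q a A" and B: "eigendecomposition d V b B"
  shows "j < d \<Longrightarrow> (\<Sum>i<d. ((Q\<^sup>T * V) $$ (i, j))\<^sup>2) = 1"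
    and "i < d \<Longrightarrow> (\<Sum>j<d. ((Q\<^sup>T * V) $$ (i, j))\<^sup>2) = 1"
proof -
  note Q = eigendecomposition_carrier[OF A] and V = eigendecomposition_carrier[OF B]
  define C where "C = Q\<^sup>T * V"
  have C: "C \<in> carrier_mat d d" using Q V by (simp add: C_def)
  have CT: "C\<^sup>T = V\<^sup>T * Q" using Q(1) V(1) by (simp add: C_def transpose_mult[of _ d d _ d])
  have "C\<^sup>T * C = 1\<^sub>m d" unfolding CT unfolding C_def using Q(1,4) V(1,3)
    by (simp add: assoc_mult_mat[of _ d d _ d _ d] orthogonal_cancel')
  have "C * C\<^sup>T = 1\<^sub>m d" unfolding CT unfolding C_def using Q(1,3) V(1,4)
    by (simp add: assoc_mult_mat[of _ d d _ d _ d] orthogonal_cancel')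
  show "(\<Sum>i<d. ((Q\<^sup>T * V) $$ (i, j))\<^sup>2) = 1" if "j < d"
    using arg_cong[OF \<open>C\<^sup>T * C = 1\<^sub>m d\<close>, of "\<lambda>M. M $$ (j, j)"] that C
      index_mult_mat_sum[of "C\<^sup>T" d d C d j j]
    by (simp add: C_def[symmetric] power2_eq_square del: index_mult_mat)
  show "(\<Sum>j<d. ((Q\<^sup>T * V) $$ (i, j))\<^sup>2) = 1" if "i < d"
    using arg_cong[OF \<open>C * C\<^sup>T = 1\<^sub>m d\<close>, of "\<lambda>M. M $$ (i, i)"] that C
      index_mult_mat_sum[of C d d "C\<^sup>T" d i i]
    by (simp add: C_def[symmetric] power2_eq_square del: index_mult_mat)
qed

text \<open>
  For \<open>T = V diag(t) V\<^sup>T\<close> and \<open>A = Q diag(a) Q\<^sup>T\<close> this is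
  \<open>tr (T log T - T log A - T + A)\<close>, the relative entropy for matrices that need not have trace 1.
\<close>

definition relative_entropy ::
    "nat \<Rightarrow> real Matrix.mat \<Rightarrow> (nat \<Rightarrow> real) \<Rightarrow> real Matrix.mat \<Rightarrow> (nat \<Rightarrow> real) \<Rightarrow> real" where
  "relative_entropy d V t Q a =
     (\<Sum>i<d. \<Sum>j<d. ((Q\<^sup>T * V) $$ (i, j))\<^sup>2 * (t j * ln (t j) - t j * ln (a i) - t j + a i))"

lemma relative_entropy_eq:
  assumes T: "eigendecomposition d V t T" and A: "eigendecomposition d Q a A"
  shows "relative_entropy d V t Q a = (\<Sum>j<d. t j * ln (t j))
     - (\<Sum>i<d. \<Sum>j<d. ((Q\<^sup>T * V) $$ (i, j))\<^sup>2 * (ln (a i) * t j)) - (\<Sum>j<d. t j) + (\<Sum>i<d. a i)"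
proof -
  let ?c = "\<lambda>i j. ((Q\<^sup>T * V) $$ (i, j))\<^sup>2"
  have "relative_entropy d V t Q a = (\<Sum>i<d. \<Sum>j<d. ?c i j * (t j * ln (t j)))
     - (\<Sum>i<d. \<Sum>j<d. ?c i j * (ln (a i) * t j)) - (\<Sum>i<d. \<Sum>j<d. ?c i j * t j)
     + (\<Sum>i<d. \<Sum>j<d. ?c i j * a i)"
    unfolding relative_entropy_def by (simp add: sum.distrib sum_subtractf algebra_simps)
  moreover have "(\<Sum>i<d. \<Sum>j<d. ?c i j * f j) = (\<Sum>j<d. f j)" for f
    by (subst sum.swap) (simp add: sum_distrib_right[symmetric] overlap_sums(1)[OF A T])
  moreover have "(\<Sum>i<d. \<Sum>j<d. ?c i j * f i) = (\<Sum>i<d. f i)" for f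
    by (simp add: sum_distrib_right[symmetric] overlap_sums(2)[OF A T])
  ultimately show ?thesis by simp
qed

text \<open>
  Klein's inequality, which in overlap coordinates is \<open>ln x \<le> x - 1\<close>.
\<close>

lemma relative_entropy_nonneg:
  assumes "\<And>j. j < d \<Longrightarrow> 0 < t j" "\<And>i. i < d \<Longrightarrow> 0 < a i"
  shows "0 \<le> relative_entropy d V t Q a"
  unfolding relative_entropy_def
proof (intro sum_nonneg mult_nonneg_nonneg)
  fix i j assume "i \<in> {..<d}" "j \<in> {..<d}"
  then have p: "0 < a i" "0 < t j" using assms by auto
  have "ln (a i / t j) \<le> a i / t j - 1" using p by (intro ln_le_minus_one) auto
  then have "t j * ln (a i / t j) \<le> t j * (a i / t j - 1)" using p by (intro mult_left_mono) auto
  then show "0 \<le> t j * ln (t j) - t j * ln (a i) - t j + a i"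
    using p by (simp add: ln_div algebra_simps)
qed simp

text \<open>
  With left multiplication by \<open>A\<close> and right multiplication by \<open>T\<close> as commuting operators \<open>L\<close> and
  \<open>R\<close> on matrices, this is the quadratic form of the inverse of \<open>u L + (1 - u) R\<close> at \<open>A - T\<close>.
\<close>

definition chi_square ::
    "nat \<Rightarrow> real \<Rightarrow> real Matrix.mat \<Rightarrow> (nat \<Rightarrow> real) \<Rightarrow> real Matrix.mat \<Rightarrow> (nat \<Rightarrow> real) \<Rightarrow> real" where
  "chi_square d u V t Q a =
     (\<Sum>i<d. \<Sum>j<d. ((Q\<^sup>T * V) $$ (i, j))\<^sup>2 * ((a i - t j)\<^sup>2 / (u * a i + (1 - u) * t j)))"

text \<open>
  The function whose maximum over \<open>Y\<close> is the chi-square quantity, by completion of the square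
  \<open>\<langle>x, inverse(M) x\<rangle> = max (2 \<langle>x, y\<rangle> - \<langle>y, M y\<rangle>)\<close>. For fixed \<open>Y\<close> it is linear in \<open>T\<close> and \<open>A\<close>.
\<close>

definition chi_square_dual ::
    "nat \<Rightarrow> real \<Rightarrow> real Matrix.mat \<Rightarrow> real Matrix.mat \<Rightarrow> real Matrix.mat \<Rightarrow> real" where
  "chi_square_dual d u Y T A =
     2 * (frob d A Y - frob d T Y) - u * frob d A (Y * Y\<^sup>T) - (1 - u) * frob d T (Y\<^sup>T * Y)"

text \<open>
  In the coordinates \<open>Q\<^sup>T Y V\<close> the maximization separates into one quadratic problem for each pair
  of eigenvectors.
\<close>

lemma chi_square_dual_coordinates:
  assumes T: "eigendecomposition d V t T" and A: "eigendecomposition d Q a A"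
    and Y: "Y \<in> carrier_mat d d"
  shows "chi_square_dual d u Y T A = (\<Sum>i<d. \<Sum>j<d.
     2 * (Q\<^sup>T * Y * V) $$ (i, j) * (Q\<^sup>T * V) $$ (i, j) * (a i - t j)
     - (u * a i + (1 - u) * t j) * ((Q\<^sup>T * Y * V) $$ (i, j))\<^sup>2)"
proof -
  note Q = eigendecomposition_carrier[OF A] and V = eigendecomposition_carrier[OF T]
  note assoc = assoc_mult_mat[of _ d d _ d _ d]
  define C where "C = Q\<^sup>T * V"
  define Z where "Z = Q\<^sup>T * Y * V"
  have C: "C \<in> carrier_mat d d" and CT': "C\<^sup>T \<in> carrier_mat d d"
    and Z: "Z \<in> carrier_mat d d" and ZT': "Z\<^sup>T \<in> carrier_mat d d"
    using Q V Y by (auto simp: C_def Z_def)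
  have CT: "C\<^sup>T = V\<^sup>T * Q" using Q(1) V(1) by (simp add: C_def transpose_mult[of _ d d _ d])
  have ZT: "Z\<^sup>T = V\<^sup>T * Y\<^sup>T * Q" using Q(1) V(1) Y
    by (simp add: Z_def transpose_mult[of _ d d _ d] assoc)
  note cancel = orthogonal_cancel'[OF Q(1) Q(4), of _ d] orthogonal_cancel'[OF V(1) V(4), of _ d]
  have 1: "Q\<^sup>T * Y * Q = Z * C\<^sup>T" "Q\<^sup>T * (Y * Y\<^sup>T) * Q = Z * Z\<^sup>T"
    unfolding CT ZT unfolding Z_def using Q(1) V(1) Y by (simp_all add: assoc cancel)
  have 2: "V\<^sup>T * Y * V = C\<^sup>T * Z" "V\<^sup>T * (Y\<^sup>T * Y) * V = Z\<^sup>T * Z"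
    unfolding CT ZT unfolding Z_def using Q(1) V(1) Y by (simp_all add: assoc cancel)
  have AY: "frob d A Y = (\<Sum>i<d. \<Sum>j<d. a i * (Z $$ (i, j) * C $$ (i, j)))"
    unfolding frob_eigendecomposition[OF A Y] 1 sum_distrib_left[symmetric]
    using C Z by (intro sum.cong refl) (simp add: index_mult_mat_sum[OF Z CT'] del: index_mult_mat)
  have TY: "frob d T Y = (\<Sum>i<d. \<Sum>j<d. t j * (Z $$ (i, j) * C $$ (i, j)))"
    unfolding frob_eigendecomposition[OF T Y] 2
    by (subst sum.swap, intro sum.cong refl) 
       (use C Z in \<open>simp add: index_mult_mat_sum[OF CT' Z] sum_distrib_left mult.assoc mult.left_commute mult.commute del: index_mult_mat\<close>)
  have AYY: "frob d A (Y * Y\<^sup>T) = (\<Sum>i<d. \<Sum>j<d. a i * (Z $$ (i, j))\<^sup>2)"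
    using frob_eigendecomposition[OF A, of "Y * Y\<^sup>T"] Y C Z unfolding 1 sum_distrib_left[symmetric]
    by (simp add: index_mult_mat_sum[OF Z ZT'] power2_eq_square del: index_mult_mat)
  have TYY: "frob d T (Y\<^sup>T * Y) = (\<Sum>i<d. \<Sum>j<d. t j * (Z $$ (i, j))\<^sup>2)"
    using frob_eigendecomposition[OF T, of "Y\<^sup>T * Y"] Y C Z unfolding 2
    by (subst sum.swap)
       (simp add: index_mult_mat_sum[OF ZT' Z] power2_eq_square sum_distrib_left del: index_mult_mat)
  show ?thesis
    unfolding chi_square_dual_def AY TY AYY TYY C_def[symmetric] Z_def[symmetric]
    by (simp add: sum_distrib_left sum_subtractf[symmetric] algebra_simps)
qed

lemma convex_comb_pos:
  assumes "0 < (a::real)" "0 < t" "0 \<le> u" "u \<le> 1"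
  shows "0 < u * a + (1 - u) * t"
  using assms by (cases "u = 0") (auto intro: add_pos_nonneg)

lemma chi_square_dual_le:
  assumes T: "eigendecomposition d V t T" and A: "eigendecomposition d Q a A"
    and Y: "Y \<in> carrier_mat d d" and u: "0 \<le> u" "u \<le> 1"
    and pos: "\<And>j. j < d \<Longrightarrow> 0 < t j" "\<And>i. i < d \<Longrightarrow> 0 < a i"
  shows "chi_square_dual d u Y T A \<le> chi_square d u V t Q a"
  unfolding chi_square_dual_coordinates[OF T A Y] chi_square_def
proof (intro sum_mono)
  fix i j assume "i \<in> {..<d}" "j \<in> {..<d}"
  then have m: "0 < u * a i + (1 - u) * t j" using convex_comb_pos pos u by simp
  have *: "2 * y * c * r - m * y\<^sup>2 \<le> c\<^sup>2 * (r\<^sup>2 / m)" if "0 < m" for y c r m :: real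
  proof -
    have "0 \<le> (m * y - c * r)\<^sup>2 / m" using that by simp
    also have "\<dots> = c\<^sup>2 * (r\<^sup>2 / m) - (2 * y * c * r - m * y\<^sup>2)"
      using that by (simp add: field_simps power2_eq_square)
    finally show ?thesis by simp
  qed
  show "2 * (Q\<^sup>T * Y * V) $$ (i, j) * (Q\<^sup>T * V) $$ (i, j) * (a i - t j)
     - (u * a i + (1 - u) * t j) * ((Q\<^sup>T * Y * V) $$ (i, j))\<^sup>2
     \<le> ((Q\<^sup>T * V) $$ (i, j))\<^sup>2 * ((a i - t j)\<^sup>2 / (u * a i + (1 - u) * t j))"
    by (rule *[OF m])
qed

lemma chi_square_dual_attained:
  assumes T: "eigendecomposition d V t T" and A: "eigendecomposition d Q a A"
    and u: "0 \<le> u" "u \<le> 1"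
    and pos: "\<And>j. j < d \<Longrightarrow> 0 < t j" "\<And>i. i < d \<Longrightarrow> 0 < a i"
  obtains Y where "Y \<in> carrier_mat d d" "chi_square_dual d u Y T A = chi_square d u V t Q a"
proof -
  note Q = eigendecomposition_carrier[OF A] and V = eigendecomposition_carrier[OF T]
  (* The maximizer of the quadratic problem for each pair of eigenvectors. *)
  define Z where "Z = Matrix.mat d d (\<lambda>(i, j).
     (Q\<^sup>T * V) $$ (i, j) * (a i - t j) / (u * a i + (1 - u) * t j))"
  have Z: "Z \<in> carrier_mat d d" by (simp add: Z_def)
  define Y where "Y = Q * Z * V\<^sup>T"
  have Y: "Y \<in> carrier_mat d d" using Q V Z by (simp add: Y_def)
  have QYV: "Q\<^sup>T * Y * V = Z" using Q(1,3) V(1,3) Z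
    by (simp add: Y_def assoc_mult_mat[of _ d d _ d _ d] orthogonal_cancel)
  have "chi_square_dual d u Y T A = chi_square d u V t Q a"
    unfolding chi_square_dual_coordinates[OF T A Y] chi_square_def QYV
  proof (intro sum.cong refl)
    fix i j assume ij: "i \<in> {..<d}" "j \<in> {..<d}"
    then have m: "0 < u * a i + (1 - u) * t j" using convex_comb_pos pos u by simp
    have *: "2 * (c * r / m) * c * r - m * (c * r / m)\<^sup>2 = c\<^sup>2 * (r\<^sup>2 / m)" if "0 < m" for c r m :: real
      using that by (simp add: field_simps power2_eq_square)
    show "2 * Z $$ (i, j) * (Q\<^sup>T * V) $$ (i, j) * (a i - t j)
     - (u * a i + (1 - u) * t j) * (Z $$ (i, j))\<^sup>2
     = ((Q\<^sup>T * V) $$ (i, j))\<^sup>2 * ((a i - t j)\<^sup>2 / (u * a i + (1 - u) * t j))"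
      using *[OF m] ij by (simp add: Z_def del: index_mult_mat)
  qed
  with Y show ?thesis by (rule that)
qed

text \<open>
  With \<open>x = u a + (1 - u) t\<close> one has \<open>u (a - t) = x - t\<close>, so the integrand is the derivative of
  \<open>x - t ln x\<close>.
\<close>

lemma relative_entropy_scalar_integral:
  fixes a t :: real
  assumes "0 < a" "0 < t"
  shows "((\<lambda>u. u * ((a - t)\<^sup>2 / (u * a + (1 - u) * t))) has_integral
           (t * ln t - t * ln a - t + a)) {0..1}"
proof -
  let ?x = "\<lambda>u. u * a + (1 - u) * t"
  let ?F = "\<lambda>u. ?x u - t * ln (?x u)"
  have "((\<lambda>u. u * ((a - t)\<^sup>2 / ?x u)) has_integral (?F 1 - ?F 0)) {0..1}"
  proof (rule fundamental_theorem_of_calculus)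
    fix u :: real assume u: "u \<in> {0..1}"
    then have x: "0 < ?x u" using convex_comb_pos assms by simp
    have "(?F has_real_derivative ((a - t) - t * ((a - t) / ?x u))) (at u within {0..1})"
      using x by (auto intro!: derivative_eq_intros)
    moreover have "(a - t) - t * ((a - t) / ?x u) = u * ((a - t)\<^sup>2 / ?x u)"
      using x by (simp add: divide_simps) (simp add: algebra_simps power2_eq_square)
    ultimately show "(?F has_vector_derivative u * ((a - t)\<^sup>2 / ?x u)) (at u within {0..1})"
      by (simp add: has_real_derivative_iff_has_vector_derivative)
  qed simp
  then show ?thesis by (simp add: algebra_simps)
qed

lemma relative_entropy_integral:
  assumes "\<And>j. j < d \<Longrightarrow> 0 < t j" "\<And>i. i < d \<Longrightarrow> 0 < a i"
  shows "((\<lambda>u. u * chi_square d u V t Q a) has_integral relative_entropy d V t Q a) {0..1}"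
proof -
  have "((\<lambda>u. \<Sum>i<d. \<Sum>j<d. ((Q\<^sup>T * V) $$ (i, j))\<^sup>2 *
      (u * ((a i - t j)\<^sup>2 / (u * a i + (1 - u) * t j)))) has_integral relative_entropy d V t Q a) {0..1}"
    unfolding relative_entropy_def
    by (intro has_integral_sum has_integral_mult_right relative_entropy_scalar_integral finite_lessThan)
       (use assms in auto)
  then show ?thesis
    unfolding chi_square_def by (simp add: sum_distrib_left mult.left_commute)
qed

text \<open>
  For each \<open>u\<close>, the auxiliary matrix that is optimal for the two means is admissible, though not
  optimal, for every pair in the average. Linearity of the dual function gives convexity of the
  chi-square quantity, and integration over \<open>u\<close> gives the claim.
\<close>

lemma relative_entropy_jointly_convex:
  fixes I :: "'i set" and w :: "'i \<Rightarrow> real"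
  assumes w: "\<And>l. l \<in> I \<Longrightarrow> 0 \<le> w l" and fin: "finite I"
    and Tl: "\<And>l. l \<in> I \<Longrightarrow> eigendecomposition d (V l) (t l) (T l)"
    and Al: "\<And>l. l \<in> I \<Longrightarrow> eigendecomposition d (Q l) (a l) (A l)"
    and posl: "\<And>l j. l \<in> I \<Longrightarrow> j < d \<Longrightarrow> 0 < t l j" "\<And>l i. l \<in> I \<Longrightarrow> i < d \<Longrightarrow> 0 < a l i"
    and T: "eigendecomposition d V' t' (mat_sum d d (\<lambda>l. w l \<cdot>\<^sub>m T l) I)"
    and A: "eigendecomposition d Q' a' (mat_sum d d (\<lambda>l. w l \<cdot>\<^sub>m A l) I)"
    and pos: "\<And>j. j < d \<Longrightarrow> 0 < t' j" "\<And>i. i < d \<Longrightarrow> 0 < a' i"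
  shows "relative_entropy d V' t' Q' a' \<le> (\<Sum>l\<in>I. w l * relative_entropy d (V l) (t l) (Q l) (a l))"
proof -
  have chi: "chi_square d u V' t' Q' a' \<le> (\<Sum>l\<in>I. w l * chi_square d u (V l) (t l) (Q l) (a l))"
    if u: "0 \<le> u" "u \<le> 1" for u
  proof -
    obtain Y where Y: "Y \<in> carrier_mat d d" and eq: 
      "chi_square_dual d u Y (mat_sum d d (\<lambda>l. w l \<cdot>\<^sub>m T l) I) (mat_sum d d (\<lambda>l. w l \<cdot>\<^sub>m A l) I)
         = chi_square d u V' t' Q' a'"
      using chi_square_dual_attained[OF T A u pos] .
    have "chi_square d u V' t' Q' a' = (\<Sum>l\<in>I. w l * chi_square_dual d u Y (T l) (A l))"
      unfolding eq[symmetric] chi_square_dual_def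
      using eigendecomposition_carrier(2)[OF Tl] eigendecomposition_carrier(2)[OF Al]
      by (simp add: frob_mat_sum_left sum_distrib_left sum_subtractf[symmetric] algebra_simps)
    also have "\<dots> \<le> (\<Sum>l\<in>I. w l * chi_square d u (V l) (t l) (Q l) (a l))"
      using chi_square_dual_le[OF Tl Al Y u posl] w by (intro sum_mono mult_left_mono) auto
    finally show ?thesis .
  qed
  have "((\<lambda>u. \<Sum>l\<in>I. w l * (u * chi_square d u (V l) (t l) (Q l) (a l))) has_integral
      (\<Sum>l\<in>I. w l * relative_entropy d (V l) (t l) (Q l) (a l))) {0..1}"
    using posl by (intro has_integral_sum has_integral_mult_right relative_entropy_integral fin) auto
  from relative_entropy_integral[OF pos] this show ?thesis
  proof (rule has_integral_le)
    fix u :: real assume u: "u \<in> {0..1}"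
    have "u * chi_square d u V' t' Q' a' \<le> u * (\<Sum>l\<in>I. w l * chi_square d u (V l) (t l) (Q l) (a l))"
      using u chi[of u] by (intro mult_left_mono) auto
    then show "u * chi_square d u V' t' Q' a' \<le>
        (\<Sum>l\<in>I. w l * (u * chi_square d u (V l) (t l) (Q l) (a l)))"
      by (simp add: sum_distrib_left mult.left_commute)
  qed simp
qed

section \<open>A Jensen inequality for the trace exponential\<close>

definition sym_mat :: "nat \<Rightarrow> real Matrix.mat \<Rightarrow> bool" where
  "sym_mat d A \<longleftrightarrow> A \<in> carrier_mat d d \<and> A\<^sup>T = A"

text \<open>
  The trace of the exponential of a symmetric matrix, computed from an arbitrarily chosen
  eigendecomposition.
\<close>

definition trace_exp :: "nat \<Rightarrow> real Matrix.mat \<Rightarrow> real" where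
  "trace_exp d A = (\<Sum>i<d. exp ((SOME a. \<exists>Q. eigendecomposition d Q a A) i))"

lemma trace_exp_obtain:
  assumes "sym_mat d A"
  obtains Q a where "eigendecomposition d Q a A" "trace_exp d A = (\<Sum>i<d. exp (a i))"
proof -
  have "\<exists>a Q. eigendecomposition d Q a A"
    using symmetric_eigendecomposition[of A d] assms by (auto simp: sym_mat_def)
  from someI_ex[OF this] show ?thesis
    using that unfolding trace_exp_def by blast
qed

lemma sym_mat_eigendecomposition: "eigendecomposition d Q a A \<Longrightarrow> sym_mat d A"
  using eigendecomposition_carrier(2) eigendecomposition_transpose by (simp add: sym_mat_def)

lemma sym_mat_add: "sym_mat d A \<Longrightarrow> sym_mat d B \<Longrightarrow> sym_mat d (A + B)"
  by (auto simp: sym_mat_def transpose_add[of _ d d])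

lemma sym_mat_one: "sym_mat d (1\<^sub>m d)" and sym_mat_zero: "sym_mat d (0\<^sub>m d d)"
  by (auto simp: sym_mat_def)

lemma sym_mat_carrier: "sym_mat d A \<Longrightarrow> A \<in> carrier_mat d d"
  by (simp add: sym_mat_def)

lemma sym_mat_entry:
  assumes "sym_mat d A" "i < d" "j < d"
  shows "A $$ (j, i) = A $$ (i, j)"
proof -
  have A: "A \<in> carrier_mat d d" "A\<^sup>T = A" using assms(1) by (auto simp: sym_mat_def)
  have "A\<^sup>T $$ (i, j) = A $$ (j, i)" using A(1) assms(2,3) by simp
  then show ?thesis unfolding A(2) by simp
qed

lemma sym_mat_smult:
  assumes "sym_mat d A"
  shows "sym_mat d (c \<cdot>\<^sub>m A)"
  unfolding sym_mat_def using sym_mat_carrier[OF assms] sym_mat_entry[OF assms]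
  by (auto intro!: eq_matI)

lemma mat_sum_carrier [simp]: "mat_sum nr nc F I \<in> carrier_mat nr nc"
  by (simp add: mat_sum_def)

lemma index_mat_sum [simp]:
  "i < nr \<Longrightarrow> j < nc \<Longrightarrow> mat_sum nr nc F I $$ (i, j) = (\<Sum>l\<in>I. F l $$ (i, j))"
  by (simp add: mat_sum_def)

lemma dim_mat_sum [simp]: "dim_row (mat_sum nr nc F I) = nr" "dim_col (mat_sum nr nc F I) = nc"
  by (simp_all add: mat_sum_def)

lemma sym_mat_sum:
  assumes "\<And>l. l \<in> I \<Longrightarrow> sym_mat d (F l)"
  shows "sym_mat d (mat_sum d d F I)"
  unfolding sym_mat_def
proof (intro conjI eq_matI mat_sum_carrier)
  fix i j assume "i < dim_row (mat_sum d d F I)" "j < dim_col (mat_sum d d F I)"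
  then show "(mat_sum d d F I)\<^sup>T $$ (i, j) = mat_sum d d F I $$ (i, j)"
    using sym_mat_entry[OF assms] by (simp cong: sum.cong)
qed simp_all

lemma mat_sum_insert:
  assumes "finite I" "x \<notin> I" "F x \<in> carrier_mat d d"
  shows "mat_sum d d F (insert x I) = F x + mat_sum d d F I"
  using assms by (intro eq_matI) auto

lemma mat_sum_empty: "mat_sum d d F {} = 0\<^sub>m d d"
  by (intro eq_matI) auto

lemma quadratic_form_frob:
  assumes "A \<in> carrier_mat d d" "v \<in> carrier_vec d"
  shows "v \<bullet> (A *\<^sub>v v) = frob d A (Matrix.mat d d (\<lambda>(i, j). v $ i * v $ j))"
proof -
  have Av: "A *\<^sub>v v \<in> carrier_vec d" by (rule mult_mat_vec_carrier[OF assms])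
  show ?thesis unfolding scalar_prod_sum[OF Av] frob_def
    by (intro sum.cong refl)
       (simp add: index_mult_vec_sum[OF assms] sum_distrib_left algebra_simps del: index_mult_mat_vec)
qed

lemma quadratic_form_mat_sum:
  assumes "\<And>l. l \<in> I \<Longrightarrow> F l \<in> carrier_mat d d" "v \<in> carrier_vec d"
  shows "v \<bullet> (mat_sum d d F I *\<^sub>v v) = (\<Sum>l\<in>I. v \<bullet> (F l *\<^sub>v v))"
proof -
  have "mat_sum d d F I = mat_sum d d (\<lambda>l. 1 \<cdot>\<^sub>m F l) I"
  proof (intro eq_matI)
    fix i j assume "i < dim_row (mat_sum d d (\<lambda>l. 1 \<cdot>\<^sub>m F l) I)"
      "j < dim_col (mat_sum d d (\<lambda>l. 1 \<cdot>\<^sub>m F l) I)"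
    then have ij: "i < d" "j < d" by auto
    have "F l $$ (i, j) = (1 \<cdot>\<^sub>m F l) $$ (i, j)" if "l \<in> I" for l
      using assms(1)[OF that] ij by simp
    then show "mat_sum d d F I $$ (i, j) = mat_sum d d (\<lambda>l. 1 \<cdot>\<^sub>m F l) I $$ (i, j)"
      using ij by (simp cong: sum.cong)
  qed auto
  then have "v \<bullet> (mat_sum d d F I *\<^sub>v v) = (\<Sum>l\<in>I. 1 * frob d (F l) (Matrix.mat d d (\<lambda>(i, j). v $ i * v $ j)))"
    using quadratic_form_frob[OF mat_sum_carrier assms(2), of F I]
      frob_mat_sum_left[of I F d "\<lambda>_. 1", OF assms(1)] by (simp only:)
  also have "\<dots> = (\<Sum>l\<in>I. v \<bullet> (F l *\<^sub>v v))"
    using quadratic_form_frob[OF assms(1) assms(2)] by (intro sum.cong) auto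
  finally show ?thesis .
qed

lemma quadratic_form_smult:
  fixes A :: "real Matrix.mat"
  assumes "A \<in> carrier_mat d d" "v \<in> carrier_vec d"
  shows "v \<bullet> ((c \<cdot>\<^sub>m A) *\<^sub>v v) = c * (v \<bullet> (A *\<^sub>v v))"
proof -
  have "v \<bullet> ((c \<cdot>\<^sub>m A) *\<^sub>v v) = frob d (c \<cdot>\<^sub>m A) (Matrix.mat d d (\<lambda>(i, j). v $ i * v $ j))"
    by (rule quadratic_form_frob) (use assms in auto)
  then show ?thesis
    unfolding quadratic_form_frob[OF assms] frob_commute[of d _ "Matrix.mat _ _ _"]
      frob_smult_right[OF assms(1)] .
qed

lemma frob_same_eigenvectors:
  assumes A: "eigendecomposition d Q a A" and B: "eigendecomposition d Q b B"
  shows "frob d A B = (\<Sum>i<d. a i * b i)"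
proof -
  have "frob d A B = (\<Sum>i<d. \<Sum>j<d. ((1\<^sub>m d) $$ (i, j))\<^sup>2 * (a i * b j))"
    using frob_two_eigendecompositions[OF A B] eigendecomposition_carrier(3)[OF A] by simp
  also have "\<dots> = (\<Sum>i<d. \<Sum>j<d. if j = i then a i * b i else 0)"
    by (intro sum.cong refl) auto
  finally show ?thesis by simp
qed

lemma sum_eigenvalues:
  assumes "eigendecomposition d Q a A"
  shows "frob d (1\<^sub>m d) A = (\<Sum>i<d. a i)"
  using frob_same_eigenvectors[OF eigendecomposition_id[OF assms] assms] by simp

lemma quadratic_form_pos:
  assumes A: "eigendecomposition d Q a A" and pos: "\<And>i. i < d \<Longrightarrow> 0 < a i"
    and v: "v \<in> carrier_vec d" "v \<bullet> v = 1"
  shows "0 < v \<bullet> (A *\<^sub>v v)"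
proof (rule ccontr)
  let ?y = "\<lambda>i. (Q\<^sup>T *\<^sub>v v) $ i"
  assume "\<not> ?thesis"
  then have "(\<Sum>i<d. a i * (?y i)\<^sup>2) \<le> 0" using eigendecomposition_mult_vec(1)[OF A v(1)] by simp
  moreover have nn: "\<And>i. i \<in> {..<d} \<Longrightarrow> 0 \<le> a i * (?y i)\<^sup>2" using pos by (simp add: less_imp_le)
  ultimately have "(\<Sum>i<d. a i * (?y i)\<^sup>2) = 0" using sum_nonneg[of "{..<d}"] by (meson antisym)
  then have "\<forall>i\<in>{..<d}. a i * (?y i)\<^sup>2 = 0" using nn by (subst (asm) sum_nonneg_eq_0_iff) auto
  then have "\<forall>i\<in>{..<d}. (?y i)\<^sup>2 = 0"
    using pos by (metis lessThan_iff less_irrefl mult_eq_0_iff)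
  then have "(\<Sum>i<d. (?y i)\<^sup>2) = 0" by (intro sum.neutral) auto
  then show False using eigendecomposition_mult_vec(2)[OF A v(1)] v(2) by simp
qed

text \<open>
  As a function of \<open>z\<close> in \<open>[0, 1]\<close>, the convex function \<open>exp (\<theta> z)\<close> lies below its chord. Applied to
  eigenvalues this is \<open>\<theta> Z \<le> log (1 + g Z)\<close> with \<open>g = exp \<theta> - 1\<close>, and \<open>ln (1 + x) \<le> x\<close> gives
  \<open>log (1 + g Z) \<le> g Z\<close>.
\<close>

lemma exp_chord_le:
  fixes \<theta> z :: real
  assumes "0 \<le> z" "z \<le> 1"
  shows "\<theta> * z \<le> ln (1 + (exp \<theta> - 1) * z)" "0 < 1 + (exp \<theta> - 1) * z"
    "ln (1 + (exp \<theta> - 1) * z) \<le> (exp \<theta> - 1) * z"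
proof -
  have "0 < z * exp \<theta> + (1 - z) * 1" by (rule convex_comb_pos) (use assms in auto)
  then show pos: "0 < 1 + (exp \<theta> - 1) * z" by (simp add: algebra_simps)
  have "exp ((1 - z) *\<^sub>R 0 + z *\<^sub>R \<theta>) \<le> (1 - z) * exp 0 + z * exp \<theta>"
    using convex_onD[OF convex_on_exp, of 1 z 0 \<theta>] assms by simp
  then have "exp (\<theta> * z) \<le> 1 + (exp \<theta> - 1) * z" by (simp add: algebra_simps)
  then show "\<theta> * z \<le> ln (1 + (exp \<theta> - 1) * z)" using pos by (simp add: ln_ge_iff)
  show "ln (1 + (exp \<theta> - 1) * z) \<le> (exp \<theta> - 1) * z"
    using ln_le_minus_one[OF pos] by simp
qed

text \<open>
  Put \<open>g = exp \<theta> - 1\<close>, \<open>T\<^sub>l = exp (H + \<theta> Z\<^sub>l)\<close> and \<open>A\<^sub>l = 1 + g Z\<^sub>l\<close>, with weighted means \<open>T\<close>, \<open>A\<close> and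
  \<open>Z\<close>. Since \<open>log T\<^sub>l = H + \<theta> Z\<^sub>l\<close> and \<open>\<theta> Z\<^sub>l \<le> log A\<^sub>l\<close>, the relative entropy of \<open>T\<^sub>l\<close> and \<open>A\<^sub>l\<close> is at most
  \<open>tr (T\<^sub>l H - T\<^sub>l + A\<^sub>l)\<close>, which is linear. Joint convexity passes this bound to the means,
  and \<open>log A \<le> g Z\<close> gives \<open>tr T (log T - H - g Z) \<le> 0\<close>. Klein's inequality for \<open>T\<close> and
  \<open>exp (H + g Z)\<close> then yields \<open>tr T \<le> tr exp (H + g Z)\<close>.
\<close>

theorem trace_exp_jensen:
  fixes I :: "'i set" and w :: "'i \<Rightarrow> real" and \<theta> :: real
  assumes fin: "finite I" and w: "\<And>l. l \<in> I \<Longrightarrow> 0 \<le> w l" "(\<Sum>l\<in>I. w l) = 1"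
    and H: "sym_mat d H" and Z: "\<And>l. l \<in> I \<Longrightarrow> sym_mat d (Z l)"
    and Z01: "\<And>l v. l \<in> I \<Longrightarrow> v \<in> carrier_vec d \<Longrightarrow>
      0 \<le> v \<bullet> (Z l *\<^sub>v v) \<and> v \<bullet> (Z l *\<^sub>v v) \<le> v \<bullet> v"
  shows "(\<Sum>l\<in>I. w l * trace_exp d (H + \<theta> \<cdot>\<^sub>m Z l))
     \<le> trace_exp d (H + (exp \<theta> - 1) \<cdot>\<^sub>m mat_sum d d (\<lambda>l. w l \<cdot>\<^sub>m Z l) I)"
proof -
  define g where "g = exp \<theta> - 1"
  note symI = sym_mat_add sym_mat_smult sym_mat_one
  have "\<forall>l. \<exists>V x. l \<in> I \<longrightarrow> eigendecomposition d V x (H + \<theta> \<cdot>\<^sub>m Z l) \<and>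
      trace_exp d (H + \<theta> \<cdot>\<^sub>m Z l) = (\<Sum>i<d. exp (x i))"
    using trace_exp_obtain symI H Z by metis
  then obtain V x where Vx: "\<And>l. l \<in> I \<Longrightarrow> eigendecomposition d (V l) (x l) (H + \<theta> \<cdot>\<^sub>m Z l)"
    and tr: "\<And>l. l \<in> I \<Longrightarrow> trace_exp d (H + \<theta> \<cdot>\<^sub>m Z l) = (\<Sum>i<d. exp (x l i))" by metis
  have "\<forall>l. \<exists>Q z. l \<in> I \<longrightarrow> eigendecomposition d Q z (Z l)"
    using trace_exp_obtain Z by metis
  then obtain Q z where Qz: "\<And>l. l \<in> I \<Longrightarrow> eigendecomposition d (Q l) (z l) (Z l)" by metis
  have z01: "0 \<le> z l i" "z l i \<le> 1" if "l \<in> I" "i < d" for l i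
    using Z01[OF that(1) eigendecomposition_eigenvector(1)[OF Qz[OF that(1)] that(2)]]
      eigenvalue_quadratic_form[OF Qz[OF that(1)] that(2)]
      eigendecomposition_eigenvector(3)[OF Qz[OF that(1)] that(2)] by auto
  define t where "t l i = exp (x l i)" for l i
  define T where "T l = V l * mat_diag d (t l) * (V l)\<^sup>T" for l
  have VT: "eigendecomposition d (V l) (t l) (T l)" if "l \<in> I" for l
    using Vx[OF that] by (auto simp: eigendecomposition_def T_def)
  have tpos: "0 < t l i" for l i by (simp add: t_def)
  define a where "a l i = 1 + g * z l i" for l i
  define A where "A l = 1 \<cdot>\<^sub>m 1\<^sub>m d + g \<cdot>\<^sub>m Z l" for l
  have QA: "eigendecomposition d (Q l) (a l) (A l)" if "l \<in> I" for l
    unfolding A_def a_def by (rule eigendecomposition_affine[OF Qz[OF that]])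
  have apos: "0 < a l i" if "l \<in> I" "i < d" for l i
    using exp_chord_le(2) z01[OF that] by (simp add: a_def g_def)
  define Zm where "Zm = mat_sum d d (\<lambda>l. w l \<cdot>\<^sub>m Z l) I"
  define Tm where "Tm = mat_sum d d (\<lambda>l. w l \<cdot>\<^sub>m T l) I"
  have Zsym: "sym_mat d Zm" unfolding Zm_def by (intro sym_mat_sum symI Z)
  have Tsym: "sym_mat d Tm" unfolding Tm_def by (intro sym_mat_sum symI sym_mat_eigendecomposition[OF VT])
  have Am: "mat_sum d d (\<lambda>l. w l \<cdot>\<^sub>m A l) I = 1 \<cdot>\<^sub>m 1\<^sub>m d + g \<cdot>\<^sub>m Zm"
  proof (rule eq_matI)
    fix i j assume "i < dim_row (1 \<cdot>\<^sub>m 1\<^sub>m d + g \<cdot>\<^sub>m Zm)" "j < dim_col (1 \<cdot>\<^sub>m 1\<^sub>m d + g \<cdot>\<^sub>m Zm)"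
    then have ij: "i < d" "j < d" by (auto simp: Zm_def)
    have "(\<Sum>l\<in>I. (w l \<cdot>\<^sub>m A l) $$ (i, j)) =
        (\<Sum>l\<in>I. w l * (1\<^sub>m d) $$ (i, j) + g * (w l \<cdot>\<^sub>m Z l) $$ (i, j))"
    proof (rule sum.cong[OF refl])
      fix l assume "l \<in> I"
      then show "(w l \<cdot>\<^sub>m A l) $$ (i, j) = w l * (1\<^sub>m d) $$ (i, j) + g * (w l \<cdot>\<^sub>m Z l) $$ (i, j)"
        using ij sym_mat_carrier[OF Z[OF \<open>l \<in> I\<close>]] by (simp add: A_def algebra_simps)
    qed
    also have "\<dots> = (1\<^sub>m d) $$ (i, j) + g * (\<Sum>l\<in>I. (w l \<cdot>\<^sub>m Z l) $$ (i, j))"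
      by (simp only: sum.distrib sum_distrib_left[symmetric] sum_distrib_right[symmetric] w(2) mult_1_left)
    finally show "mat_sum d d (\<lambda>l. w l \<cdot>\<^sub>m A l) I $$ (i, j) = (1 \<cdot>\<^sub>m 1\<^sub>m d + g \<cdot>\<^sub>m Zm) $$ (i, j)"
      using ij by (simp add: Zm_def)
  qed (auto simp: Zm_def)
  obtain Q' z' where Qz': "eigendecomposition d Q' z' Zm" using trace_exp_obtain[OF Zsym] .
  obtain V' t' where Vt': "eigendecomposition d V' t' Tm" using trace_exp_obtain[OF Tsym] .
  define a' where "a' i = 1 + g * z' i" for i
  have QA': "eigendecomposition d Q' a' (mat_sum d d (\<lambda>l. w l \<cdot>\<^sub>m A l) I)"
    unfolding Am a'_def by (rule eigendecomposition_affine[OF Qz'])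
  have qm: "v \<bullet> (mat_sum d d (\<lambda>l. w l \<cdot>\<^sub>m F l) I *\<^sub>v v) = (\<Sum>l\<in>I. w l * (v \<bullet> (F l *\<^sub>v v)))"
    if "\<And>l. l \<in> I \<Longrightarrow> sym_mat d (F l)" "v \<in> carrier_vec d" for F v
  proof -
    have "v \<bullet> (mat_sum d d (\<lambda>l. w l \<cdot>\<^sub>m F l) I *\<^sub>v v) = (\<Sum>l\<in>I. v \<bullet> ((w l \<cdot>\<^sub>m F l) *\<^sub>v v))"
      by (rule quadratic_form_mat_sum[OF _ that(2)]) (simp add: sym_mat_carrier[OF that(1)])
    also have "\<dots> = (\<Sum>l\<in>I. w l * (v \<bullet> (F l *\<^sub>v v)))"
      by (rule sum.cong[OF refl], rule quadratic_form_smult[OF sym_mat_carrier[OF that(1)] that(2)])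
    finally show ?thesis .
  qed
  have z'01: "0 \<le> z' i" "z' i \<le> 1" if "i < d" for i
  proof -
    let ?q = "col Q' i"
    have q: "?q \<in> carrier_vec d" "?q \<bullet> ?q = 1" "?q \<bullet> (Zm *\<^sub>v ?q) = z' i"
      using eigendecomposition_eigenvector[OF Qz' that] eigenvalue_quadratic_form[OF Qz' that] by auto
    have *: "z' i = (\<Sum>l\<in>I. w l * (?q \<bullet> (Z l *\<^sub>v ?q)))"
      using qm[of Z, OF Z q(1)] q(3) by (simp add: Zm_def)
    show "0 \<le> z' i" unfolding * using w Z01[OF _ q(1)] by (intro sum_nonneg mult_nonneg_nonneg) auto
    have "z' i \<le> (\<Sum>l\<in>I. w l * 1)" unfolding *
      using w Z01[OF _ q(1)] q(2) by (intro sum_mono mult_left_mono) auto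
    then show "z' i \<le> 1" using w by simp
  qed
  have a'pos: "0 < a' i" if "i < d" for i
    using exp_chord_le(2) z'01[OF that] by (simp add: a'_def g_def)
  have t'pos: "0 < t' j" if "j < d" for j
  proof -
    let ?q = "col V' j"
    have q: "?q \<in> carrier_vec d" "?q \<bullet> ?q = 1" "?q \<bullet> (Tm *\<^sub>v ?q) = t' j"
      using eigendecomposition_eigenvector[OF Vt' that] eigenvalue_quadratic_form[OF Vt' that] by auto
    have *: "t' j = (\<Sum>l\<in>I. w l * (?q \<bullet> (T l *\<^sub>v ?q)))"
      using qm[of T, OF sym_mat_eigendecomposition[OF VT] q(1)] q(3) by (simp add: Tm_def)
    have p: "0 < ?q \<bullet> (T l *\<^sub>v ?q)" if "l \<in> I" for l
      using quadratic_form_pos[OF VT[OF that] tpos q(1,2)] .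
    obtain l where l: "l \<in> I" "0 < w l" using w sum_nonpos[of I w] by force
    show ?thesis unfolding *
      by (rule sum_pos2[OF fin l(1)]) (use l p w(1) in \<open>auto intro!: mult_nonneg_nonneg less_imp_le[OF p]\<close>)
  qed
  have D_le: "relative_entropy d V' t' Q' a' \<le> (\<Sum>l\<in>I. w l * relative_entropy d (V l) (t l) (Q l) (a l))"
    by (rule relative_entropy_jointly_convex[OF w(1) fin VT QA _ _ Vt'[unfolded Tm_def] QA'])
       (use tpos apos t'pos a'pos in auto)
  have Dl: "relative_entropy d (V l) (t l) (Q l) (a l)
      \<le> frob d H (T l) - frob d (1\<^sub>m d) (T l) + frob d (1\<^sub>m d) (A l)" if l: "l \<in> I" for l
  proof -
    have c: "H \<in> carrier_mat d d" "\<theta> \<cdot>\<^sub>m Z l \<in> carrier_mat d d" "Z l \<in> carrier_mat d d"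
      using H Z[OF l] by (auto simp: sym_mat_def)
    have "(\<Sum>j<d. t l j * ln (t l j)) = frob d (T l) (H + \<theta> \<cdot>\<^sub>m Z l)"
      using frob_same_eigenvectors[OF VT[OF l] Vx[OF l]] by (simp add: t_def)
    also have "\<dots> = frob d H (T l) + \<theta> * frob d (Z l) (T l)"
      unfolding frob_commute[of d H] frob_commute[of d "Z l"]
      using c by (simp add: frob_add_right frob_smult_right)
    finally have e: "(\<Sum>j<d. t l j * ln (t l j)) = frob d H (T l) + \<theta> * frob d (Z l) (T l)" .
    have "\<theta> * frob d (Z l) (T l) = 
        (\<Sum>i<d. \<Sum>j<d. (((Q l)\<^sup>T * V l) $$ (i, j))\<^sup>2 * (\<theta> * z l i * t l j))"
      unfolding frob_two_eigendecompositions[OF Qz[OF l] VT[OF l]]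
      by (simp add: sum_distrib_left mult.assoc mult.left_commute)
    also have "\<dots> \<le> (\<Sum>i<d. \<Sum>j<d. (((Q l)\<^sup>T * V l) $$ (i, j))\<^sup>2 * (ln (a l i) * t l j))"
      using exp_chord_le(1)[OF z01[OF l]] tpos[of l]
      by (intro sum_mono mult_left_mono mult_right_mono) (auto simp: a_def g_def less_imp_le)
    finally show ?thesis
      unfolding relative_entropy_eq[OF VT[OF l] QA[OF l]] sum_eigenvalues[OF VT[OF l]] sum_eigenvalues[OF QA[OF l]]
      using e by linarith
  qed
  have D': "(\<Sum>j<d. t' j * ln (t' j)) - g * frob d Zm Tm - frob d (1\<^sub>m d) Tm
      + frob d (1\<^sub>m d) (mat_sum d d (\<lambda>l. w l \<cdot>\<^sub>m A l) I) \<le> relative_entropy d V' t' Q' a'"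
  proof -
    have "(\<Sum>i<d. \<Sum>j<d. ((Q'\<^sup>T * V') $$ (i, j))\<^sup>2 * (ln (a' i) * t' j))
      \<le> (\<Sum>i<d. \<Sum>j<d. ((Q'\<^sup>T * V') $$ (i, j))\<^sup>2 * (g * z' i * t' j))"
      using exp_chord_le(3)[OF z'01] t'pos
      by (intro sum_mono mult_left_mono mult_right_mono) (auto simp: a'_def g_def less_imp_le)
    also have "\<dots> = g * frob d Zm Tm"
      unfolding frob_two_eigendecompositions[OF Qz' Vt']
      by (simp add: sum_distrib_left mult.assoc mult.left_commute)
    finally show ?thesis
      unfolding relative_entropy_eq[OF Vt' QA'] sum_eigenvalues[OF Vt'] sum_eigenvalues[OF QA'] by linarith
  qed
  have lin: "(\<Sum>l\<in>I. w l * frob d K (F l)) = frob d K (mat_sum d d (\<lambda>l. w l \<cdot>\<^sub>m F l) I)"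
    if "\<And>l. l \<in> I \<Longrightarrow> sym_mat d (F l)" for K F
    using frob_mat_sum_left[of I F d w K] that sym_mat_carrier by (simp add: frob_commute[of d K])
  have lT: "(\<Sum>l\<in>I. w l * frob d K (T l)) = frob d K Tm" for K
    unfolding Tm_def by (rule lin) (rule sym_mat_eigendecomposition[OF VT])
  have lA: "(\<Sum>l\<in>I. w l * frob d K (A l)) = frob d K (mat_sum d d (\<lambda>l. w l \<cdot>\<^sub>m A l) I)" for K
    by (rule lin) (rule sym_mat_eigendecomposition[OF QA])
  have "(\<Sum>l\<in>I. w l * relative_entropy d (V l) (t l) (Q l) (a l))
      \<le> (\<Sum>l\<in>I. w l * (frob d H (T l) - frob d (1\<^sub>m d) (T l) + frob d (1\<^sub>m d) (A l)))"
    using w(1) Dl by (intro sum_mono mult_left_mono) auto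
  also have "\<dots> = frob d H Tm - frob d (1\<^sub>m d) Tm + frob d (1\<^sub>m d) (mat_sum d d (\<lambda>l. w l \<cdot>\<^sub>m A l) I)"
    unfolding lT[symmetric] lA[symmetric]
    by (simp add: sum.distrib sum_subtractf algebra_simps)
  finally have main: "(\<Sum>j<d. t' j * ln (t' j)) \<le> frob d H Tm + g * frob d Zm Tm"
    using D' D_le by linarith
  define K where "K = H + g \<cdot>\<^sub>m Zm"
  have K: "sym_mat d K" unfolding K_def by (intro symI H Zsym)
  obtain P y where Py: "eigendecomposition d P y K" and trK: "trace_exp d K = (\<Sum>i<d. exp (y i))"
    using trace_exp_obtain[OF K] .
  have PS: "eigendecomposition d P (\<lambda>i. exp (y i)) (P * mat_diag d (\<lambda>i. exp (y i)) * P\<^sup>T)"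
    using Py by (auto simp: eigendecomposition_def)
  have "0 \<le> relative_entropy d V' t' P (\<lambda>i. exp (y i))"
    by (rule relative_entropy_nonneg) (use t'pos in auto)
  also have "\<dots> = (\<Sum>j<d. t' j * ln (t' j)) - frob d K Tm - frob d (1\<^sub>m d) Tm + trace_exp d K"
    unfolding relative_entropy_eq[OF Vt' PS] frob_two_eigendecompositions[OF Py Vt']
      sum_eigenvalues[OF Vt'] trK by simp
  also have "frob d K Tm = frob d H Tm + g * frob d Zm Tm"
    unfolding K_def using H Zsym
    by (simp add: frob_commute[of d _ Tm] frob_add_right frob_smult_right sym_mat_def)
  finally have "frob d (1\<^sub>m d) Tm \<le> trace_exp d K" using main by linarith
  moreover have "frob d (1\<^sub>m d) Tm = (\<Sum>l\<in>I. w l * trace_exp d (H + \<theta> \<cdot>\<^sub>m Z l))"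
    unfolding lT[symmetric] using tr sum_eigenvalues[OF VT]
    by (intro sum.cong refl) (simp add: t_def)
  ultimately show ?thesis by (simp add: K_def Zm_def g_def)
qed

section \<open>A matrix Chernoff inequality\<close>

text \<open>
  The bound on the exponential moment is required for every shift \<open>H\<close>, because this makes it stable under sums of
  independent matrices: the other summands enter through \<open>H\<close>.
\<close>

definition exp_dominated ::
    "nat \<Rightarrow> real \<Rightarrow> 'a pmf \<Rightarrow> ('a \<Rightarrow> real Matrix.mat) \<Rightarrow> real Matrix.mat \<Rightarrow> bool" where
  "exp_dominated d \<theta> \<mu> X B \<longleftrightarrow>
     finite (set_pmf \<mu>) \<and> (\<forall>\<omega>\<in>set_pmf \<mu>. sym_mat d (X \<omega>)) \<and> sym_mat d B \<and>
     (\<forall>H. sym_mat d H \<longrightarrow>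
        measure_pmf.expectation \<mu> (\<lambda>\<omega>. trace_exp d (H + \<theta> \<cdot>\<^sub>m X \<omega>))
          \<le> trace_exp d (H + (exp \<theta> - 1) \<cdot>\<^sub>m B))"

lemma expectation_finite_pmf:
  assumes "finite (set_pmf \<mu>)"
  shows "measure_pmf.expectation \<mu> f = (\<Sum>\<omega>\<in>set_pmf \<mu>. pmf \<mu> \<omega> * (f \<omega> :: real))"
  using assms by (subst integral_measure_pmf_real[of "set_pmf \<mu>"]) (auto simp: mult.commute)

lemma exp_dominated_single:
  assumes fin: "finite (set_pmf \<mu>)" and Z: "\<And>\<omega>. \<omega> \<in> set_pmf \<mu> \<Longrightarrow> sym_mat d (Z \<omega>)"
    and Z01: "\<And>\<omega> v. \<omega> \<in> set_pmf \<mu> \<Longrightarrow> v \<in> carrier_vec d \<Longrightarrow>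
      0 \<le> v \<bullet> (Z \<omega> *\<^sub>v v) \<and> v \<bullet> (Z \<omega> *\<^sub>v v) \<le> v \<bullet> v"
  shows "exp_dominated d \<theta> \<mu> Z (mat_sum d d (\<lambda>\<omega>. pmf \<mu> \<omega> \<cdot>\<^sub>m Z \<omega>) (set_pmf \<mu>))"
  unfolding exp_dominated_def expectation_finite_pmf[OF fin]
  using fin Z Z01 sum_pmf_eq_1[OF fin order.refl]
  by (auto intro!: sym_mat_sum sym_mat_smult trace_exp_jensen)

text \<open>
  Conditionally on the first component, the second is replaced by its mean, and then the first.
\<close>

lemma exp_dominated_pair:
  assumes 1: "exp_dominated d \<theta> \<mu> X B" and 2: "exp_dominated d \<theta> \<nu> X' B'"
  shows "exp_dominated d \<theta> (pair_pmf \<mu> \<nu>) (\<lambda>(x, y). X x + X' y) (B + B')"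
  unfolding exp_dominated_def
proof (intro conjI ballI allI impI)
  have fin: "finite (set_pmf \<mu>)" "finite (set_pmf \<nu>)"
    and sym: "\<And>x. x \<in> set_pmf \<mu> \<Longrightarrow> sym_mat d (X x)" "\<And>y. y \<in> set_pmf \<nu> \<Longrightarrow> sym_mat d (X' y)"
      "sym_mat d B" "sym_mat d B'"
    using 1 2 by (auto simp: exp_dominated_def)
  note symI = sym_mat_add sym_mat_smult
  show "finite (set_pmf (pair_pmf \<mu> \<nu>))" using fin by simp
  show "sym_mat d (case \<omega> of (x, y) \<Rightarrow> X x + X' y)" if "\<omega> \<in> set_pmf (pair_pmf \<mu> \<nu>)" for \<omega>
    using that sym by (auto intro!: symI)
  show "sym_mat d (B + B')" by (intro symI sym)
  fix H assume H: "sym_mat d H"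
  let ?g = "exp \<theta> - 1"
  let ?f = "\<lambda>(x, y). trace_exp d (H + \<theta> \<cdot>\<^sub>m (X x + X' y))"
  have arr1: "H + \<theta> \<cdot>\<^sub>m (X x + X' y) = (H + \<theta> \<cdot>\<^sub>m X x) + \<theta> \<cdot>\<^sub>m X' y"
    if "x \<in> set_pmf \<mu>" "y \<in> set_pmf \<nu>" for x y
    using sym_mat_carrier[OF H] sym_mat_carrier[OF sym(1)[OF that(1)]] sym_mat_carrier[OF sym(2)[OF that(2)]]
    by (intro eq_matI) (auto simp: algebra_simps)
  have arr2: "(H + \<theta> \<cdot>\<^sub>m X x) + ?g \<cdot>\<^sub>m B' = (H + ?g \<cdot>\<^sub>m B') + \<theta> \<cdot>\<^sub>m X x" if "x \<in> set_pmf \<mu>" for x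
    using sym_mat_carrier[OF H] sym_mat_carrier[OF sym(1)[OF that]] sym_mat_carrier[OF sym(4)]
    by (intro eq_matI) auto
  have arr3: "(H + ?g \<cdot>\<^sub>m B') + ?g \<cdot>\<^sub>m B = H + ?g \<cdot>\<^sub>m (B + B')"
    using sym_mat_carrier[OF H] sym_mat_carrier[OF sym(3)] sym_mat_carrier[OF sym(4)]
    by (intro eq_matI) (auto simp: algebra_simps)
  have "measure_pmf.expectation (pair_pmf \<mu> \<nu>) (\<lambda>\<omega>. trace_exp d (H + \<theta> \<cdot>\<^sub>m (case \<omega> of (x, y) \<Rightarrow> X x + X' y)))
      = (\<Sum>x\<in>set_pmf \<mu>. \<Sum>y\<in>set_pmf \<nu>. pmf \<mu> x * pmf \<nu> y * trace_exp d (H + \<theta> \<cdot>\<^sub>m (X x + X' y)))"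
    using fin by (subst expectation_finite_pmf)
       (auto simp: sum.cartesian_product pmf_pair intro!: sum.cong)
  also have "\<dots> = (\<Sum>x\<in>set_pmf \<mu>. pmf \<mu> x *
      measure_pmf.expectation \<nu> (\<lambda>y. trace_exp d ((H + \<theta> \<cdot>\<^sub>m X x) + \<theta> \<cdot>\<^sub>m X' y)))"
    unfolding expectation_finite_pmf[OF fin(2)] sum_distrib_left
    by (intro sum.cong refl) (simp add: arr1)
  also have "\<dots> \<le> (\<Sum>x\<in>set_pmf \<mu>. pmf \<mu> x * trace_exp d ((H + \<theta> \<cdot>\<^sub>m X x) + ?g \<cdot>\<^sub>m B'))"
  proof (intro sum_mono mult_left_mono pmf_nonneg)
    fix x assume "x \<in> set_pmf \<mu>"
    then have "sym_mat d (H + \<theta> \<cdot>\<^sub>m X x)" by (intro symI H sym)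
    with 2 show "measure_pmf.expectation \<nu> (\<lambda>y. trace_exp d ((H + \<theta> \<cdot>\<^sub>m X x) + \<theta> \<cdot>\<^sub>m X' y))
        \<le> trace_exp d ((H + \<theta> \<cdot>\<^sub>m X x) + ?g \<cdot>\<^sub>m B')" unfolding exp_dominated_def by blast
  qed
  also have "\<dots> = measure_pmf.expectation \<mu> (\<lambda>x. trace_exp d ((H + ?g \<cdot>\<^sub>m B') + \<theta> \<cdot>\<^sub>m X x))"
    unfolding expectation_finite_pmf[OF fin(1)] by (intro sum.cong refl) (simp add: arr2)
  also have "\<dots> \<le> trace_exp d ((H + ?g \<cdot>\<^sub>m B') + ?g \<cdot>\<^sub>m B)"
  proof -
    have "sym_mat d (H + ?g \<cdot>\<^sub>m B')" by (intro symI H sym)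
    with 1 show ?thesis unfolding exp_dominated_def by blast
  qed
  finally show "measure_pmf.expectation (pair_pmf \<mu> \<nu>) (\<lambda>\<omega>. trace_exp d (H + \<theta> \<cdot>\<^sub>m (case \<omega> of (x, y) \<Rightarrow> X x + X' y)))
      \<le> trace_exp d (H + ?g \<cdot>\<^sub>m (B + B'))" by (simp only: arr3)
qed

lemma exp_dominated_map:
  assumes "exp_dominated d \<theta> \<mu> (\<lambda>\<omega>. X (f \<omega>)) B"
  shows "exp_dominated d \<theta> (map_pmf f \<mu>) X B"
  using assms by (auto simp: exp_dominated_def)

lemma exp_dominated_cong:
  assumes "exp_dominated d \<theta> \<mu> X B" "\<And>\<omega>. \<omega> \<in> set_pmf \<mu> \<Longrightarrow> X \<omega> = X' \<omega>"
  shows "exp_dominated d \<theta> \<mu> X' B"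
proof -
  have fin: "finite (set_pmf \<mu>)" using assms by (simp add: exp_dominated_def)
  show ?thesis using assms unfolding exp_dominated_def expectation_finite_pmf[OF fin] by auto
qed

lemma exp_dominated_independent_sum:
  assumes "finite I" "\<And>i. i \<in> I \<Longrightarrow> exp_dominated d \<theta> (\<mu> i) (X i) (B i)"
  shows "exp_dominated d \<theta> (Pi_pmf I dflt \<mu>) (\<lambda>\<omega>. mat_sum d d (\<lambda>i. X i (\<omega> i)) I) (mat_sum d d B I)"
  using assms
proof (induction I rule: finite_induct)
  case empty
  have "H + c \<cdot>\<^sub>m 0\<^sub>m d d = H" if "sym_mat d H" for H c
    using sym_mat_carrier[OF that] by simp
  then show ?case by (simp add: mat_sum_empty exp_dominated_def sym_mat_zero)
next
  case (insert i I)
  have d: "exp_dominated d \<theta> (\<mu> i) (X i) (B i)" using insert.prems by simp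
  have ne: "\<And>j. j \<in> I \<Longrightarrow> j \<noteq> i" using insert.hyps by auto
  have Bc: "B i \<in> carrier_mat d d" using d by (simp add: exp_dominated_def sym_mat_def)
  have "exp_dominated d \<theta> (pair_pmf (\<mu> i) (Pi_pmf I dflt \<mu>))
      (\<lambda>(x, y). X i x + mat_sum d d (\<lambda>i. X i (y i)) I) (B i + mat_sum d d B I)"
    using insert by (intro exp_dominated_pair) auto
  then have "exp_dominated d \<theta> (pair_pmf (\<mu> i) (Pi_pmf I dflt \<mu>))
      (\<lambda>\<omega>. mat_sum d d (\<lambda>j. X j ((case \<omega> of (x, y) \<Rightarrow> y(i := x)) j)) (insert i I)) (B i + mat_sum d d B I)"
  proof (rule exp_dominated_cong)
    fix \<omega> assume \<omega>: "\<omega> \<in> set_pmf (pair_pmf (\<mu> i) (Pi_pmf I dflt \<mu>))"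
    obtain x y where xy: "\<omega> = (x, y)" by (cases \<omega>)
    have "X i x \<in> carrier_mat d d" using d \<omega> xy by (auto simp: exp_dominated_def sym_mat_def)
    moreover have "mat_sum d d (\<lambda>j. X j ((y(i := x)) j)) I = mat_sum d d (\<lambda>j. X j (y j)) I"
      by (intro eq_matI) (auto intro!: sum.cong simp: ne)
    ultimately show "(case \<omega> of (x, y) \<Rightarrow> X i x + mat_sum d d (\<lambda>i. X i (y i)) I) =
        mat_sum d d (\<lambda>j. X j ((case \<omega> of (x, y) \<Rightarrow> y(i := x)) j)) (insert i I)"
      using insert.hyps xy by (subst mat_sum_insert) auto
  qed
  then show ?case
    unfolding Pi_pmf_insert[OF insert.hyps] mat_sum_insert[of I i B d, OF insert.hyps Bc]
    by (rule exp_dominated_map[where f = "\<lambda>(y, f). f(i := y)"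
          and X = "\<lambda>\<omega>. mat_sum d d (\<lambda>j. X j (\<omega> j)) (insert i I)"])
qed

lemma quadratic_form_le_of_trace_exp:
  assumes A: "sym_mat d A" and lt: "trace_exp d A < exp \<kappa>" and v: "v \<in> carrier_vec d"
  shows "v \<bullet> (A *\<^sub>v v) \<le> \<kappa> * (v \<bullet> v)"
proof -
  obtain Q a where Qa: "eigendecomposition d Q a A" and tr: "trace_exp d A = (\<Sum>i<d. exp (a i))"
    using trace_exp_obtain[OF A] .
  have a: "a i \<le> \<kappa>" if "i < d" for i
  proof -
    have "exp (a i) \<le> (\<Sum>i<d. exp (a i))" using that by (intro member_le_sum) auto
    then have "exp (a i) < exp \<kappa>" using lt tr by linarith
    then show ?thesis by simp
  qed
  show ?thesis
    unfolding eigendecomposition_mult_vec[OF Qa v] sum_distrib_left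
    using a by (intro sum_mono mult_right_mono) auto
qed

lemma trace_exp_le:
  assumes A: "sym_mat d A" and le: "\<And>v. v \<in> carrier_vec d \<Longrightarrow> v \<bullet> (A *\<^sub>v v) \<le> b * (v \<bullet> v)"
  shows "trace_exp d A \<le> real d * exp b"
proof -
  obtain Q a where Qa: "eigendecomposition d Q a A" and tr: "trace_exp d A = (\<Sum>i<d. exp (a i))"
    using trace_exp_obtain[OF A] .
  have "a i \<le> b" if "i < d" for i
    using le[OF eigendecomposition_eigenvector(1)[OF Qa that]] eigenvalue_quadratic_form[OF Qa that]
      eigendecomposition_eigenvector(3)[OF Qa that] by simp
  then have "trace_exp d A \<le> (\<Sum>i<d. exp b)" unfolding tr by (intro sum_mono) auto
  then show ?thesis by simp
qed

lemma trace_exp_nonneg: "0 \<le> trace_exp d A"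
  unfolding trace_exp_def by (intro sum_nonneg) auto

text \<open>
  Markov's inequality for the trace exponential. A single eigenvalue above \<open>\<kappa>\<close> makes the trace at
  least \<open>exp \<kappa>\<close>. Positive \<open>\<theta>\<close> gives the upper tail of \<open>X\<close>, negative \<open>\<theta>\<close> the lower one.
\<close>

lemma matrix_laplace_tail:
  assumes dom: "exp_dominated d \<theta> \<mu> X B"
    and b: "\<And>v. v \<in> carrier_vec d \<Longrightarrow> (exp \<theta> - 1) * (v \<bullet> (B *\<^sub>v v)) \<le> b * (v \<bullet> v)"
  shows "measure_pmf.prob \<mu> {\<omega>. \<not> (\<forall>v\<in>carrier_vec d. \<theta> * (v \<bullet> (X \<omega> *\<^sub>v v)) \<le> \<kappa> * (v \<bullet> v))}
     \<le> real d * exp (b - \<kappa>)"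
proof -
  let ?f = "\<lambda>\<omega>. trace_exp d (0\<^sub>m d d + \<theta> \<cdot>\<^sub>m X \<omega>)"
  have fin: "finite (set_pmf \<mu>)" and sym: "\<And>\<omega>. \<omega> \<in> set_pmf \<mu> \<Longrightarrow> sym_mat d (X \<omega>)" and B: "sym_mat d B"
    and le: "measure_pmf.expectation \<mu> ?f \<le> trace_exp d (0\<^sub>m d d + (exp \<theta> - 1) \<cdot>\<^sub>m B)"
    using dom sym_mat_zero unfolding exp_dominated_def by blast+
  let ?E = "{\<omega>. \<not> (\<forall>v\<in>carrier_vec d. \<theta> * (v \<bullet> (X \<omega> *\<^sub>v v)) \<le> \<kappa> * (v \<bullet> v))}"
  have "measure_pmf.prob \<mu> ?E = measure_pmf.prob \<mu> (?E \<inter> set_pmf \<mu>)"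
    by (simp add: measure_Int_set_pmf)
  also have "\<dots> \<le> measure_pmf.prob \<mu> {\<omega> \<in> space (measure_pmf \<mu>). ?f \<omega> \<ge> exp \<kappa>}"
  proof (rule measure_pmf.finite_measure_mono)
    show "?E \<inter> set_pmf \<mu> \<subseteq> {\<omega> \<in> space (measure_pmf \<mu>). ?f \<omega> \<ge> exp \<kappa>}"
    proof (rule subsetI, rule ccontr)
      fix \<omega> assume \<omega>: "\<omega> \<in> ?E \<inter> set_pmf \<mu>" and n: "\<omega> \<notin> {\<omega> \<in> space (measure_pmf \<mu>). ?f \<omega> \<ge> exp \<kappa>}"
      have s: "sym_mat d (X \<omega>)" using \<omega> sym by auto
      have 0: "0\<^sub>m d d + \<theta> \<cdot>\<^sub>m X \<omega> = \<theta> \<cdot>\<^sub>m X \<omega>"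
        using sym_mat_carrier[OF s] by simp
      have lt: "trace_exp d (\<theta> \<cdot>\<^sub>m X \<omega>) < exp \<kappa>" using n 0 by simp
      have "\<forall>v\<in>carrier_vec d. \<theta> * (v \<bullet> (X \<omega> *\<^sub>v v)) \<le> \<kappa> * (v \<bullet> v)"
        using quadratic_form_le_of_trace_exp[OF sym_mat_smult[OF s] lt]
          quadratic_form_smult[OF sym_mat_carrier[OF s]] by auto
      then show False using \<omega> by blast
    qed
  qed simp
  also have "\<dots> \<le> measure_pmf.expectation \<mu> ?f / exp \<kappa>"
    by (rule integral_Markov_inequality_measure[where A = "{}"])
       (use integrable_measure_pmf_finite[OF fin] trace_exp_nonneg in auto)
  also have "\<dots> \<le> (real d * exp b) / exp \<kappa>"
  proof (rule divide_right_mono)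
    have 0: "0\<^sub>m d d + (exp \<theta> - 1) \<cdot>\<^sub>m B = (exp \<theta> - 1) \<cdot>\<^sub>m B"
      using sym_mat_carrier[OF B] by simp
    have "trace_exp d ((exp \<theta> - 1) \<cdot>\<^sub>m B) \<le> real d * exp b"
      using b by (intro trace_exp_le sym_mat_smult B) (auto simp: quadratic_form_smult[OF sym_mat_carrier[OF B]])
    then show "measure_pmf.expectation \<mu> ?f \<le> real d * exp b" using le unfolding 0 by linarith
  qed simp
  finally show ?thesis by (simp add: exp_diff)
qed

text \<open>
  The difference of the two sides vanishes at 0 and has derivative \<open>ln (1 + x) - 2 x / 3\<close>, which is
  nonnegative on \<open>[0, 1]\<close> because \<open>ln (1 + x)\<close> is concave and \<open>ln 2 \<ge> 2 / 3\<close>.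
\<close>

lemma chernoff_exponent_upper:
  fixes \<delta> :: real
  assumes "0 \<le> \<delta>" "\<delta> \<le> 1"
  shows "\<delta>\<^sup>2 / 3 \<le> (1 + \<delta>) * ln (1 + \<delta>) - \<delta>"
proof -
  have slope: "2 * x / 3 \<le> ln (1 + x)" if "0 \<le> x" "x \<le> 1" for x :: real
  proof -
    have "(1 - x) * ln 1 + x * ln 2 \<le> ln ((1 - x) * 1 + x * 2)"
      using concave_onD[OF ln_concave, of x 1 2] that by simp
    moreover have "x * (2 / 3) \<le> x * ln 2" using that ln2_ge_two_thirds by (intro mult_left_mono) auto
    ultimately show ?thesis by (simp add: algebra_simps)
  qed
  have "(1 + 0) * ln (1 + 0) - 0 - 0\<^sup>2 / 3 \<le> (1 + \<delta>) * ln (1 + \<delta>) - \<delta> - \<delta>\<^sup>2 / 3"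
  proof (rule DERIV_nonneg_imp_nondecreasing[of 0 \<delta> "\<lambda>x. (1 + x) * ln (1 + x) - x - x\<^sup>2 / 3"])
    fix x assume x: "0 \<le> x" "x \<le> \<delta>"
    have "((\<lambda>x. (1 + x) * ln (1 + x) - x - x\<^sup>2 / 3) has_real_derivative (ln (1 + x) - 2 * x / 3)) (at x)"
      using x by (auto intro!: derivative_eq_intros)
    then show "\<exists>y. ((\<lambda>x. (1 + x) * ln (1 + x) - x - x\<^sup>2 / 3) has_real_derivative y) (at x) \<and> 0 \<le> y"
      using slope[of x] x assms by auto
  qed (use assms in auto)
  then show ?thesis by simp
qed

lemma chernoff_exponent_lower:
  fixes \<delta> :: real
  assumes "0 \<le> \<delta>" "\<delta> < 1"
  shows "\<delta>\<^sup>2 / 3 \<le> (1 - \<delta>) * ln (1 - \<delta>) + \<delta>"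
proof -
  have "(1 - 0) * ln (1 - 0) + 0 - 0\<^sup>2 / 3 \<le> (1 - \<delta>) * ln (1 - \<delta>) + \<delta> - \<delta>\<^sup>2 / 3"
  proof (rule DERIV_nonneg_imp_nondecreasing[of 0 \<delta> "\<lambda>x. (1 - x) * ln (1 - x) + x - x\<^sup>2 / 3"])
    fix x assume x: "0 \<le> x" "x \<le> \<delta>"
    have "((\<lambda>x. (1 - x) * ln (1 - x) + x - x\<^sup>2 / 3) has_real_derivative (- ln (1 - x) - 2 * x / 3)) (at x)"
      using x assms by (auto intro!: derivative_eq_intros)
    moreover have "ln (1 - x) \<le> - x" using ln_le_minus_one[of "1 - x"] x assms by simp
    ultimately show "\<exists>y. ((\<lambda>x. (1 - x) * ln (1 - x) + x - x\<^sup>2 / 3) has_real_derivative y) (at x) \<and> 0 \<le> y"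
      using x by (intro exI[of _ "- ln (1 - x) - 2 * x / 3"]) auto
  qed (use assms in auto)
  then show ?thesis by simp
qed

text \<open>
  The optimal parameters of the exponential moment are \<open>ln (1 + \<delta>)\<close> for the largest eigenvalue and
  \<open>ln (1 - \<delta>)\<close> for the smallest. Domination holds for summands that are normalized to lie between 0
  and 1, so \<open>lo\<close> and \<open>hi\<close> are measured in units of the bound on the summands. The upper tail is estimated with \<open>lo\<close> in place of the larger \<open>hi\<close>, so that both tails have the same bound.
\<close>

theorem matrix_chernoff:
  assumes dom: "\<And>\<theta>. exp_dominated d \<theta> \<mu> X B" and \<delta>: "0 < \<delta>" "\<delta> < 1"
    and lo: "\<And>v. v \<in> carrier_vec d \<Longrightarrow> lo * (v \<bullet> v) \<le> v \<bullet> (B *\<^sub>v v)"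
    and hi: "\<And>v. v \<in> carrier_vec d \<Longrightarrow> v \<bullet> (B *\<^sub>v v) \<le> hi * (v \<bullet> v)" and lohi: "0 \<le> lo" "lo \<le> hi"
  shows "1 - 2 * real d * exp (- (lo * \<delta>\<^sup>2 / 3)) \<le> measure_pmf.prob \<mu>
     {\<omega>. \<forall>v\<in>carrier_vec d. (1 - \<delta>) * lo * (v \<bullet> v) \<le> v \<bullet> (X \<omega> *\<^sub>v v) \<and>
        v \<bullet> (X \<omega> *\<^sub>v v) \<le> (1 + \<delta>) * hi * (v \<bullet> v)}"
proof -
  define \<theta>1 where "\<theta>1 = ln (1 + \<delta>)"
  define \<theta>2 where "\<theta>2 = ln (1 - \<delta>)"
  have pos: "0 < \<theta>1" and neg: "\<theta>2 < 0" using \<delta> by (auto simp: \<theta>1_def \<theta>2_def)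
  let ?E1 = "{\<omega>. \<not> (\<forall>v\<in>carrier_vec d. \<theta>1 * (v \<bullet> (X \<omega> *\<^sub>v v)) \<le> (\<theta>1 * ((1 + \<delta>) * hi)) * (v \<bullet> v))}"
  let ?E2 = "{\<omega>. \<not> (\<forall>v\<in>carrier_vec d. \<theta>2 * (v \<bullet> (X \<omega> *\<^sub>v v)) \<le> (\<theta>2 * ((1 - \<delta>) * lo)) * (v \<bullet> v))}"
  let ?G = "{\<omega>. \<forall>v\<in>carrier_vec d. (1 - \<delta>) * lo * (v \<bullet> v) \<le> v \<bullet> (X \<omega> *\<^sub>v v) \<and>
        v \<bullet> (X \<omega> *\<^sub>v v) \<le> (1 + \<delta>) * hi * (v \<bullet> v)}"
  have e1: "exp \<theta>1 - 1 = \<delta>" and e2: "exp \<theta>2 - 1 = - \<delta>" using \<delta> by (simp_all add: \<theta>1_def \<theta>2_def)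
  have "measure_pmf.prob \<mu> ?E1 \<le> real d * exp (\<delta> * hi - \<theta>1 * ((1 + \<delta>) * hi))"
    by (rule matrix_laplace_tail[OF dom]) (use e1 hi \<delta> in \<open>auto simp: mult.assoc intro!: mult_left_mono\<close>)
  also have "\<dots> \<le> real d * exp (- (lo * \<delta>\<^sup>2 / 3))"
  proof (intro mult_left_mono, subst exp_le_cancel_iff)
    have "lo * (\<delta>\<^sup>2 / 3) \<le> hi * ((1 + \<delta>) * ln (1 + \<delta>) - \<delta>)"
      using chernoff_exponent_upper[of \<delta>] \<delta> lohi by (intro mult_mono) auto
    then show "\<delta> * hi - \<theta>1 * ((1 + \<delta>) * hi) \<le> - (lo * \<delta>\<^sup>2 / 3)" by (simp add: \<theta>1_def algebra_simps)
  qed simp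
  finally have p1: "measure_pmf.prob \<mu> ?E1 \<le> real d * exp (- (lo * \<delta>\<^sup>2 / 3))" .
  have "measure_pmf.prob \<mu> ?E2 \<le> real d * exp (- \<delta> * lo - \<theta>2 * ((1 - \<delta>) * lo))"
    by (rule matrix_laplace_tail[OF dom]) (use e2 lo \<delta> in \<open>auto simp: mult.assoc intro!: mult_left_mono\<close>)
  also have "\<dots> \<le> real d * exp (- (lo * \<delta>\<^sup>2 / 3))"
  proof (intro mult_left_mono, subst exp_le_cancel_iff)
    have "lo * (\<delta>\<^sup>2 / 3) \<le> lo * ((1 - \<delta>) * ln (1 - \<delta>) + \<delta>)"
      using chernoff_exponent_lower[of \<delta>] \<delta> lohi by (intro mult_left_mono) auto
    then show "- \<delta> * lo - \<theta>2 * ((1 - \<delta>) * lo) \<le> - (lo * \<delta>\<^sup>2 / 3)" by (simp add: \<theta>2_def algebra_simps)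
  qed simp
  finally have p2: "measure_pmf.prob \<mu> ?E2 \<le> real d * exp (- (lo * \<delta>\<^sup>2 / 3))" .
  have sub: "- ?G \<subseteq> ?E1 \<union> ?E2"
  proof
    fix \<omega> assume "\<omega> \<in> - ?G"
    then obtain v where v: "v \<in> carrier_vec d" and
      "v \<bullet> (X \<omega> *\<^sub>v v) < (1 - \<delta>) * lo * (v \<bullet> v) \<or> (1 + \<delta>) * hi * (v \<bullet> v) < v \<bullet> (X \<omega> *\<^sub>v v)"
      by (auto simp: not_le)
    then have "\<theta>2 * ((1 - \<delta>) * lo * (v \<bullet> v)) < \<theta>2 * (v \<bullet> (X \<omega> *\<^sub>v v)) \<or>
        \<theta>1 * ((1 + \<delta>) * hi * (v \<bullet> v)) < \<theta>1 * (v \<bullet> (X \<omega> *\<^sub>v v))"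
      using pos neg by (auto intro: mult_strict_left_mono mult_strict_left_mono_neg)
    then show "\<omega> \<in> ?E1 \<union> ?E2" using v by (force simp: mult.assoc not_le)
  qed
  have "measure_pmf.prob \<mu> (- ?G) \<le> measure_pmf.prob \<mu> (?E1 \<union> ?E2)"
    by (rule measure_pmf.finite_measure_mono[OF sub]) simp
  also have "\<dots> \<le> measure_pmf.prob \<mu> ?E1 + measure_pmf.prob \<mu> ?E2"
    by (rule measure_Un_le) auto
  finally have "measure_pmf.prob \<mu> (- ?G) \<le> 2 * real d * exp (- (lo * \<delta>\<^sup>2 / 3))" using p1 p2 by linarith
  moreover have "measure_pmf.prob \<mu> (- ?G) = 1 - measure_pmf.prob \<mu> ?G"
    using measure_pmf.prob_compl[of ?G \<mu>] by (simp add: Compl_eq_Diff_UNIV)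
  ultimately show ?thesis by linarith
qed

section \<open>Euclidean norm, spectral norm and spectrum\<close>

lemma scalar_prod_le:
  fixes u v :: "real Matrix.vec"
  assumes "u \<in> carrier_vec d" "v \<in> carrier_vec d"
  shows "(u \<bullet> v)\<^sup>2 \<le> (u \<bullet> u) * (v \<bullet> v)"
  using Cauchy_Schwarz_ineq_sum[of "\<lambda>i. u $ i" "\<lambda>i. v $ i" "{..<d}"] assms
  by (simp add: scalar_prod_sum power2_eq_square)

lemma enorm_nonneg: "0 \<le> enorm v"
  by (simp add: enorm_def scalar_prod_self_nonneg)

lemma enorm_power2: "(enorm v)\<^sup>2 = v \<bullet> v"
  by (simp add: enorm_def scalar_prod_self_nonneg)

lemma enorm_L2_set: "v \<in> carrier_vec d \<Longrightarrow> enorm v = L2_set (\<lambda>i. v $ i) {..<d}"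
  by (simp add: enorm_def L2_set_def scalar_prod_sum power2_eq_square)

lemma enorm_add_le:
  assumes "u \<in> carrier_vec d" "v \<in> carrier_vec d"
  shows "enorm (u + v) \<le> enorm u + enorm v"
proof -
  have "enorm (u + v) = L2_set (\<lambda>i. u $ i + v $ i) {..<d}"
    using assms enorm_L2_set[of "u + v" d] by (auto simp: intro!: L2_set_cong)
  then show ?thesis
    using L2_set_triangle_ineq[of "\<lambda>i. u $ i" "\<lambda>i. v $ i" "{..<d}"] assms by (simp add: enorm_L2_set)
qed

lemma enorm_eq_0_iff: "v \<in> carrier_vec d \<Longrightarrow> enorm v = 0 \<longleftrightarrow> v = 0\<^sub>v d"
  by (simp add: enorm_def scalar_prod_self_eq_0_iff)

lemma enorm_zero [simp]: "enorm (0\<^sub>v d) = 0"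
  by (simp add: enorm_def)

lemma scalar_prod_le_enorm:
  assumes "u \<in> carrier_vec d" "v \<in> carrier_vec d"
  shows "u \<bullet> v \<le> enorm u * enorm v"
proof (rule power2_le_imp_le)
  show "(u \<bullet> v)\<^sup>2 \<le> (enorm u * enorm v)\<^sup>2"
    using scalar_prod_le[OF assms] by (simp add: power_mult_distrib enorm_power2)
qed (simp add: enorm_nonneg)

lemma enorm_smult: "enorm (c \<cdot>\<^sub>v v) = \<bar>c\<bar> * enorm v"
proof -
  have "(c \<cdot>\<^sub>v v) \<bullet> (c \<cdot>\<^sub>v v) = c\<^sup>2 * (v \<bullet> v)"
    by (simp add: scalar_prod_def sum_distrib_left power2_eq_square algebra_simps)
  then show ?thesis by (simp add: enorm_def real_sqrt_mult)
qed

text \<open>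
  The supremum that defines the spectral norm is over a bounded set, since the Cauchy-Schwarz
  inequality in each row bounds the norm of the image by the Frobenius norm; scaling to the unit
  sphere does the rest.
\<close>

lemma enorm_mult_vec_le_spectral_norm:
  assumes A: "A \<in> carrier_mat nr nc" and v: "v \<in> carrier_vec nc"
  shows "enorm (A *\<^sub>v v) \<le> spectral_norm A * enorm v"
proof -
  let ?S = "{v \<in> carrier_vec (dim_col A). enorm v \<le> 1}"
  define F where "F = (\<Sum>i<nr. Matrix.row A i \<bullet> Matrix.row A i)"
  have bound: "enorm (A *\<^sub>v u) \<le> sqrt F" if u: "u \<in> carrier_vec nc" "enorm u \<le> 1" for u
  proof -
    have uu: "u \<bullet> u \<le> 1" using u(2) enorm_power2[of u] power_le_one[OF enorm_nonneg u(2), of 2] by simp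
    have Au: "A *\<^sub>v u \<in> carrier_vec nr" using A u by (rule_tac mult_mat_vec_carrier)
    have "(A *\<^sub>v u) \<bullet> (A *\<^sub>v u) = (\<Sum>i<nr. (Matrix.row A i \<bullet> u)\<^sup>2)"
      using A by (subst scalar_prod_sum[OF Au]) (auto simp: power2_eq_square intro!: sum.cong)
    also have "\<dots> \<le> (\<Sum>i<nr. (Matrix.row A i \<bullet> Matrix.row A i) * 1)"
    proof (intro sum_mono)
      fix i assume "i \<in> {..<nr}"
      have r: "Matrix.row A i \<in> carrier_vec nc" using A by auto
      show "(Matrix.row A i \<bullet> u)\<^sup>2 \<le> (Matrix.row A i \<bullet> Matrix.row A i) * 1"
        using scalar_prod_le[OF r u(1)] mult_left_mono[OF uu scalar_prod_self_nonneg[of "Matrix.row A i"]]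
        by linarith
    qed
    finally show ?thesis by (simp add: enorm_def F_def)
  qed
  have bdd: "bdd_above ((\<lambda>v. enorm (A *\<^sub>v v)) ` ?S)"
    using bound A by (intro bdd_aboveI2[of _ _ "sqrt F"]) auto
  show ?thesis
  proof (cases "v = 0\<^sub>v nc")
    case True
    have "A *\<^sub>v v = 0\<^sub>v nr" using A by (intro eq_vecI) (auto simp: True)
    then show ?thesis by (simp add: True)
  next
    case False
    then have pos: "0 < enorm v" using enorm_eq_0_iff[OF v] enorm_nonneg[of v] by linarith
    let ?u = "(1 / enorm v) \<cdot>\<^sub>v v"
    have u: "?u \<in> ?S" using A v pos by (auto simp: enorm_smult)
    have Au: "A *\<^sub>v ?u = (1 / enorm v) \<cdot>\<^sub>v (A *\<^sub>v v)" using A v by (rule_tac mult_mat_vec)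
    have "enorm (A *\<^sub>v ?u) \<le> spectral_norm A"
      unfolding spectral_norm_def by (rule cSUP_upper[OF u bdd])
    then show ?thesis unfolding Au using pos by (simp add: enorm_smult field_simps)
  qed
qed

lemma quadratic_form_le_spectral_norm:
  assumes A: "A \<in> carrier_mat d d" and v: "v \<in> carrier_vec d"
  shows "v \<bullet> (A *\<^sub>v v) \<le> spectral_norm A * (v \<bullet> v)"
proof -
  have "v \<bullet> (A *\<^sub>v v) \<le> enorm v * enorm (A *\<^sub>v v)"
    using A v by (intro scalar_prod_le_enorm[of _ d]) auto
  also have "\<dots> \<le> enorm v * (spectral_norm A * enorm v)"
    using enorm_mult_vec_le_spectral_norm[OF A v] by (intro mult_left_mono enorm_nonneg)
  finally show ?thesis by (simp add: enorm_power2[symmetric] power2_eq_square algebra_simps)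
qed

lemma spectrum_bounds:
  assumes A: "sym_mat d A" and d: "0 < d"
  shows "v \<in> carrier_vec d \<Longrightarrow> Min (spectrum A) * (v \<bullet> v) \<le> v \<bullet> (A *\<^sub>v v)"
    and "v \<in> carrier_vec d \<Longrightarrow> v \<bullet> (A *\<^sub>v v) \<le> Max (spectrum A) * (v \<bullet> v)"
    and "Min (spectrum A) \<le> Max (spectrum A)"
proof -
  obtain Q a where Qa: "eigendecomposition d Q a A" using trace_exp_obtain[OF A] .
  have fin: "finite (spectrum A)" using card_finite_spectrum sym_mat_carrier[OF A] by blast
  have a: "a i \<in> spectrum A" if i: "i < d" for i
  proof -
    note q = eigendecomposition_eigenvector[OF Qa i]
    have "col Q i \<noteq> 0\<^sub>v d" using q(1,3) by auto
    then have "eigenvector A (col Q i) (a i)"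
      using q sym_mat_carrier[OF A] by (simp add: eigenvector_def)
    then show ?thesis by (auto simp: spectrum_def eigenvalue_def)
  qed
  show "Min (spectrum A) * (v \<bullet> v) \<le> v \<bullet> (A *\<^sub>v v)" if v: "v \<in> carrier_vec d"
    unfolding eigendecomposition_mult_vec[OF Qa v] sum_distrib_left
    using a fin by (intro sum_mono mult_right_mono) auto
  show "v \<bullet> (A *\<^sub>v v) \<le> Max (spectrum A) * (v \<bullet> v)" if v: "v \<in> carrier_vec d"
    unfolding eigendecomposition_mult_vec[OF Qa v] sum_distrib_left
    using a fin by (intro sum_mono mult_right_mono) auto
  show "Min (spectrum A) \<le> Max (spectrum A)"
    using Min_le[OF fin a[OF d]] Max_ge[OF fin a[OF d]] by linarith
qed

definition outer :: "nat \<Rightarrow> real Matrix.vec \<Rightarrow> real Matrix.mat" where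
  "outer d u = Matrix.mat d d (\<lambda>(i, j). u $ i * u $ j)"

lemma outer_sym: "sym_mat d (outer d u)"
  by (auto simp: sym_mat_def outer_def intro!: eq_matI)

lemma quadratic_form_outer:
  assumes "u \<in> carrier_vec d" "v \<in> carrier_vec d"
  shows "v \<bullet> (outer d u *\<^sub>v v) = (u \<bullet> v)\<^sup>2"
proof -
  have "v \<bullet> (outer d u *\<^sub>v v) = (\<Sum>i<d. \<Sum>j<d. (u $ i * v $ i) * (u $ j * v $ j))"
    using quadratic_form_frob[OF sym_mat_carrier[OF outer_sym] assms(2)]
    by (simp add: frob_def outer_def algebra_simps)
  also have "\<dots> = (u \<bullet> v) * (u \<bullet> v)"
    unfolding scalar_prod_sum[OF assms(2)] by (rule sum_product[symmetric])
  finally show ?thesis by (simp add: power2_eq_square)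
qed

section \<open>Block vectors and least squares\<close>

fun vconcat :: "real Matrix.vec list \<Rightarrow> real Matrix.vec" where
  "vconcat [] = 0\<^sub>v 0"
| "vconcat (v # vs) = v @\<^sub>v vconcat vs"

lemma vconcat_carrier:
  "(\<And>t. t \<in> set ts \<Longrightarrow> x t \<in> carrier_vec (c t)) \<Longrightarrow>
     vconcat (map x ts) \<in> carrier_vec (sum_list (map c ts))"
  by (induction ts) auto

lemma diag_block_mat_carrier:
  "(\<And>t. t \<in> set ts \<Longrightarrow> A t \<in> carrier_mat (r t) (c t)) \<Longrightarrow>
     diag_block_mat (map A ts) \<in> carrier_mat (sum_list (map r ts)) (sum_list (map c ts))"
  by (induction ts) (auto simp: Let_def)

lemma diag_block_mat_mult_vconcat:
  assumes "\<And>t. t \<in> set ts \<Longrightarrow> A t \<in> carrier_mat (r t) (c t)"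
    and "\<And>t. t \<in> set ts \<Longrightarrow> x t \<in> carrier_vec (c t)"
  shows "diag_block_mat (map A ts) *\<^sub>v vconcat (map x ts) = vconcat (map (\<lambda>t. A t *\<^sub>v x t) ts)"
  using assms
proof (induction ts)
  case Nil
  show ?case by (rule eq_vecI) auto
next
  case (Cons t ts)
  let ?r = "sum_list (map r ts)" and ?c = "sum_list (map c ts)"
  let ?D = "diag_block_mat (map A ts)" and ?y = "vconcat (map x ts)"
  have D: "?D \<in> carrier_mat ?r ?c" using Cons.prems by (intro diag_block_mat_carrier) auto
  have y: "?y \<in> carrier_vec ?c" using Cons.prems by (intro vconcat_carrier) auto
  have A: "A t \<in> carrier_mat (r t) (c t)" and x: "x t \<in> carrier_vec (c t)" using Cons.prems by auto
  have "diag_block_mat (map A (t # ts)) *\<^sub>v vconcat (map x (t # ts)) =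
      four_block_mat (A t) (0\<^sub>m (r t) ?c) (0\<^sub>m ?r (c t)) ?D *\<^sub>v (x t @\<^sub>v ?y)"
    using A D by (simp add: Let_def)
  also have "\<dots> = (A t *\<^sub>v x t + 0\<^sub>m (r t) ?c *\<^sub>v ?y) @\<^sub>v (0\<^sub>m ?r (c t) *\<^sub>v x t + ?D *\<^sub>v ?y)"
    by (rule four_block_mat_mult_vec[OF A _ _ D x y]) auto
  also have "0\<^sub>m (r t) ?c *\<^sub>v ?y = 0\<^sub>v (r t)" using y by auto
  also have "0\<^sub>m ?r (c t) *\<^sub>v x t = 0\<^sub>v ?r" using x by auto
  also have "A t *\<^sub>v x t + 0\<^sub>v (r t) = A t *\<^sub>v x t" using A x by auto
  also have "0\<^sub>v ?r + ?D *\<^sub>v ?y = ?D *\<^sub>v ?y" using D y by (intro left_zero_vec mult_mat_vec_carrier)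
  finally show ?case using Cons by simp
qed

lemma scalar_prod_vconcat:
  assumes "\<And>t. t \<in> set ts \<Longrightarrow> x t \<in> carrier_vec (c t)"
  shows "vconcat (map x ts) \<bullet> vconcat (map x ts) = (\<Sum>t\<leftarrow>ts. x t \<bullet> x t)"
  using assms
proof (induction ts)
  case (Cons t ts)
  have "vconcat (map x ts) \<in> carrier_vec (sum_list (map c ts))"
    using Cons.prems by (intro vconcat_carrier) auto
  then show ?case using Cons scalar_prod_append[of "x t" "c t" _ _ "x t"] by simp
qed (simp add: scalar_prod_def)

lemma vconcat_upt:
  assumes "\<And>t. t < s \<Longrightarrow> x t \<in> carrier_vec n" and n: "0 < n"
  shows "vconcat (map x [0..<s]) = Matrix.vec (s * n) (\<lambda>i. x (i div n) $ (i mod n))"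
  using assms(1)
proof (induction s arbitrary: x)
  case 0
  show ?case by (rule eq_vecI) auto
next
  case (Suc s)
  have "vconcat (map x [0..<Suc s]) = x 0 @\<^sub>v vconcat (map (\<lambda>t. x (Suc t)) [0..<s])"
    by (simp add: upt_conv_Cons map_Suc_upt[symmetric] comp_def del: upt_Suc)
  also have "vconcat (map (\<lambda>t. x (Suc t)) [0..<s]) = Matrix.vec (s * n) (\<lambda>i. x (Suc (i div n)) $ (i mod n))"
    using Suc.prems by (intro Suc.IH) auto
  also have "x 0 @\<^sub>v Matrix.vec (s * n) (\<lambda>i. x (Suc (i div n)) $ (i mod n)) =
      Matrix.vec (Suc s * n) (\<lambda>i. x (i div n) $ (i mod n))"
    using Suc.prems[of 0] n by (intro eq_vecI) (auto simp: le_div_geq le_mod_geq)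
  finally show ?case .
qed

text \<open>
  Comparison of \<open>w'\<close> with \<open>w\<close> itself shows that the residual at \<open>w'\<close> is at most the weighted noise;
  the triangle inequality then accounts for the factor 2.
\<close>

lemma least_squares_stability:
  fixes T :: "real Matrix.vec \<Rightarrow> real Matrix.vec"
  assumes D: "D \<in> carrier_mat M M"
    and T: "\<And>u. u \<in> S \<Longrightarrow> T u \<in> carrier_vec M"
    and T_add: "\<And>u w. u \<in> S \<Longrightarrow> w \<in> S \<Longrightarrow> T (u + w) = T u + T w"
    and S: "S \<subseteq> carrier_vec N" "\<And>u w. u \<in> S \<Longrightarrow> w \<in> S \<Longrightarrow> u - w \<in> S"
    and lo: "0 < lo" "\<And>u. u \<in> S \<Longrightarrow> lo * (enorm u)\<^sup>2 \<le> (enorm (D *\<^sub>v T u))\<^sup>2"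
    and w: "w \<in> S" and w': "w' \<in> S" and e: "e \<in> carrier_vec M"
    and min: "enorm (D *\<^sub>v (T w' - (T w + e))) \<le> enorm (D *\<^sub>v (T w - (T w + e)))"
  shows "enorm (w' - w) \<le> 2 / sqrt lo * enorm (D *\<^sub>v e)"
proof -
  define u where "u = w' - w"
  have u: "u \<in> S" using S w w' by (simp add: u_def)
  have "w \<in> carrier_vec N" "w' \<in> carrier_vec N" using S w w' by auto
  then have "u + w = w'" unfolding u_def by (intro eq_vecI) auto
  then have Tw': "T w' = T u + T w" using T_add[OF u w] by simp
  have c: "T u \<in> carrier_vec M" "T w \<in> carrier_vec M" using T u w by auto
  have r1: "T w' - (T w + e) = T u - e" unfolding Tw' using c e by (intro eq_vecI) auto
  have r2: "T w - (T w + e) = - e" using c e by (intro eq_vecI) auto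
  have Dc: "D *\<^sub>v (T u - e) \<in> carrier_vec M" "D *\<^sub>v e \<in> carrier_vec M"
    using D c e by (auto intro!: mult_mat_vec_carrier)
  have neg: "D *\<^sub>v (- e) = (- 1) \<cdot>\<^sub>v (D *\<^sub>v e)"
  proof -
    have "- e = (- 1) \<cdot>\<^sub>v e" by (intro eq_vecI) auto
    then show ?thesis using mult_mat_vec[OF D e, of "- 1"] by simp
  qed
  have "enorm (D *\<^sub>v (- e)) = enorm (D *\<^sub>v e)" unfolding neg enorm_smult by simp
  then have le: "enorm (D *\<^sub>v (T u - e)) \<le> enorm (D *\<^sub>v e)" using min unfolding r1 r2 by simp
  have "T u = (T u - e) + e" using c e by (intro eq_vecI) auto
  then have "D *\<^sub>v T u = D *\<^sub>v (T u - e) + D *\<^sub>v e"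
    using mult_add_distrib_mat_vec[OF D, of "T u - e" e] c e by auto
  then have "enorm (D *\<^sub>v T u) \<le> enorm (D *\<^sub>v (T u - e)) + enorm (D *\<^sub>v e)"
    using enorm_add_le[OF Dc] by simp
  also have "\<dots> \<le> 2 * enorm (D *\<^sub>v e)" using le by simp
  finally have up: "enorm (D *\<^sub>v T u) \<le> 2 * enorm (D *\<^sub>v e)" .
  have "sqrt lo * enorm u = sqrt (lo * (enorm u)\<^sup>2)"
    by (simp add: real_sqrt_mult enorm_nonneg)
  also have "\<dots> \<le> enorm (D *\<^sub>v T u)"
    using lo(2)[OF u] enorm_nonneg real_le_lsqrt by simp
  finally have "sqrt lo * enorm u \<le> 2 * enorm (D *\<^sub>v e)" using up by linarith
  then show ?thesis using lo(1) by (simp add: u_def field_simps)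
qed

lemma gram_quadratic_form:
  fixes A :: "real Matrix.mat"
  assumes A: "A \<in> carrier_mat nr nc" and x: "x \<in> carrier_vec nc"
  shows "x \<bullet> ((A\<^sup>T * A) *\<^sub>v x) = (A *\<^sub>v x) \<bullet> (A *\<^sub>v x)"
proof -
  have Ax: "A *\<^sub>v x \<in> carrier_vec nr" using A x by (rule mult_mat_vec_carrier)
  have "(A\<^sup>T * A) *\<^sub>v x = A\<^sup>T *\<^sub>v (A *\<^sub>v x)" using A x by (intro assoc_mult_mat_vec[of _ nc nr _ nc]) auto
  moreover have "A\<^sup>T *\<^sub>v (A *\<^sub>v x) \<in> carrier_vec nc" using A Ax by (intro mult_mat_vec_carrier[of _ nc nr]) auto
  ultimately show ?thesis
    using transpose_vec_mult_scalar[OF A x Ax] x by (simp add: comm_scalar_prod[of x nc])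
qed

lemma scalar_prod_rows:
  fixes A :: "real Matrix.mat"
  assumes A: "A \<in> carrier_mat nr nc" and v: "v \<in> carrier_vec nc"
  shows "(A *\<^sub>v v) \<bullet> (A *\<^sub>v v) = (\<Sum>l<nr. (Matrix.row A l \<bullet> v)\<^sup>2)"
  using A by (subst scalar_prod_sum[OF mult_mat_vec_carrier[OF assms]])
     (auto simp: power2_eq_square intro!: sum.cong)

section \<open>The sampled dynamical system\<close>

text \<open>
  The signals are the combinations of the first \<open>k\<close> columns of an orthogonal matrix, and \<open>lam\<close> lists the
  eigenvalues of the dynamics on them. An initial state and an input are described together by a vector
  of \<open>2k\<close> coefficients.
\<close>

locale spectral_frame =
  fixes n k :: nat and U :: "real Matrix.mat" and lam :: "nat \<Rightarrow> real"
  assumes U: "U \<in> carrier_mat n n" "U\<^sup>T * U = 1\<^sub>m n" and k: "1 \<le> k" "k \<le> n"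
begin

abbreviation V :: "real Matrix.mat" where "V \<equiv> first_cols k U"
abbreviation Ut :: "real Matrix.mat" where "Ut \<equiv> U_tilde n k U"

text \<open>
  The map from the \<open>2k\<close> coefficients of initial state and input to the state at time \<open>t\<close>.
\<close>

definition block :: "nat \<Rightarrow> real Matrix.mat" where
  "block t = V * Lam_row k lam t"

lemma V: "V \<in> carrier_mat n k"
  using U by (simp add: first_cols_def)

lemma VTV: "V\<^sup>T * V = 1\<^sub>m k"
proof (rule eq_matI)
  fix i j assume "i < dim_row (1\<^sub>m k :: real Matrix.mat)" "j < dim_col (1\<^sub>m k :: real Matrix.mat)"
  then have ij: "i < k" "j < k" by auto
  then have ij': "i < n" "j < n" using k by auto
  have "(V\<^sup>T * V) $$ (i, j) = (\<Sum>p<n. V\<^sup>T $$ (i, p) * V $$ (p, j))"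
    by (rule index_mult_mat_sum[of _ k n _ k]) (use V ij in auto)
  also have "\<dots> = (\<Sum>p<n. U\<^sup>T $$ (i, p) * U $$ (p, j))"
    using U ij ij' V by (intro sum.cong) (auto simp: first_cols_def)
  also have "\<dots> = (U\<^sup>T * U) $$ (i, j)"
    by (rule index_mult_mat_sum[of _ n n _ n, symmetric]) (use U ij' in auto)
  finally show "(V\<^sup>T * V) $$ (i, j) = 1\<^sub>m k $$ (i, j)" using U ij ij' by simp
qed (use V in auto)

lemma Ut: "Ut \<in> carrier_mat (2 * n) (2 * k)"
  using four_block_carrier_mat[OF V V] by (simp add: U_tilde_def mult_2)

lemma UtTUt: "Ut\<^sup>T * Ut = 1\<^sub>m (2 * k)"
proof -
  have T: "Ut\<^sup>T = four_block_mat (V\<^sup>T) (0\<^sub>m k n) (0\<^sub>m k n) (V\<^sup>T)"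
    unfolding U_tilde_def by (subst transpose_four_block_mat[of _ n k _ k _ n]) (use V in auto)
  have VT: "V\<^sup>T \<in> carrier_mat k n" using V by simp
  have "Ut\<^sup>T * Ut = four_block_mat (V\<^sup>T * V + 0\<^sub>m k n * 0\<^sub>m n k) (V\<^sup>T * 0\<^sub>m n k + 0\<^sub>m k n * V)
      (0\<^sub>m k n * V + V\<^sup>T * 0\<^sub>m n k) (0\<^sub>m k n * 0\<^sub>m n k + V\<^sup>T * V)"
    unfolding T unfolding U_tilde_def
    by (rule mult_four_block_mat[of _ k n _ n _ k _ _ k _ k]) (use V VT in auto)
  also have "\<dots> = four_block_mat (1\<^sub>m k) (0\<^sub>m k k) (0\<^sub>m k k) (1\<^sub>m k)"
    unfolding VTV using V VT by (simp add: left_mult_zero_mat[OF V] right_mult_zero_mat[OF VT])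
  also have "\<dots> = 1\<^sub>m (2 * k)" by (simp add: mult_2)
  finally show ?thesis .
qed

lemma Lam_pow_eq: "Lam_pow k lam t = mat_diag k (\<lambda>i. lam i ^ t)"
  unfolding Lam_pow_def
proof (induction t)
  case 0
  show ?case by (simp add: mat_diag_def)
next
  case (Suc t)
  show ?case using Suc by (simp add: mult.commute)
qed

lemma Lam_pow: "Lam_pow k lam t \<in> carrier_mat k k" by (simp add: Lam_pow_eq)
lemma Lam_bar: "Lam_bar k lam t \<in> carrier_mat k k" by (simp add: Lam_bar_def)

lemma Lam_bar_eq: "Lam_bar k lam t = mat_diag k (\<lambda>i. \<Sum>j<t. lam i ^ j)"
  unfolding Lam_bar_def by (rule eq_matI) (auto simp: Lam_pow_eq mat_diag_def)

lemma Lam_row: "Lam_row k lam t \<in> carrier_mat k (2 * k)"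
proof -
  have "Lam_row k lam t \<in> carrier_mat (k + 0) (k + k)"
    unfolding Lam_row_def append_cols_def by (rule four_block_carrier_mat) (use Lam_pow[of t] Lam_bar[of t] in auto)
  then show ?thesis by (simp add: mult_2)
qed

lemma Lam_row_index:
  assumes "i < k" "j < 2 * k"
  shows "Lam_row k lam t $$ (i, j) =
    (if j < k then (if i = j then lam i ^ t else 0) else (if i = j - k then (\<Sum>l<t. lam i ^ l) else 0))"
  using assms unfolding Lam_row_def append_cols_def Lam_pow_eq Lam_bar_eq
  by (subst index_mat_four_block) (auto simp: mat_diag_def)

lemma Lam_col_eq: "Lam_col k lam t = (Lam_row k lam t)\<^sup>T"
proof (rule eq_matI)
  fix i j assume "i < dim_row ((Lam_row k lam t)\<^sup>T)" "j < dim_col ((Lam_row k lam t)\<^sup>T)"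
  then have ij: "i < 2 * k" "j < k" using Lam_row[of t] by auto
  have "Lam_col k lam t $$ (i, j) =
    (if i < k then (if i = j then lam j ^ t else 0) else (if i - k = j then (\<Sum>l<t. lam j ^ l) else 0))"
    using ij unfolding Lam_col_def append_rows_def Lam_pow_eq Lam_bar_eq
    by (subst index_mat_four_block) (auto simp: mat_diag_def)
  then show "Lam_col k lam t $$ (i, j) = (Lam_row k lam t)\<^sup>T $$ (i, j)"
    using ij Lam_row[of t] Lam_row_index[of j i t] by auto
qed (use Lam_row[of t] Lam_pow[of t] Lam_bar[of t] in \<open>auto simp: Lam_col_def append_rows_def mult_2\<close>)

lemma block: "block t \<in> carrier_mat n (2 * k)"
  unfolding block_def using V Lam_row by (rule mult_carrier_mat)

lemma block_row: "Matrix.row (block t) l \<in> carrier_vec (2 * k)"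
  using block[of t] by (auto simp: Matrix.row_def)

lemma block_norm:
  assumes v: "v \<in> carrier_vec (2 * k)"
  shows "(block t *\<^sub>v v) \<bullet> (block t *\<^sub>v v) = (Lam_row k lam t *\<^sub>v v) \<bullet> (Lam_row k lam t *\<^sub>v v)"
proof -
  have L: "Lam_row k lam t *\<^sub>v v \<in> carrier_vec k" by (rule mult_mat_vec_carrier[OF Lam_row v])
  have "block t *\<^sub>v v = V *\<^sub>v (Lam_row k lam t *\<^sub>v v)"
    unfolding block_def by (rule assoc_mult_mat_vec[OF V Lam_row v])
  then show ?thesis using gram_quadratic_form[OF V L] L VTV by simp
qed

lemma Y_mat_sym: "sym_mat (2 * k) (Y_mat k s lam)"
  unfolding Y_mat_def
proof (rule sym_mat_sum)
  fix t
  show "sym_mat (2 * k) (Lam_col k lam t * Lam_row k lam t)"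
    unfolding sym_mat_def Lam_col_eq using Lam_row[of t]
    by (simp add: transpose_mult[of _ "2 * k" k _ "2 * k"])
qed

lemma Y_mat_quadratic_form:
  assumes v: "v \<in> carrier_vec (2 * k)"
  shows "v \<bullet> (Y_mat k s lam *\<^sub>v v) = (\<Sum>t<s. (block t *\<^sub>v v) \<bullet> (block t *\<^sub>v v))"
proof -
  have "v \<bullet> (Y_mat k s lam *\<^sub>v v) = (\<Sum>t<s. v \<bullet> ((Lam_col k lam t * Lam_row k lam t) *\<^sub>v v))"
    unfolding Y_mat_def
  proof (rule quadratic_form_mat_sum[OF _ v])
    fix t show "Lam_col k lam t * Lam_row k lam t \<in> carrier_mat (2 * k) (2 * k)"
      unfolding Lam_col_eq using Lam_row[of t] by simp
  qed
  then show ?thesis unfolding Lam_col_eq gram_quadratic_form[OF Lam_row v] block_norm[OF v] .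
qed

text \<open>
  The block row of time \<open>t\<close> is nonzero: if a power of an eigenvalue vanishes at a positive time, the
  eigenvalue is 0 and the geometric sum beside it equals 1. Hence the coherences are positive and the
  sample size condition excludes empty samples, for which the weights would be meaningless.
\<close>

lemma block_not_annihilated:
  "\<exists>l<n. \<exists>v\<in>carrier_vec (2 * k). Matrix.row (block t) l \<bullet> v \<noteq> 0"
proof (rule ccontr)
  assume *: "\<not> ?thesis"
  have zero: "(Lam_row k lam t *\<^sub>v v) $ 0 = 0" if v: "v \<in> carrier_vec (2 * k)" for v
  proof -
    have L: "Lam_row k lam t *\<^sub>v v \<in> carrier_vec k" by (rule mult_mat_vec_carrier[OF Lam_row v])
    have "(Lam_row k lam t *\<^sub>v v) \<bullet> (Lam_row k lam t *\<^sub>v v) = 0"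
      unfolding block_norm[OF v, symmetric] scalar_prod_rows[OF block v]
      using * v by (intro sum.neutral) auto
    then have "Lam_row k lam t *\<^sub>v v = 0\<^sub>v k" using scalar_prod_self_eq_0_iff[OF L] by simp
    then show ?thesis using k by simp
  qed
  have entry: "Lam_row k lam t $$ (0, j) = 0" if "j < 2 * k" for j
    using zero[of "unit_vec (2 * k) j"] that k Lam_row[of t] by simp
  have "lam 0 ^ t = 0" using entry[of 0] k Lam_row_index[of 0 0 t] by simp
  then have "lam 0 = 0" "t \<noteq> 0" by (auto intro: ccontr)
  moreover have "(\<Sum>l<t. lam 0 ^ l) = 0" using entry[of k] k Lam_row_index[of 0 k t] by simp
  ultimately have "(\<Sum>l<t. (0::real) ^ l) = 0" by simp
  moreover have "(\<Sum>l<t. (0::real) ^ l) = 1"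
    using \<open>t \<noteq> 0\<close> by (simp add: power_0_left sum.delta)
  ultimately show False by simp
qed

lemma span_eq: "span_U_tilde n k U = {Ut *\<^sub>v v |v. v \<in> carrier_vec (2 * k)}"
  unfolding span_U_tilde_def vec_space.col_space_eq[OF Ut]
  using Ut mult_mat_vec_carrier[OF Ut] by auto

lemma Ut_norm:
  assumes v: "v \<in> carrier_vec (2 * k)"
  shows "enorm (Ut *\<^sub>v v) = enorm v"
  using gram_quadratic_form[OF Ut v] UtTUt v by (simp add: enorm_def)

lemma pi_op_Ut:
  assumes v: "v \<in> carrier_vec (2 * k)"
  shows "pi_op n k s U lam (Ut *\<^sub>v v) = vconcat (map (\<lambda>t. block t *\<^sub>v v) [0..<s])"
proof -
  have UtT: "Ut\<^sup>T \<in> carrier_mat (2 * k) (2 * n)" using Ut by simp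
  have "Ut\<^sup>T *\<^sub>v (Ut *\<^sub>v v) = v"
    using assoc_mult_mat_vec[OF UtT Ut v] UtTUt v by simp
  then have "(V * Lam_row k lam t * Ut\<^sup>T) *\<^sub>v (Ut *\<^sub>v v) = block t *\<^sub>v v" for t
    unfolding block_def[symmetric]
    using assoc_mult_mat_vec[OF block UtT mult_mat_vec_carrier[OF Ut v]] by simp
  moreover have "vconcat (map (\<lambda>t. block t *\<^sub>v v) [0..<s]) =
      Matrix.vec (s * n) (\<lambda>i. (block (i div n) *\<^sub>v v) $ (i mod n))"
    using k by (intro vconcat_upt mult_mat_vec_carrier[OF block v]) auto
  ultimately show ?thesis by (simp add: pi_op_def)
qed

lemma pi_op_carrier: "pi_op n k s U lam w \<in> carrier_vec (s * n)"
  by (simp add: pi_op_def)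

lemma pi_op_add:
  assumes "u \<in> span_U_tilde n k U" "w \<in> span_U_tilde n k U"
  shows "pi_op n k s U lam (u + w) = pi_op n k s U lam u + pi_op n k s U lam w"
proof (rule eq_vecI)
  have c: "u \<in> carrier_vec (2 * n)" "w \<in> carrier_vec (2 * n)"
    using assms mult_mat_vec_carrier[OF Ut] by (auto simp: span_eq)
  fix i assume "i < dim_vec (pi_op n k s U lam u + pi_op n k s U lam w)"
  then have i: "i < s * n" by (simp add: pi_op_def)
  have n: "i mod n < n" using k by simp
  let ?M = "V * Lam_row k lam (i div n) * Ut\<^sup>T"
  have M: "?M \<in> carrier_mat n (2 * n)"
    unfolding block_def[symmetric] using block[of "i div n"] Ut by (intro mult_carrier_mat[of _ n "2 * k"]) auto
  have "(?M *\<^sub>v (u + w)) $ (i mod n) = (?M *\<^sub>v u) $ (i mod n) + (?M *\<^sub>v w) $ (i mod n)"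
  proof -
    have "i mod n < dim_vec (?M *\<^sub>v w)"
      unfolding carrier_vecD[OF mult_mat_vec_carrier[OF M c(2)]] by (rule n)
    then show ?thesis unfolding mult_add_distrib_mat_vec[OF M c] by (rule index_add_vec(1))
  qed
  then show "pi_op n k s U lam (u + w) $ i = (pi_op n k s U lam u + pi_op n k s U lam w) $ i"
    using i by (simp add: pi_op_def)
qed (simp add: pi_op_def)

definition sample_energy ::
    "nat \<Rightarrow> (nat \<Rightarrow> nat) \<Rightarrow> (nat \<Rightarrow> nat pmf) \<Rightarrow> (nat \<Rightarrow> nat \<Rightarrow> nat) \<Rightarrow> real Matrix.vec \<Rightarrow> real" where
  "sample_energy s m p \<omega> v = (\<Sum>t<s. \<Sum>j<m t.
     (Matrix.row (block t) (\<omega> t j) \<bullet> v)\<^sup>2 / (real (m t) * pmf (p t) (\<omega> t j)))"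

lemma W_cal_carrier: "W_cal s m \<in> carrier_mat (\<Sum>t<s. m t) (\<Sum>t<s. m t)"
  and P_cal_carrier: "P_cal s m p \<omega> \<in> carrier_mat (\<Sum>t<s. m t) (\<Sum>t<s. m t)"
  and S_cal_carrier: "S_cal n s m \<omega> \<in> carrier_mat (\<Sum>t<s. m t) (s * n)"
proof -
  have s: "sum_list (map m [0..<s]) = (\<Sum>t<s. m t)" "sum_list (map (\<lambda>t. n) [0..<s]) = s * n"
    by (simp_all add: interv_sum_list_conv_sum_set_nat lessThan_atLeast0)
  show "W_cal s m \<in> carrier_mat (\<Sum>t<s. m t) (\<Sum>t<s. m t)"
    unfolding W_cal_def s[symmetric] by (rule diag_block_mat_carrier) auto
  show "P_cal s m p \<omega> \<in> carrier_mat (\<Sum>t<s. m t) (\<Sum>t<s. m t)"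
    unfolding P_cal_def s[symmetric] by (rule diag_block_mat_carrier) auto
  show "S_cal n s m \<omega> \<in> carrier_mat (\<Sum>t<s. m t) (s * n)"
    unfolding S_cal_def s[symmetric] by (rule diag_block_mat_carrier) auto
qed

text \<open>
  All three operators are block diagonal, so the norm splits over the times; within one time,
  sampling selects the entry at the drawn node and the weights divide it by the square root of the
  sample size times the probability of the node.
\<close>

lemma weighted_sample_norm:
  assumes v: "v \<in> carrier_vec (2 * k)" and \<omega>: "\<And>t j. t < s \<Longrightarrow> j < m t \<Longrightarrow> \<omega> t j < n"
  shows "(enorm ((W_cal s m * P_cal s m p \<omega>) *\<^sub>v (S_cal n s m \<omega> *\<^sub>v pi_op n k s U lam (Ut *\<^sub>v v))))\<^sup>2
     = sample_energy s m p \<omega> v"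
proof -
  let ?x = "\<lambda>t. block t *\<^sub>v v"
  let ?M = "\<lambda>t. (1 / sqrt (real (m t))) \<cdot>\<^sub>m 1\<^sub>m (m t)"
  let ?P = "\<lambda>t. mat_diag (m t) (\<lambda>j. 1 / sqrt (pmf (p t) (\<omega> t j)))"
  let ?S = "\<lambda>t. Matrix.mat (m t) n (\<lambda>(i, j). if j = \<omega> t i then 1 else 0 :: real)"
  have x: "?x t \<in> carrier_vec n" for t by (rule mult_mat_vec_carrier[OF block v])
  have Sx: "?S t *\<^sub>v ?x t \<in> carrier_vec (m t)" for t by (rule mult_mat_vec_carrier[OF _ x]) simp
  have PSx: "?P t *\<^sub>v (?S t *\<^sub>v ?x t) \<in> carrier_vec (m t)" for t
    by (rule mult_mat_vec_carrier[OF _ Sx]) simp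
  have MPSx: "?M t *\<^sub>v (?P t *\<^sub>v (?S t *\<^sub>v ?x t)) \<in> carrier_vec (m t)" for t
    by (rule mult_mat_vec_carrier[OF _ PSx]) simp
  have 1: "S_cal n s m \<omega> *\<^sub>v pi_op n k s U lam (Ut *\<^sub>v v) = vconcat (map (\<lambda>t. ?S t *\<^sub>v ?x t) [0..<s])"
    unfolding S_cal_def pi_op_Ut[OF v]
    by (rule diag_block_mat_mult_vconcat[where c = "\<lambda>_. n" and r = m]) (use x in auto)
  have 2: "P_cal s m p \<omega> *\<^sub>v vconcat (map (\<lambda>t. ?S t *\<^sub>v ?x t) [0..<s]) =
      vconcat (map (\<lambda>t. ?P t *\<^sub>v (?S t *\<^sub>v ?x t)) [0..<s])"
    unfolding P_cal_def by (rule diag_block_mat_mult_vconcat[where c = m and r = m]) (use Sx in auto)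
  have 3: "W_cal s m *\<^sub>v vconcat (map (\<lambda>t. ?P t *\<^sub>v (?S t *\<^sub>v ?x t)) [0..<s]) =
      vconcat (map (\<lambda>t. ?M t *\<^sub>v (?P t *\<^sub>v (?S t *\<^sub>v ?x t))) [0..<s])"
    unfolding W_cal_def by (rule diag_block_mat_mult_vconcat[where c = m and r = m]) (use PSx in auto)
  have c: "vconcat (map (\<lambda>t. ?S t *\<^sub>v ?x t) [0..<s]) \<in> carrier_vec (\<Sum>t<s. m t)"
    using vconcat_carrier[of "[0..<s]" "\<lambda>t. ?S t *\<^sub>v ?x t" m] Sx
    by (simp add: interv_sum_list_conv_sum_set_nat lessThan_atLeast0)
  have "(W_cal s m * P_cal s m p \<omega>) *\<^sub>v (S_cal n s m \<omega> *\<^sub>v pi_op n k s U lam (Ut *\<^sub>v v))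
      = vconcat (map (\<lambda>t. ?M t *\<^sub>v (?P t *\<^sub>v (?S t *\<^sub>v ?x t))) [0..<s])"
    unfolding 1 assoc_mult_mat_vec[OF W_cal_carrier P_cal_carrier c] 2 3 ..
  then have "(enorm ((W_cal s m * P_cal s m p \<omega>) *\<^sub>v (S_cal n s m \<omega> *\<^sub>v pi_op n k s U lam (Ut *\<^sub>v v))))\<^sup>2
      = (\<Sum>t\<leftarrow>[0..<s]. (?M t *\<^sub>v (?P t *\<^sub>v (?S t *\<^sub>v ?x t))) \<bullet> (?M t *\<^sub>v (?P t *\<^sub>v (?S t *\<^sub>v ?x t))))"
    unfolding enorm_power2 by (simp only:) (rule scalar_prod_vconcat[where c = m], rule MPSx)
  also have "\<dots> = (\<Sum>t<s. (?M t *\<^sub>v (?P t *\<^sub>v (?S t *\<^sub>v ?x t))) \<bullet> (?M t *\<^sub>v (?P t *\<^sub>v (?S t *\<^sub>v ?x t))))"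
    by (simp only: interv_sum_list_conv_sum_set_nat set_upt lessThan_atLeast0)
  also have "\<dots> = sample_energy s m p \<omega> v"
    unfolding sample_energy_def
  proof (rule sum.cong[OF refl])
    fix t assume "t \<in> {..<s}"
    then have t: "t < s" by simp
    have e: "(?M t *\<^sub>v (?P t *\<^sub>v (?S t *\<^sub>v ?x t))) $ j =
        1 / sqrt (real (m t)) * (1 / sqrt (pmf (p t) (\<omega> t j)) * (Matrix.row (block t) (\<omega> t j) \<bullet> v))"
      if j: "j < m t" for j
    proof -
      have "(?S t *\<^sub>v ?x t) $ j = (\<Sum>l<n. ?S t $$ (j, l) * ?x t $ l)"
        by (rule index_mult_vec_sum[OF _ x j]) simp
      also have "\<dots> = (\<Sum>l<n. if l = \<omega> t j then ?x t $ l else 0)"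
        by (rule sum.cong[OF refl]) (use j in auto)
      also have "\<dots> = Matrix.row (block t) (\<omega> t j) \<bullet> v"
        using \<omega>[OF t j] block[of t] by simp
      finally have e1: "(?S t *\<^sub>v ?x t) $ j = Matrix.row (block t) (\<omega> t j) \<bullet> v" .
      have "(?P t *\<^sub>v (?S t *\<^sub>v ?x t)) $ j = (\<Sum>l<m t. ?P t $$ (j, l) * (?S t *\<^sub>v ?x t) $ l)"
        by (rule index_mult_vec_sum[OF _ Sx j]) simp
      also have "\<dots> = (\<Sum>l<m t. if l = j then 1 / sqrt (pmf (p t) (\<omega> t j)) * (?S t *\<^sub>v ?x t) $ j else 0)"
        by (rule sum.cong[OF refl]) (use j in \<open>auto simp: mat_diag_def\<close>)
      also have "\<dots> = 1 / sqrt (pmf (p t) (\<omega> t j)) * (Matrix.row (block t) (\<omega> t j) \<bullet> v)"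
        using j e1 by simp
      finally have e2: "(?P t *\<^sub>v (?S t *\<^sub>v ?x t)) $ j =
          1 / sqrt (pmf (p t) (\<omega> t j)) * (Matrix.row (block t) (\<omega> t j) \<bullet> v)" .
      have "(?M t *\<^sub>v (?P t *\<^sub>v (?S t *\<^sub>v ?x t))) $ j =
          (\<Sum>l<m t. ?M t $$ (j, l) * (?P t *\<^sub>v (?S t *\<^sub>v ?x t)) $ l)"
        by (rule index_mult_vec_sum[OF _ PSx j]) simp
      also have "\<dots> = (\<Sum>l<m t. if l = j then 1 / sqrt (real (m t)) * (?P t *\<^sub>v (?S t *\<^sub>v ?x t)) $ j else 0)"
        by (rule sum.cong[OF refl]) (use j in auto)
      also have "\<dots> = 1 / sqrt (real (m t)) * (?P t *\<^sub>v (?S t *\<^sub>v ?x t)) $ j" using j by simp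
      finally show ?thesis unfolding e2 .
    qed
    show "(?M t *\<^sub>v (?P t *\<^sub>v (?S t *\<^sub>v ?x t))) \<bullet> (?M t *\<^sub>v (?P t *\<^sub>v (?S t *\<^sub>v ?x t))) =
        (\<Sum>j<m t. (Matrix.row (block t) (\<omega> t j) \<bullet> v)\<^sup>2 / (real (m t) * pmf (p t) (\<omega> t j)))"
      unfolding scalar_prod_sum[OF MPSx]
      by (intro sum.cong refl) (simp add: e power2_eq_square[symmetric] power_mult_distrib power_divide del: index_mult_mat_vec)
  qed
  finally show ?thesis .
qed


text \<open>
  The contribution of one drawn node, divided by \<open>R\<close>, which makes it at most the identity when the
  sample size is at least the coherence divided by \<open>R\<close>.
\<close>

definition sample_term :: "real \<Rightarrow> nat \<Rightarrow> nat pmf \<Rightarrow> nat \<Rightarrow> nat \<Rightarrow> real Matrix.mat" where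
  "sample_term R M q t l = (1 / (R * (real M * pmf q l))) \<cdot>\<^sub>m outer (2 * k) (Matrix.row (block t) l)"

lemma sample_term_sym: "sym_mat (2 * k) (sample_term R M q t l)"
  unfolding sample_term_def by (intro sym_mat_smult outer_sym)

lemma sample_term_quadratic_form:
  assumes "v \<in> carrier_vec (2 * k)"
  shows "v \<bullet> (sample_term R M q t l *\<^sub>v v) = (Matrix.row (block t) l \<bullet> v)\<^sup>2 / (R * (real M * pmf q l))"
  unfolding sample_term_def quadratic_form_smult[OF sym_mat_carrier[OF outer_sym] assms]
    quadratic_form_outer[OF block_row assms] by simp

text \<open>
  The probability of a node cancels the importance weight, so every distribution of full support
  has the same mean.
\<close>

lemma sample_term_mean:
  assumes v: "v \<in> carrier_vec (2 * k)" and q: "set_pmf q = {..<n}" and M: "0 < M"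
  shows "(\<Sum>l<n. pmf q l * (v \<bullet> (sample_term R M q t l *\<^sub>v v))) =
    (block t *\<^sub>v v) \<bullet> (block t *\<^sub>v v) / (R * real M)"
proof -
  have "pmf q l \<noteq> 0" if "l < n" for l using q that set_pmf_iff by (metis lessThan_iff)
  then have "(\<Sum>l<n. pmf q l * (v \<bullet> (sample_term R M q t l *\<^sub>v v))) =
      (\<Sum>l<n. (Matrix.row (block t) l \<bullet> v)\<^sup>2 / (R * real M))"
    unfolding sample_term_quadratic_form[OF v] by (intro sum.cong refl) (auto simp: field_simps)
  then show ?thesis unfolding scalar_prod_rows[OF block v] by (simp add: sum_divide_distrib)
qed

definition sample_sum ::
    "real \<Rightarrow> nat \<Rightarrow> (nat \<Rightarrow> nat) \<Rightarrow> (nat \<Rightarrow> nat pmf) \<Rightarrow> (nat \<Rightarrow> nat \<Rightarrow> nat) \<Rightarrow> real Matrix.mat" where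
  "sample_sum R s m p \<omega> = mat_sum (2 * k) (2 * k)
     (\<lambda>t. mat_sum (2 * k) (2 * k) (\<lambda>j. sample_term R (m t) (p t) t (\<omega> t j)) {..<m t}) {..<s}"

lemma sample_sum_quadratic_form:
  assumes v: "v \<in> carrier_vec (2 * k)"
  shows "v \<bullet> (sample_sum R s m p \<omega> *\<^sub>v v) = sample_energy s m p \<omega> v / R"
proof -
  have "v \<bullet> (sample_sum R s m p \<omega> *\<^sub>v v) =
      (\<Sum>t<s. \<Sum>j<m t. v \<bullet> (sample_term R (m t) (p t) t (\<omega> t j) *\<^sub>v v))"
    unfolding sample_sum_def
    by (subst quadratic_form_mat_sum[OF mat_sum_carrier v], rule sum.cong[OF refl],
        rule quadratic_form_mat_sum[OF sym_mat_carrier[OF sample_term_sym] v])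
  then show ?thesis
    by (simp add: sample_term_quadratic_form[OF v] sample_energy_def sum_divide_distrib mult.commute)
qed

lemma divide_coherence_bound:
  fixes x y c R M q :: real
  assumes "x \<le> q * (M * R) * y" "0 < R" "0 < M" "0 < q"
  shows "x / (R * (M * q)) \<le> y"
  using assms by (simp add: divide_le_eq mult.commute mult.left_commute)

text \<open>
  Every single draw is dominated; independence within a time and then between times adds the draws
  up.
\<close>

lemma exp_dominated_regime2:
  assumes p: "\<And>t. t < s \<Longrightarrow> set_pmf (p t) = {..<n}" and R: "0 < R" and m: "\<And>t. t < s \<Longrightarrow> 0 < m t"
    and coh: "\<And>t l (v :: real Matrix.vec). t < s \<Longrightarrow> l < n \<Longrightarrow> v \<in> carrier_vec (2 * k) \<Longrightarrow>
      (Matrix.row (block t) l \<bullet> v)\<^sup>2 \<le> pmf (p t) l * (real (m t) * R) * (v \<bullet> v)"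
  obtains B where "\<And>\<theta>. exp_dominated (2 * k) \<theta> (sampling Regime2 s m p) (sample_sum R s m p) B"
    "\<And>v :: real Matrix.vec. v \<in> carrier_vec (2 * k) \<Longrightarrow> v \<bullet> (B *\<^sub>v v) = (v \<bullet> (Y_mat k s lam *\<^sub>v v)) / R"
proof -
  let ?d = "2 * k"
  define E where "E t = mat_sum ?d ?d (\<lambda>l. pmf (p t) l \<cdot>\<^sub>m sample_term R (m t) (p t) t l) {..<n}" for t
  define B where "B = mat_sum ?d ?d (\<lambda>t. mat_sum ?d ?d (\<lambda>j. E t) {..<m t}) {..<s}"
  have pos: "0 < pmf (p t) l" if "t < s" "l < n" for t l
    using p[OF that(1)] that(2) pmf_positive_iff by fastforce
  have draw: "exp_dominated ?d \<theta> (p t) (sample_term R (m t) (p t) t) (E t)" if t: "t < s" for \<theta> t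
    unfolding E_def p[OF t, symmetric]
  proof (rule exp_dominated_single)
    show "finite (set_pmf (p t))" using p[OF t] by simp
    show "sym_mat ?d (sample_term R (m t) (p t) t l)" for l by (rule sample_term_sym)
    fix l and v :: "real Matrix.vec" assume "l \<in> set_pmf (p t)" and v: "v \<in> carrier_vec ?d"
    then have l: "l < n" using p[OF t] by simp
    show "0 \<le> v \<bullet> (sample_term R (m t) (p t) t l *\<^sub>v v) \<and>
        v \<bullet> (sample_term R (m t) (p t) t l *\<^sub>v v) \<le> v \<bullet> v"
      unfolding sample_term_quadratic_form[OF v]
      using divide_coherence_bound[OF coh[OF t l v] R _ pos[OF t l]] m[OF t] R by simp
  qed
  have "exp_dominated ?d \<theta> (Pi_pmf {..<m t} 0 (\<lambda>j. p t))
      (\<lambda>\<omega>. mat_sum ?d ?d (\<lambda>j. sample_term R (m t) (p t) t (\<omega> j)) {..<m t})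
      (mat_sum ?d ?d (\<lambda>j. E t) {..<m t})" if t: "t < s" for \<theta> t
    by (rule exp_dominated_independent_sum[where X = "\<lambda>j. sample_term R (m t) (p t) t"])
       (use draw[OF t] in auto)
  then have "exp_dominated ?d \<theta> (sampling Regime2 s m p) (sample_sum R s m p) B" for \<theta>
    unfolding sample_sum_def[abs_def] B_def sampling.simps
    by (intro exp_dominated_independent_sum
        [where X = "\<lambda>t \<omega>. mat_sum ?d ?d (\<lambda>j. sample_term R (m t) (p t) t (\<omega> j)) {..<m t}"]) auto
  moreover have "v \<bullet> (B *\<^sub>v v) = (v \<bullet> (Y_mat k s lam *\<^sub>v v)) / R" if v: "v \<in> carrier_vec ?d" for v :: "real Matrix.vec"
  proof -
    have E: "v \<bullet> (E t *\<^sub>v v) = (block t *\<^sub>v v) \<bullet> (block t *\<^sub>v v) / (R * real (m t))" if t: "t < s" for t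
      unfolding E_def sample_term_mean[OF v p[OF t] m[OF t], of R t, symmetric]
      by (subst quadratic_form_mat_sum[OF sym_mat_carrier[OF sym_mat_smult[OF sample_term_sym]] v])
         (rule sum.cong[OF refl], rule quadratic_form_smult[OF sym_mat_carrier[OF sample_term_sym] v])
    have Ec: "E t \<in> carrier_mat ?d ?d" for t by (simp add: E_def)
    have "v \<bullet> (B *\<^sub>v v) = (\<Sum>t<s. \<Sum>j<m t. v \<bullet> (E t *\<^sub>v v))"
      unfolding B_def
      by (subst quadratic_form_mat_sum[OF mat_sum_carrier v], rule sum.cong[OF refl],
          rule quadratic_form_mat_sum[OF Ec v])
    also have "\<dots> = (\<Sum>t<s. (block t *\<^sub>v v) \<bullet> (block t *\<^sub>v v) / R)"
      using m R by (intro sum.cong refl) (simp add: E)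
    finally show ?thesis by (simp add: Y_mat_quadratic_form[OF v] sum_divide_distrib)
  qed
  ultimately show ?thesis by (rule that)
qed

text \<open>
  A node is observed at all times at once, so its contributions at different times are dependent and
  form one summand. This is why the coherence of this regime sums over the times before taking the
  norm.
\<close>

lemma exp_dominated_regime1:
  assumes same: "\<And>t. t < s \<Longrightarrow> p t = p 0 \<and> m t = m 0"
    and p: "set_pmf (p 0) = {..<n}" and R: "0 < R" and m: "0 < m 0"
    and coh: "\<And>l (v :: real Matrix.vec). l < n \<Longrightarrow> v \<in> carrier_vec (2 * k) \<Longrightarrow>
      (\<Sum>t<s. (Matrix.row (block t) l \<bullet> v)\<^sup>2) \<le> pmf (p 0) l * (real (m 0) * R) * (v \<bullet> v)"
  obtains B where "\<And>\<theta>. exp_dominated (2 * k) \<theta> (sampling Regime1 s m p) (sample_sum R s m p) B"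
    "\<And>v :: real Matrix.vec. v \<in> carrier_vec (2 * k) \<Longrightarrow> v \<bullet> (B *\<^sub>v v) = (v \<bullet> (Y_mat k s lam *\<^sub>v v)) / R"
proof -
  let ?d = "2 * k"
  define Z where "Z l = mat_sum ?d ?d (\<lambda>t. sample_term R (m 0) (p 0) t l) {..<s}" for l
  define E where "E = mat_sum ?d ?d (\<lambda>l. pmf (p 0) l \<cdot>\<^sub>m Z l) {..<n}"
  define B where "B = mat_sum ?d ?d (\<lambda>j. E) {..<m 0}"
  have pos: "0 < pmf (p 0) l" if "l < n" for l
    using p that pmf_positive_iff by fastforce
  have Zsym: "sym_mat ?d (Z l)" for l unfolding Z_def by (intro sym_mat_sum sample_term_sym)
  have Zq: "v \<bullet> (Z l *\<^sub>v v) = (\<Sum>t<s. v \<bullet> (sample_term R (m 0) (p 0) t l *\<^sub>v v))"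
    if "v \<in> carrier_vec ?d" for v :: "real Matrix.vec" and l
    unfolding Z_def by (rule quadratic_form_mat_sum[OF sym_mat_carrier[OF sample_term_sym] that])
  have draw: "exp_dominated ?d \<theta> (p 0) Z E" for \<theta>
    unfolding E_def p[symmetric]
  proof (rule exp_dominated_single)
    show "finite (set_pmf (p 0))" using p by simp
    show "sym_mat ?d (Z l)" for l by (rule Zsym)
    fix l and v :: "real Matrix.vec" assume "l \<in> set_pmf (p 0)" and v: "v \<in> carrier_vec ?d"
    then have l: "l < n" using p by simp
    have "v \<bullet> (Z l *\<^sub>v v) = (\<Sum>t<s. (Matrix.row (block t) l \<bullet> v)\<^sup>2) / (R * (real (m 0) * pmf (p 0) l))"
      unfolding Zq[OF v] sample_term_quadratic_form[OF v] by (simp add: sum_divide_distrib)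
    then show "0 \<le> v \<bullet> (Z l *\<^sub>v v) \<and> v \<bullet> (Z l *\<^sub>v v) \<le> v \<bullet> v"
      using divide_coherence_bound[OF coh[OF l v] R _ pos[OF l]] m R by (simp add: sum_nonneg)
  qed
  have sum_eq: "mat_sum ?d ?d (\<lambda>j. Z (\<omega> j)) {..<m 0} = sample_sum R s m p (\<lambda>t. \<omega>)" for \<omega>
  proof (rule eq_matI)
    fix i j assume "i < dim_row (sample_sum R s m p (\<lambda>t. \<omega>))" "j < dim_col (sample_sum R s m p (\<lambda>t. \<omega>))"
    then have ij: "i < ?d" "j < ?d" by (auto simp: sample_sum_def)
    have "(\<Sum>a<m 0. \<Sum>t<s. sample_term R (m 0) (p 0) t (\<omega> a) $$ (i, j)) =
        (\<Sum>t<s. \<Sum>a<m 0. sample_term R (m 0) (p 0) t (\<omega> a) $$ (i, j))" by (rule sum.swap)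
    also have "\<dots> = (\<Sum>t<s. \<Sum>a<m t. sample_term R (m t) (p t) t (\<omega> a) $$ (i, j))"
    proof (rule sum.cong[OF refl])
      fix t assume "t \<in> {..<s}"
      then have "p t = p 0" "m t = m 0" using same by blast+
      then show "(\<Sum>a<m 0. sample_term R (m 0) (p 0) t (\<omega> a) $$ (i, j)) =
          (\<Sum>a<m t. sample_term R (m t) (p t) t (\<omega> a) $$ (i, j))" by (simp only:)
    qed
    finally show "mat_sum ?d ?d (\<lambda>j. Z (\<omega> j)) {..<m 0} $$ (i, j) = sample_sum R s m p (\<lambda>t. \<omega>) $$ (i, j)"
      using ij by (simp add: Z_def sample_sum_def)
  qed (auto simp: sample_sum_def)
  have "exp_dominated ?d \<theta> (Pi_pmf {..<m 0} 0 (\<lambda>j. p 0)) (\<lambda>\<omega>. sample_sum R s m p (\<lambda>t. \<omega>)) B" for \<theta>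
    unfolding sum_eq[symmetric] B_def
    by (rule exp_dominated_independent_sum[where X = "\<lambda>j. Z"]) (use draw in auto)
  then have "exp_dominated ?d \<theta> (sampling Regime1 s m p) (sample_sum R s m p) B" for \<theta>
    unfolding sampling.simps
    by (rule exp_dominated_map[where f = "\<lambda>\<omega> t. \<omega>" and X = "sample_sum R s m p"])
  moreover have "v \<bullet> (B *\<^sub>v v) = (v \<bullet> (Y_mat k s lam *\<^sub>v v)) / R" if v: "v \<in> carrier_vec ?d" for v :: "real Matrix.vec"
  proof -
    have "v \<bullet> (E *\<^sub>v v) = (\<Sum>l<n. pmf (p 0) l * (v \<bullet> (Z l *\<^sub>v v)))"
      unfolding E_def
      by (subst quadratic_form_mat_sum[OF sym_mat_carrier[OF sym_mat_smult[OF Zsym]] v])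
         (rule sum.cong[OF refl], rule quadratic_form_smult[OF sym_mat_carrier[OF Zsym] v])
    also have "\<dots> = (\<Sum>t<s. \<Sum>l<n. pmf (p 0) l * (v \<bullet> (sample_term R (m 0) (p 0) t l *\<^sub>v v)))"
      unfolding Zq[OF v] sum_distrib_left by (rule sum.swap)
    also have "\<dots> = (v \<bullet> (Y_mat k s lam *\<^sub>v v)) / (R * real (m 0))"
      unfolding sample_term_mean[OF v p m] Y_mat_quadratic_form[OF v] by (simp add: sum_divide_distrib)
    finally have E: "v \<bullet> (E *\<^sub>v v) = (v \<bullet> (Y_mat k s lam *\<^sub>v v)) / (R * real (m 0))" .
    have Ec: "E \<in> carrier_mat ?d ?d" by (simp add: E_def)
    have "v \<bullet> (B *\<^sub>v v) = (\<Sum>j<m 0. v \<bullet> (E *\<^sub>v v))"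
      unfolding B_def by (rule quadratic_form_mat_sum[OF Ec v])
    then show ?thesis using m by (simp add: E)
  qed
  ultimately show ?thesis by (rule that)
qed

lemma nu2_coherence:
  assumes q: "set_pmf q = {..<n}" and l: "l < n" and v: "v \<in> carrier_vec (2 * k)"
  shows "(Matrix.row (block t) l \<bullet> v)\<^sup>2 \<le> pmf q l * nu2 n k U lam q t * (v \<bullet> v)"
proof -
  let ?r = "Matrix.row (block t) l"
  let ?f = "\<lambda>l. 1 / pmf q l * (enorm ((block t)\<^sup>T *\<^sub>v unit_vec n l))\<^sup>2"
  have pos: "0 < pmf q l" using q l pmf_positive_iff by fastforce
  have "(block t)\<^sup>T *\<^sub>v unit_vec n l = ?r"
    using block[of t] l by (intro eq_vecI) auto
  then have "1 / pmf q l * (?r \<bullet> ?r) = ?f l" by (simp add: enorm_power2)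
  also have "\<dots> \<le> nu2 n k U lam q t"
    unfolding nu2_def block_def[symmetric] using l by (intro Max_ge) auto
  finally have "?r \<bullet> ?r \<le> pmf q l * nu2 n k U lam q t" using pos by (simp add: field_simps)
  then have "(?r \<bullet> ?r) * (v \<bullet> v) \<le> pmf q l * nu2 n k U lam q t * (v \<bullet> v)"
    by (intro mult_right_mono scalar_prod_self_nonneg)
  then show ?thesis using scalar_prod_le[OF block_row v, of t l] by linarith
qed

text \<open>
  The matrix in the coherence is the sum over the times of the Gram matrices of the rows at the node \<open>l\<close>,
  so its quadratic form is the left-hand side.
\<close>

lemma nu1_coherence:
  assumes q: "set_pmf q = {..<n}" and l: "l < n" and v: "v \<in> carrier_vec (2 * k)"
  shows "(\<Sum>t<s. (Matrix.row (block t) l \<bullet> v)\<^sup>2) \<le> pmf q l * nu1 n k s U lam q * (v \<bullet> v)"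
proof -
  let ?D = "\<lambda>l. mat_of_cols n [unit_vec n l] * mat_of_rows n [unit_vec n l] :: real Matrix.mat"
  let ?F = "\<lambda>l t. Lam_col k lam t * V\<^sup>T * ?D l * V * Lam_row k lam t"
  let ?N = "\<lambda>l. mat_sum (2 * k) (2 * k) (?F l) {..<s}"
  have pos: "0 < pmf q l" using q l pmf_positive_iff by fastforce
  have D: "?D l = outer n (unit_vec n l)"
    by (rule eq_matI) (auto simp: outer_def scalar_prod_def mat_of_cols_def mat_of_rows_def)
  have Dc: "outer n (unit_vec n l) \<in> carrier_mat n n" by (simp add: outer_def)
  have F: "?F l t = (block t)\<^sup>T * (outer n (unit_vec n l) * block t)" for t
  proof -
    have c: "Lam_col k lam t \<in> carrier_mat (2 * k) k" "V\<^sup>T \<in> carrier_mat k n"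
      using Lam_row[of t] V by (auto simp: Lam_col_eq)
    have "Lam_col k lam t * V\<^sup>T = (block t)\<^sup>T"
      unfolding block_def Lam_col_eq by (rule transpose_mult[OF V Lam_row, symmetric])
    then have "?F l t = (block t)\<^sup>T * outer n (unit_vec n l) * V * Lam_row k lam t" unfolding D by simp
    also have "\<dots> = (block t)\<^sup>T * outer n (unit_vec n l) * block t"
      unfolding block_def using V Lam_row[of t] Dc block[of t]
      by (intro assoc_mult_mat[of _ "2 * k" n _ k]) (auto simp: block_def[symmetric])
    also have "\<dots> = (block t)\<^sup>T * (outer n (unit_vec n l) * block t)"
      using Dc block[of t] by (intro assoc_mult_mat[of _ "2 * k" n _ n]) auto
    finally show ?thesis .
  qed
  have Fc: "?F l t \<in> carrier_mat (2 * k) (2 * k)" for t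
    unfolding F using block[of t] Dc
    by (intro mult_carrier_mat[of _ "2 * k" n] mult_carrier_mat[of _ n n]) auto
  have Fq: "v \<bullet> (?F l t *\<^sub>v v) = (Matrix.row (block t) l \<bullet> v)\<^sup>2" for t
  proof -
    let ?b = "block t *\<^sub>v v"
    have b: "?b \<in> carrier_vec n" by (rule mult_mat_vec_carrier[OF block v])
    have OB: "outer n (unit_vec n l) * block t \<in> carrier_mat n (2 * k)"
      using Dc block by (rule mult_carrier_mat)
    have "?F l t *\<^sub>v v = (block t)\<^sup>T *\<^sub>v (outer n (unit_vec n l) *\<^sub>v ?b)"
      unfolding F using block[of t] OB v
      by (subst assoc_mult_mat_vec[of _ "2 * k" n _ "2 * k"])
         (auto simp: assoc_mult_mat_vec[OF Dc block v])
    then have "v \<bullet> (?F l t *\<^sub>v v) = ?b \<bullet> (outer n (unit_vec n l) *\<^sub>v ?b)"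
      using transpose_vec_mult_scalar[OF block v mult_mat_vec_carrier[OF Dc b], of t] v block[of t] b Dc
        mult_mat_vec_carrier[OF Dc b]
      by (simp add: comm_scalar_prod[of v "2 * k"] comm_scalar_prod[of ?b n] mult_mat_vec_carrier[of _ "2 * k" n])
    also have "\<dots> = (?b $ l)\<^sup>2"
      unfolding quadratic_form_outer[OF unit_vec_carrier b] using b l by simp
    finally show ?thesis using block[of t] l by simp
  qed
  have "(\<Sum>t<s. (Matrix.row (block t) l \<bullet> v)\<^sup>2) = v \<bullet> (?N l *\<^sub>v v)"
    unfolding quadratic_form_mat_sum[OF Fc v] Fq ..
  also have "\<dots> \<le> spectral_norm (?N l) * (v \<bullet> v)"
    by (rule quadratic_form_le_spectral_norm[OF mat_sum_carrier v])
  also have "\<dots> \<le> pmf q l * nu1 n k s U lam q * (v \<bullet> v)"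
  proof (intro mult_right_mono scalar_prod_self_nonneg)
    have "1 / pmf q l * spectral_norm (?N l) \<le> nu1 n k s U lam q"
      unfolding nu1_def using l by (intro Max_ge) auto
    then show "spectral_norm (?N l) \<le> pmf q l * nu1 n k s U lam q"
      using pos by (simp add: field_simps)
  qed
  finally show ?thesis .
qed


lemma sampling_support:
  assumes \<omega>: "\<omega> \<in> set_pmf (sampling r s m p)" and p: "\<And>t. t < s \<Longrightarrow> set_pmf (p t) = {..<n}"
    and same: "r = Regime1 \<Longrightarrow> \<forall>t<s. p t = p 0 \<and> m t = m 0" and t: "t < s" and j: "j < m t"
  shows "\<omega> t j < n"
proof (cases r)
  case Regime1
  have "0 < s" using t by simp
  with Regime1 \<omega> have "\<exists>f. \<omega> = (\<lambda>t. f) \<and> f \<in> PiE_dflt {..<m 0} 0 (\<lambda>j. {..<n})"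
    using p[of 0] by (auto simp: set_Pi_pmf comp_def)
  moreover have "j < m 0" using same[OF Regime1] t j by metis
  ultimately show ?thesis by (auto simp: PiE_dflt_def)
next
  case Regime2
  with \<omega> have "\<omega> t \<in> set_pmf (Pi_pmf {..<m t} 0 (\<lambda>j. p t))"
    using t by (auto simp: set_Pi_pmf PiE_dflt_def)
  then show ?thesis using j p[OF t] by (auto simp: set_Pi_pmf PiE_dflt_def)
qed

text \<open>
  The bound \<open>R = c \<delta>\<^sup>2 / (3 ln (4 k / \<epsilon>))\<close> on the summands is chosen so that the two tails,
  each of size \<open>2 k exp (- c \<delta>\<^sup>2 / (3 R))\<close>, add up to exactly \<open>\<epsilon>\<close>. The sample size condition says
  that the coherence is at most \<open>R\<close> times the sample size.
\<close>

lemma sample_energy_concentration: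
  assumes s: "1 \<le> s" and \<epsilon>: "0 < \<epsilon>" "\<epsilon> < 1" and \<delta>: "0 < \<delta>" "\<delta> < 1"
    and c_pos: "0 < c_low k s lam"
    and p: "\<forall>t<s. set_pmf (p t) = {..<n}"
    and regime1: "r = Regime1 \<Longrightarrow>
      (\<forall>t<s. p t = p 0 \<and> m t = m 0) \<and>
      real (m 0) \<ge> 3 * nu1 n k s U lam (p 0) / (c_low k s lam * \<delta>\<^sup>2) * ln (4 * real k / \<epsilon>)"
    and regime2: "r = Regime2 \<Longrightarrow>
      (\<forall>t<s. real (m t) \<ge> 3 * nu2 n k U lam (p t) t / (c_low k s lam * \<delta>\<^sup>2) * ln (4 * real k / \<epsilon>))"
  shows "1 - \<epsilon> \<le> measure_pmf.prob (sampling r s m p)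
    {\<omega>. \<forall>v\<in>carrier_vec (2 * k). (1 - \<delta>) * c_low k s lam * (v \<bullet> v) \<le> sample_energy s m p \<omega> v \<and>
       sample_energy s m p \<omega> v \<le> (1 + \<delta>) * C_up k s lam * (v \<bullet> v)}"
proof -
  define c where "c = c_low k s lam"
  define C where "C = C_up k s lam"
  define \<rho> where "\<rho> = ln (4 * real k / \<epsilon>)"
  define R where "R = c * \<delta>\<^sup>2 / (3 * \<rho>)"
  have c: "0 < c" using c_pos by (simp add: c_def)
  have k4: "\<epsilon> < 4 * real k" using k \<epsilon> by linarith
  then have \<rho>: "0 < \<rho>" unfolding \<rho>_def using \<epsilon> by (intro ln_gt_zero) simp
  have R: "0 < R" using c \<rho> \<delta> by (simp add: R_def)
  have size: "\<nu> \<le> real M * R" if "3 * \<nu> / (c * \<delta>\<^sup>2) * \<rho> \<le> real M" for \<nu> M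
  proof -
    have "3 * \<nu> / (c * \<delta>\<^sup>2) * \<rho> * R \<le> real M * R" using that R by (intro mult_right_mono) auto
    then show ?thesis using c \<delta> \<rho> by (simp add: R_def)
  qed
  have p': "\<And>t. t < s \<Longrightarrow> set_pmf (p t) = {..<n}" using p by blast
  have "0 < s" using s by simp
  obtain B where B: "\<And>\<theta>. exp_dominated (2 * k) \<theta> (sampling r s m p) (sample_sum R s m p) B"
    and BY: "\<And>v :: real Matrix.vec. v \<in> carrier_vec (2 * k) \<Longrightarrow> v \<bullet> (B *\<^sub>v v) = (v \<bullet> (Y_mat k s lam *\<^sub>v v)) / R"
  proof (cases r)
    case Regime1
    have same: "\<And>t. t < s \<Longrightarrow> p t = p 0 \<and> m t = m 0" using regime1[OF Regime1] by blast
    have \<nu>: "nu1 n k s U lam (p 0) \<le> real (m 0) * R"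
      using regime1[OF Regime1] by (intro size) (simp add: c_def \<rho>_def)
    have coh: "(\<Sum>t<s. (Matrix.row (block t) l \<bullet> v)\<^sup>2) \<le> pmf (p 0) l * (real (m 0) * R) * (v \<bullet> v)"
      if "l < n" "v \<in> carrier_vec (2 * k)" for l and v :: "real Matrix.vec"
      using nu1_coherence[OF p'[OF \<open>0 < s\<close>] that, where s = s]
        mult_right_mono[OF mult_left_mono[OF \<nu> pmf_nonneg] scalar_prod_self_nonneg[of v], of "p 0" l]
      by linarith
    have m: "0 < m 0"
    proof (rule ccontr)
      assume "\<not> ?thesis"
      then have z: "(\<Sum>t<s. (Matrix.row (block t) l \<bullet> v)\<^sup>2) \<le> 0"
        if "l < n" "v \<in> carrier_vec (2 * k)" for l and v :: "real Matrix.vec"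
        using coh[OF that] by simp
      have "(Matrix.row (block 0) l \<bullet> v)\<^sup>2 \<le> 0"
        if "l < n" "v \<in> carrier_vec (2 * k)" for l and v :: "real Matrix.vec"
        by (rule order_trans[OF member_le_sum[of 0 "{..<s}" "\<lambda>t. (Matrix.row (block t) l \<bullet> v)\<^sup>2"] z[OF that]])
           (use \<open>0 < s\<close> in auto)
      then show False using block_not_annihilated[of 0] by auto
    qed
    show ?thesis
      using exp_dominated_regime1[where s = s and p = p and m = m, OF same p'[OF \<open>0 < s\<close>] R m coh] that
      unfolding Regime1 by blast
  next
    case Regime2
    have \<nu>: "nu2 n k U lam (p t) t \<le> real (m t) * R" if "t < s" for t
      using regime2[OF Regime2] that by (intro size) (simp add: c_def \<rho>_def)
    have coh: "(Matrix.row (block t) l \<bullet> v)\<^sup>2 \<le> pmf (p t) l * (real (m t) * R) * (v \<bullet> v)"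
      if "t < s" "l < n" "v \<in> carrier_vec (2 * k)" for t l and v :: "real Matrix.vec"
      using nu2_coherence[OF p'[OF that(1)] that(2,3), of t]
        mult_right_mono[OF mult_left_mono[OF \<nu>[OF that(1)] pmf_nonneg] scalar_prod_self_nonneg[of v], of "p t" l]
      by linarith
    have m: "0 < m t" if t: "t < s" for t
    proof (rule ccontr)
      assume "\<not> ?thesis"
      then have "(Matrix.row (block t) l \<bullet> v)\<^sup>2 \<le> 0"
        if "l < n" "v \<in> carrier_vec (2 * k)" for l and v :: "real Matrix.vec"
        using coh[OF t that] by simp
      then show False using block_not_annihilated[of t] by auto
    qed
    show ?thesis
      using exp_dominated_regime2[where s = s and p = p and m = m, OF p' R m coh] that
      unfolding Regime2 by blast
  qed
  have d: "0 < 2 * k" using k by simp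
  note Yb = spectrum_bounds[OF Y_mat_sym[of s] d]
  have "1 - 2 * real (2 * k) * exp (- (c / R * \<delta>\<^sup>2 / 3)) \<le> measure_pmf.prob (sampling r s m p)
     {\<omega>. \<forall>v\<in>carrier_vec (2 * k). (1 - \<delta>) * (c / R) * (v \<bullet> v) \<le> v \<bullet> (sample_sum R s m p \<omega> *\<^sub>v v) \<and>
        v \<bullet> (sample_sum R s m p \<omega> *\<^sub>v v) \<le> (1 + \<delta>) * (C / R) * (v \<bullet> v)}"
  proof (rule matrix_chernoff[OF B \<delta>])
    fix v :: "real Matrix.vec" assume v: "v \<in> carrier_vec (2 * k)"
    show "c / R * (v \<bullet> v) \<le> v \<bullet> (B *\<^sub>v v)"
      using Yb(1)[OF v] R by (simp add: BY[OF v] c_def c_low_def divide_right_mono)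
    show "v \<bullet> (B *\<^sub>v v) \<le> C / R * (v \<bullet> v)"
      using Yb(2)[OF v] R by (simp add: BY[OF v] C_def C_up_def divide_right_mono)
  next
    show "0 \<le> c / R" using c R by simp
    show "c / R \<le> C / R" using Yb(3) R by (simp add: c_def C_def c_low_def C_up_def divide_right_mono)
  qed
  also have "{\<omega>. \<forall>v\<in>carrier_vec (2 * k). (1 - \<delta>) * (c / R) * (v \<bullet> v) \<le> v \<bullet> (sample_sum R s m p \<omega> *\<^sub>v v) \<and>
        v \<bullet> (sample_sum R s m p \<omega> *\<^sub>v v) \<le> (1 + \<delta>) * (C / R) * (v \<bullet> v)} =
      {\<omega>. \<forall>v\<in>carrier_vec (2 * k). (1 - \<delta>) * c * (v \<bullet> v) \<le> sample_energy s m p \<omega> v \<and>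
       sample_energy s m p \<omega> v \<le> (1 + \<delta>) * C * (v \<bullet> v)}"
    using R by (intro Collect_cong ball_cong refl) (simp add: sample_sum_quadratic_form divide_le_cancel)
  also have "2 * real (2 * k) * exp (- (c / R * \<delta>\<^sup>2 / 3)) = \<epsilon>"
  proof -
    have "c / R * \<delta>\<^sup>2 / 3 = \<rho>" using c \<delta> \<rho> by (simp add: R_def field_simps)
    then have "exp (- (c / R * \<delta>\<^sup>2 / 3)) = \<epsilon> / (4 * real k)"
      using k \<epsilon> by (simp add: \<rho>_def exp_minus)
    then show ?thesis using k by simp
  qed
  finally show ?thesis by (simp add: c_def C_def)
qed

text \<open>
  For the second claim the noise consists of the samples of a unit vector \<open>u\<close> of the signal space.
  The residual then vanishes at \<open>w + u\<close>, and the first claim with zero noise, applied at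
  \<open>w + u\<close>, shows that this is the only minimizer.
\<close>

lemma reconstruction_of_energy_bounds:
  assumes \<omega>: "\<And>t j. t < s \<Longrightarrow> j < m t \<Longrightarrow> \<omega> t j < n" and lo: "0 < lo" and hi: "0 < hi"
    and bounds: "\<And>v. v \<in> carrier_vec (2 * k) \<Longrightarrow>
      lo * (v \<bullet> v) \<le> sample_energy s m p \<omega> v \<and> sample_energy s m p \<omega> v \<le> hi * (v \<bullet> v)"
    and w: "w \<in> span_U_tilde n k U"
  shows "\<forall>e \<in> carrier_vec (\<Sum>t<s. m t). \<forall>w'.
      ls_solution n k s U lam m p \<omega> (S_cal n s m \<omega> *\<^sub>v pi_op n k s U lam w + e) w' \<longrightarrow>
      enorm (w' - w) \<le> 2 / sqrt lo * enorm ((W_cal s m * P_cal s m p \<omega>) *\<^sub>v e)"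
    and "\<exists>e \<in> carrier_vec (\<Sum>t<s. m t). e \<noteq> 0\<^sub>v (\<Sum>t<s. m t) \<and>
      (\<exists>w'. ls_solution n k s U lam m p \<omega> (S_cal n s m \<omega> *\<^sub>v pi_op n k s U lam w + e) w') \<and>
      (\<forall>w'. ls_solution n k s U lam m p \<omega> (S_cal n s m \<omega> *\<^sub>v pi_op n k s U lam w + e) w' \<longrightarrow>
        enorm (w' - w) \<ge> 1 / sqrt hi * enorm ((W_cal s m * P_cal s m p \<omega>) *\<^sub>v e))"
proof -
  let ?M = "\<Sum>t<s. m t"
  define D where "D = W_cal s m * P_cal s m p \<omega>"
  define T where "T u = S_cal n s m \<omega> *\<^sub>v pi_op n k s U lam u" for u
  define S where "S = span_U_tilde n k U"
  have D: "D \<in> carrier_mat ?M ?M" unfolding D_def by (rule mult_carrier_mat[OF W_cal_carrier P_cal_carrier])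
  have T: "T u \<in> carrier_vec ?M" for u unfolding T_def by (rule mult_mat_vec_carrier[OF S_cal_carrier pi_op_carrier])
  have T_add: "T (u + w) = T u + T w" if "u \<in> S" "w \<in> S" for u w
    unfolding T_def pi_op_add[OF that[unfolded S_def]]
    by (rule mult_add_distrib_mat_vec[OF S_cal_carrier pi_op_carrier pi_op_carrier])
  have S_carrier: "S \<subseteq> carrier_vec (2 * n)"
    using mult_mat_vec_carrier[OF Ut] by (auto simp: S_def span_eq)
  have S_diff: "u - w \<in> S" if uw: "u \<in> S" "w \<in> S" for u w
  proof -
    obtain a b where ab: "a \<in> carrier_vec (2 * k)" "b \<in> carrier_vec (2 * k)" "u = Ut *\<^sub>v a" "w = Ut *\<^sub>v b"
      using uw by (auto simp: S_def span_eq)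
    have "u - w = Ut *\<^sub>v (a - b)" unfolding ab(3,4) by (rule mult_minus_distrib_mat_vec[OF Ut ab(1,2), symmetric])
    then show ?thesis using ab(1,2) by (auto simp: S_def span_eq)
  qed
  have S_add: "u + w \<in> S" if uw: "u \<in> S" "w \<in> S" for u w
  proof -
    obtain a b where ab: "a \<in> carrier_vec (2 * k)" "b \<in> carrier_vec (2 * k)" "u = Ut *\<^sub>v a" "w = Ut *\<^sub>v b"
      using uw by (auto simp: S_def span_eq)
    have "u + w = Ut *\<^sub>v (a + b)" unfolding ab(3,4) by (rule mult_add_distrib_mat_vec[OF Ut ab(1,2), symmetric])
    then show ?thesis using ab(1,2) by (auto simp: S_def span_eq)
  qed
  have frame: "lo * (enorm u)\<^sup>2 \<le> (enorm (D *\<^sub>v T u))\<^sup>2 \<and> (enorm (D *\<^sub>v T u))\<^sup>2 \<le> hi * (enorm u)\<^sup>2"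
    if u: "u \<in> S" for u
  proof -
    obtain a where a: "a \<in> carrier_vec (2 * k)" "u = Ut *\<^sub>v a" using u by (auto simp: S_def span_eq)
    have "(enorm (D *\<^sub>v T u))\<^sup>2 = sample_energy s m p \<omega> a"
      unfolding D_def T_def a(2) by (rule weighted_sample_norm[OF a(1) \<omega>])
    then show ?thesis using bounds[OF a(1)] unfolding a(2) Ut_norm[OF a(1)] enorm_power2 by simp
  qed
  have lower: "\<And>u. u \<in> S \<Longrightarrow> lo * (enorm u)\<^sup>2 \<le> (enorm (D *\<^sub>v T u))\<^sup>2" using frame by blast
  have sol: "ls_solution n k s U lam m p \<omega> z w' \<longleftrightarrow>
      w' \<in> S \<and> (\<forall>y\<in>S. enorm (D *\<^sub>v (T w' - z)) \<le> enorm (D *\<^sub>v (T y - z)))" for z w'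
    by (auto simp: ls_solution_def is_arg_min_def D_def T_def S_def not_less)
  have wS: "w \<in> S" using w by (simp add: S_def)
  have stability: "enorm (w' - w) \<le> 2 / sqrt lo * enorm (D *\<^sub>v e)"
    if "w \<in> S" "w' \<in> S" "e \<in> carrier_vec ?M"
      "enorm (D *\<^sub>v (T w' - (T w + e))) \<le> enorm (D *\<^sub>v (T w - (T w + e)))" for w w' e
    by (rule least_squares_stability[where T = T and S = S, OF D _ _ S_carrier _ lo _ that])
       (simp_all add: T T_add S_diff lower)
  show "\<forall>e \<in> carrier_vec ?M. \<forall>w'.
      ls_solution n k s U lam m p \<omega> (S_cal n s m \<omega> *\<^sub>v pi_op n k s U lam w + e) w' \<longrightarrow>
      enorm (w' - w) \<le> 2 / sqrt lo * enorm ((W_cal s m * P_cal s m p \<omega>) *\<^sub>v e)"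
    unfolding sol T_def[symmetric] D_def[symmetric]
  proof (intro ballI allI impI)
    fix e w' assume e: "e \<in> carrier_vec ?M"
      and w': "w' \<in> S \<and> (\<forall>y\<in>S. enorm (D *\<^sub>v (T w' - (T w + e))) \<le> enorm (D *\<^sub>v (T y - (T w + e))))"
    show "enorm (w' - w) \<le> 2 / sqrt lo * enorm (D *\<^sub>v e)"
      by (rule stability[OF wS _ e]) (use w' wS in auto)
  qed
  define u where "u = Ut *\<^sub>v unit_vec (2 * k) 0"
  have uS: "u \<in> S" by (auto simp: S_def span_eq u_def)
  have u1: "enorm u = 1" using k Ut_norm[of "unit_vec (2 * k) 0"] by (simp add: u_def enorm_def)
  have D0: "D *\<^sub>v 0\<^sub>v ?M = 0\<^sub>v ?M" using D by (intro eq_vecI) auto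
  have Tu: "T u \<noteq> 0\<^sub>v ?M"
  proof
    assume "T u = 0\<^sub>v ?M"
    then have "lo * 1 \<le> 0" using lower[OF uS] u1 D0 by simp
    then show False using lo by simp
  qed
  have wuS: "w + u \<in> S" by (rule S_add[OF wS uS])
  have res0: "D *\<^sub>v (T (w + u) - (T w + T u)) = 0\<^sub>v ?M"
  proof -
    have "T (w + u) - (T w + T u) = 0\<^sub>v ?M" unfolding T_add[OF wS uS] using T[of w] T[of u] by (intro eq_vecI) auto
    then show ?thesis by (simp add: D0)
  qed
  have exact: "w' = w + u"
    if w': "w' \<in> S" and min: "\<forall>y\<in>S. enorm (D *\<^sub>v (T w' - (T w + T u))) \<le> enorm (D *\<^sub>v (T y - (T w + T u)))" for w'
  proof -
    have e0: "T (w + u) + 0\<^sub>v ?M = T w + T u" unfolding T_add[OF wS uS] using T[of w] T[of u] by simp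
    have "enorm (w' - (w + u)) \<le> 2 / sqrt lo * enorm (D *\<^sub>v 0\<^sub>v ?M)"
      by (rule stability[OF wuS w']) (use min wuS e0 in auto)
    then have "enorm (w' - (w + u)) = 0" using enorm_nonneg[of "w' - (w + u)"] by (simp add: D0)
    moreover have c: "w' \<in> carrier_vec (2 * n)" "w + u \<in> carrier_vec (2 * n)" using S_carrier w' wuS by auto
    ultimately have "w' - (w + u) = 0\<^sub>v (2 * n)" using enorm_eq_0_iff[of "w' - (w + u)" "2 * n"] by simp
    then have z: "(w' - (w + u)) $ i = 0" if "i < 2 * n" for i using that by simp
    have cwu: "w \<in> carrier_vec (2 * n)" "u \<in> carrier_vec (2 * n)" using S_carrier wS uS by auto
    show ?thesis
    proof (rule eq_vecI)
      fix i assume "i < dim_vec (w + u)"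
      then have "i < 2 * n" using cwu by simp
      then show "w' $ i = (w + u) $ i" using z[of i] c(1) cwu by simp
    qed (use c(1) cwu in simp)
  qed
  show "\<exists>e \<in> carrier_vec ?M. e \<noteq> 0\<^sub>v ?M \<and>
      (\<exists>w'. ls_solution n k s U lam m p \<omega> (S_cal n s m \<omega> *\<^sub>v pi_op n k s U lam w + e) w') \<and>
      (\<forall>w'. ls_solution n k s U lam m p \<omega> (S_cal n s m \<omega> *\<^sub>v pi_op n k s U lam w + e) w' \<longrightarrow>
        enorm (w' - w) \<ge> 1 / sqrt hi * enorm ((W_cal s m * P_cal s m p \<omega>) *\<^sub>v e))"
    unfolding sol T_def[symmetric] D_def[symmetric]
  proof (intro bexI[of _ "T u"] conjI allI impI exI[of _ "w + u"] ballI)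
    show "T u \<noteq> 0\<^sub>v ?M" by (rule Tu)
    show "T u \<in> carrier_vec ?M" by (rule T)
    show "w + u \<in> S" by (rule wuS)
    fix y
    show "enorm (D *\<^sub>v (T (w + u) - (T w + T u))) \<le> enorm (D *\<^sub>v (T y - (T w + T u)))"
      unfolding res0 by (simp add: enorm_nonneg)
  next
    fix w' assume "w' \<in> S \<and> (\<forall>y\<in>S. enorm (D *\<^sub>v (T w' - (T w + T u))) \<le> enorm (D *\<^sub>v (T y - (T w + T u))))"
    then have "w' = w + u" using exact by blast
    moreover have "w + u - w = u"
    proof -
      have "w \<in> carrier_vec (2 * n)" "u \<in> carrier_vec (2 * n)" using S_carrier wS uS by auto
      then show ?thesis by (intro eq_vecI) auto
    qed
    moreover have "enorm (D *\<^sub>v T u) \<le> sqrt hi"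
      using frame[OF uS] u1 real_le_rsqrt[of "enorm (D *\<^sub>v T u)" hi] by simp
    ultimately show "1 / sqrt hi * enorm (D *\<^sub>v T u) \<le> enorm (w' - w)"
      using u1 hi by (simp add: divide_le_eq)
  qed
qed

end

theorem theorem5:
  fixes n k s :: nat
    and W A U :: "real Matrix.mat"
    and \<theta> lam :: "nat \<Rightarrow> real"
    and p :: "nat \<Rightarrow> nat pmf"
    and m :: "nat \<Rightarrow> nat"
    and r :: regime
    and \<epsilon> \<delta> :: real
  assumes graph: "weighted_graph n W"
    and eig: "ordered_eigendecomposition n (normalized_laplacian n W) U \<theta>"
    and A: "A = U * mat_diag n lam * transpose_mat U"
    and s: "1 \<le> s"
    and k: "1 \<le> k" "k \<le> n"
    and \<epsilon>: "0 < \<epsilon>" "\<epsilon> < 1"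
    and \<delta>: "0 < \<delta>" "\<delta> < 1"
    and c_pos: "0 < c_low k s lam"
    and p: "\<forall>t<s. set_pmf (p t) = {..<n}"
    and regime1: "r = Regime1 \<Longrightarrow>
      (\<forall>t<s. p t = p 0 \<and> m t = m 0) \<and>
      real (m 0) \<ge> 3 * nu1 n k s U lam (p 0) / (c_low k s lam * \<delta>\<^sup>2) * ln (4 * real k / \<epsilon>)"
    and regime2: "r = Regime2 \<Longrightarrow>
      (\<forall>t<s. real (m t) \<ge> 3 * nu2 n k U lam (p t) t / (c_low k s lam * \<delta>\<^sup>2) * ln (4 * real k / \<epsilon>))"
  shows "measure_pmf.prob (sampling r s m p)
    {\<omega>. \<forall>w \<in> span_U_tilde n k U.
      (\<forall>e \<in> carrier_vec (\<Sum>t<s. m t). \<forall>w'.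
         ls_solution n k s U lam m p \<omega> (S_cal n s m \<omega> *\<^sub>v pi_op n k s U lam w + e) w' \<longrightarrow>
         enorm (w' - w) \<le>
           2 / sqrt ((1 - \<delta>) * c_low k s lam) * enorm ((W_cal s m * P_cal s m p \<omega>) *\<^sub>v e)) \<and>
      (\<exists>e \<in> carrier_vec (\<Sum>t<s. m t). e \<noteq> 0\<^sub>v (\<Sum>t<s. m t) \<and>
         (\<exists>w'. ls_solution n k s U lam m p \<omega> (S_cal n s m \<omega> *\<^sub>v pi_op n k s U lam w + e) w') \<and>
         (\<forall>w'. ls_solution n k s U lam m p \<omega> (S_cal n s m \<omega> *\<^sub>v pi_op n k s U lam w + e) w' \<longrightarrow>
           enorm (w' - w) \<ge>
             1 / sqrt ((1 + \<delta>) * C_up k s lam) * enorm ((W_cal s m * P_cal s m p \<omega>) *\<^sub>v e)))}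
    \<ge> 1 - \<epsilon>"
proof -
  have U: "U \<in> carrier_mat n n" "U\<^sup>T * U = 1\<^sub>m n"
    using eig by (auto simp: ordered_eigendecomposition_def)
  interpret spectral_frame n k U lam by unfold_locales (use U k in auto)
  let ?\<mu> = "sampling r s m p"
  let ?E = "{\<omega>. \<forall>v\<in>carrier_vec (2 * k).
      (1 - \<delta>) * c_low k s lam * (v \<bullet> v) \<le> sample_energy s m p \<omega> v \<and>
      sample_energy s m p \<omega> v \<le> (1 + \<delta>) * C_up k s lam * (v \<bullet> v)}"
  have "c_low k s lam \<le> C_up k s lam"
    using spectrum_bounds(3)[OF Y_mat_sym[of s]] k by (simp add: c_low_def C_up_def)
  then have lo: "0 < (1 - \<delta>) * c_low k s lam" and hi: "0 < (1 + \<delta>) * C_up k s lam"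
    using \<delta> c_pos by auto
  have "1 - \<epsilon> \<le> measure_pmf.prob ?\<mu> ?E"
    by (rule sample_energy_concentration[OF s \<epsilon> \<delta> c_pos p regime1 regime2])
  also have "\<dots> = measure_pmf.prob ?\<mu> (?E \<inter> set_pmf ?\<mu>)" by (simp add: measure_Int_set_pmf)
  finally have E: "1 - \<epsilon> \<le> measure_pmf.prob ?\<mu> (?E \<inter> set_pmf ?\<mu>)" .
  show ?thesis
  proof (rule order_trans[OF E measure_pmf.finite_measure_mono], rule subsetI, rule CollectI, rule ballI, goal_cases)
    case (1 \<omega> w)
    then have \<omega>: "\<omega> \<in> ?E" "\<omega> \<in> set_pmf ?\<mu>" and w: "w \<in> span_U_tilde n k U" by auto
    have nodes: "\<omega> t j < n" if "t < s" "j < m t" for t j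
      by (rule sampling_support[OF \<omega>(2) _ _ that]) (use p regime1 in blast)+
    have energy: "(1 - \<delta>) * c_low k s lam * (v \<bullet> v) \<le> sample_energy s m p \<omega> v \<and>
        sample_energy s m p \<omega> v \<le> (1 + \<delta>) * C_up k s lam * (v \<bullet> v)"
      if "v \<in> carrier_vec (2 * k)" for v
      using \<omega>(1) that by blast
    show ?case
      by (rule conjI; rule reconstruction_of_energy_bounds[OF _ lo hi _ w]) (fact nodes energy)+
  qed simp
qed

end
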